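(* Let $\nu\in[0,1)$ and let $A_{\nu,\infty}$ be the minimal operator generated by $\tau_\nu=-\frac{d^2}{dx^2}+\frac{\nu^2-1/4}{x^2}$ in $L^2(\mathbb R_+)$, with $(A_{\nu,\infty})_{\max}$ the corresponding maximal operator. Let $\xi\in C_0^1(\mathbb R_+)$ be a function such that $\xi(x)=1$ for $x\in[0,1]$. Then: (i) $A_{\nu,\infty}$ has equal deficiency indices $n_\pm(A_{\nu,\infty})=1$. (ii) $\operatorname{dom}(A_{\nu,\infty})=H_0^2(\mathbb R_+)$. (iii) $(A_{\nu,\infty})_{\max}=A_{\nu,\infty}^*$ and $$\operatorname{dom}(A_{\nu,\infty}^* )=\begin{cases} H_0^2(\mathbb R_+)\dotplus\operatorname{span}\{x^{1/2+\nu}\xi(x),\,x^{1/2-\nu}\xi(x)\}, & \nu\in(0,1),\\ H_0^2(\mathbb R_+)\dotplus\operatorname{span}\{x^{1/2}\xi(x),\,x^{1/2}\log(x)\,\xi(x)\}, & \nu=0.\end{cases}$$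
   Context: $\mathbb R_+$ denotes the half-line with endpoints $0$ and $\infty$. $C_0^1(\mathbb R_+)$ denotes the continuously differentiable functions on the half-line (up to and including the endpoint $0$, where they need not vanish) with compact support in $[0,\infty)$. The maximal operator generated by $\tau_\nu$ in $L^2(\mathbb R_+)$ acts as $\tau_\nu$ on all $f\in L^2(\mathbb R_+)$ with $f,f'$ locally absolutely continuous on $(0,\infty)$ and $\tau_\nu f\in L^2(\mathbb R_+)$. The minimal operator is the closure of the restriction of the maximal operator to functions with compact support in $(0,\infty)$. $H^2(\mathbb R_+)$ is the usual Sobolev space and $H_0^2(\mathbb R_+)=\{f\in H^2(\mathbb R_+): f(0)=f'(0)=0\}$. The deficiency indices of a closed symmetric operator $A$ are $n_\pm(A)=\dim\ker(A^*\pm iI)$. The symbol $\dotplus$ denotes a direct sum of linear spaces.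
   Formalization: The function ξ is additionally assumed to lie in H²(ℝ₊): for ξ merely in C_0^1 (e.g. ξ' not locally absolutely continuous) the functions x^{1/2±ν}ξ are not in the maximal domain, so the formula in (iii) fails; with ξ in H² it holds. *)

theory Defs
  imports "HOL-Analysis.Analysis"
begin

section \<open>The complex Hilbert space of square-integrable functions on the half-line\<close>

abbreviation half_line :: "real measure" where
  "half_line \<equiv> lebesgue_on {0<..}"

definition square_integrable :: "(real \<Rightarrow> complex) \<Rightarrow> bool" where
  "square_integrable f \<longleftrightarrow>
     f \<in> borel_measurable half_line \<and> integrable half_line (\<lambda>x. (cmod (f x))\<^sup>2)"

definition L2_eq :: "(real \<Rightarrow> complex) \<Rightarrow> (real \<Rightarrow> complex) \<Rightarrow> bool" where
  "L2_eq f g \<longleftrightarrow> square_integrable f \<and> square_integrable g \<and> (AE x in half_line. f x = g x)"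

lemma square_integrable_zero: "square_integrable (\<lambda>x. 0)"
  by (simp add: square_integrable_def)

lemma part_equivp_L2_eq: "part_equivp L2_eq"
proof (rule part_equivpI)
  show "\<exists>f. L2_eq f f"
    by (rule exI[of _ "\<lambda>x. 0"]) (simp add: L2_eq_def square_integrable_zero)
  show "symp L2_eq"
    by (simp add: symp_def L2_eq_def eq_commute)
  show "transp L2_eq"
  proof (rule transpI)
    fix f g h assume *: "L2_eq f g" "L2_eq g h"
    then have "AE x in half_line. f x = g x" "AE x in half_line. g x = h x"
      by (auto simp: L2_eq_def)
    then have "AE x in half_line. f x = h x" by eventually_elim simp
    with * show "L2_eq f h" by (simp add: L2_eq_def)
  qed
qed

text \<open>Only the values of a function on \<open>{0<..}\<close> matter for its class. For a function that is not
  square-integrable, \<open>L2_class\<close> is an unspecified element.\<close>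

quotient_type half_line_L2 = "real \<Rightarrow> complex" / partial: L2_eq
  morphisms L2_rep L2_class
  by (rule part_equivp_L2_eq)

lemma square_integrable_scale:
  assumes "square_integrable f" shows "square_integrable (\<lambda>x. c * f x)"
  using assms by (auto simp: square_integrable_def norm_mult power_mult_distrib)

lemma square_integrable_add:
  assumes f: "square_integrable f" and g: "square_integrable g"
  shows "square_integrable (\<lambda>x. f x + g x)"
proof -
  have [measurable]: "f \<in> borel_measurable half_line" "g \<in> borel_measurable half_line"
    using f g by (auto simp: square_integrable_def)
  have i: "integrable half_line (\<lambda>x. 2 * (cmod (f x))\<^sup>2 + 2 * (cmod (g x))\<^sup>2)"
    using f g by (auto simp: square_integrable_def)
  have bound: "(cmod (a + b))\<^sup>2 \<le> 2 * (cmod a)\<^sup>2 + 2 * (cmod b)\<^sup>2" for a b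
  proof -
    have "(cmod (a + b))\<^sup>2 \<le> (cmod a + cmod b)\<^sup>2"
      by (intro power_mono norm_triangle_ineq) auto
    also have "\<dots> \<le> 2 * (cmod a)\<^sup>2 + 2 * (cmod b)\<^sup>2"
      using sum_squares_bound[of "cmod a" "cmod b"] by (simp add: power2_sum)
    finally show ?thesis .
  qed
  have "integrable half_line (\<lambda>x. (cmod (f x + g x))\<^sup>2)"
    by (rule Bochner_Integration.integrable_bound[OF i]) (measurable, simp add: bound)
  then show ?thesis by (simp add: square_integrable_def)
qed

lemma borel_measurable_cnj [measurable]: "cnj \<in> borel_measurable borel"
  by (intro borel_measurable_continuous_onI continuous_intros)

lemma integrable_mult_cnj:
  assumes f: "square_integrable f" and g: "square_integrable g"
  shows "integrable half_line (\<lambda>x. f x * cnj (g x))"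
proof -
  have [measurable]: "f \<in> borel_measurable half_line" "g \<in> borel_measurable half_line"
    using f g by (auto simp: square_integrable_def)
  have i: "integrable half_line (\<lambda>x. (cmod (f x))\<^sup>2 + (cmod (g x))\<^sup>2)"
    using f g by (auto simp: square_integrable_def)
  have bound: "cmod a * cmod b \<le> (cmod a)\<^sup>2 + (cmod b)\<^sup>2" for a b
  proof -
    have "2 * (cmod a * cmod b) \<le> (cmod a)\<^sup>2 + (cmod b)\<^sup>2"
      using sum_squares_bound[of "cmod a" "cmod b"] by simp
    moreover have "0 \<le> cmod a * cmod b" by simp
    ultimately show ?thesis by linarith
  qed
  show ?thesis
    by (rule Bochner_Integration.integrable_bound[OF i]) (measurable, simp add: norm_mult bound)
qed

instantiation half_line_L2 :: real_vector
begin

lift_definition zero_half_line_L2 :: half_line_L2 is "\<lambda>x. 0"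
  by (simp add: L2_eq_def square_integrable_zero)

lift_definition plus_half_line_L2 :: "half_line_L2 \<Rightarrow> half_line_L2 \<Rightarrow> half_line_L2"
  is "\<lambda>f g x. f x + g x"
  by (auto simp: L2_eq_def intro!: square_integrable_add)

lift_definition uminus_half_line_L2 :: "half_line_L2 \<Rightarrow> half_line_L2" is "\<lambda>f x. - f x"
  by (auto simp: L2_eq_def square_integrable_def)

definition minus_half_line_L2 :: "half_line_L2 \<Rightarrow> half_line_L2 \<Rightarrow> half_line_L2" where
  "minus_half_line_L2 u v = u + (- v)"

lift_definition scaleR_half_line_L2 :: "real \<Rightarrow> half_line_L2 \<Rightarrow> half_line_L2"
  is "\<lambda>r f x. complex_of_real r * f x"
  by (auto simp: L2_eq_def intro!: square_integrable_scale)

instance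
proof
  fix a b c :: half_line_L2 and r s :: real
  show "a + b + c = a + (b + c)"
    by transfer (auto simp: L2_eq_def add.assoc intro!: square_integrable_add)
  show "a + b = b + a"
    by transfer (auto simp: L2_eq_def add.commute intro!: square_integrable_add)
  show "0 + a = a"
    by transfer (auto simp: L2_eq_def)
  show "- a + a = 0"
    by transfer (auto simp: L2_eq_def square_integrable_zero)
  show "a - b = a + - b"
    by (rule minus_half_line_L2_def)
  show "r *\<^sub>R (a + b) = r *\<^sub>R a + r *\<^sub>R b"
    by transfer (auto simp: L2_eq_def ring_distribs intro!: square_integrable_add square_integrable_scale)
  show "(r + s) *\<^sub>R a = r *\<^sub>R a + s *\<^sub>R a"
    by transfer (auto simp: L2_eq_def ring_distribs intro!: square_integrable_add square_integrable_scale)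
  show "r *\<^sub>R s *\<^sub>R a = (r * s) *\<^sub>R a"
    by transfer (auto simp: L2_eq_def mult.assoc intro!: square_integrable_scale)
  show "1 *\<^sub>R a = a"
    by transfer (auto simp: L2_eq_def)
qed

end

instantiation half_line_L2 :: real_inner
begin

lift_definition inner_half_line_L2 :: "half_line_L2 \<Rightarrow> half_line_L2 \<Rightarrow> real"
  is "\<lambda>f g. Re (LINT x|half_line. f x * cnj (g x))"
proof -
  fix f f' g g' assume "L2_eq f f'" "L2_eq g g'"
  then have m: "f \<in> borel_measurable half_line" "f' \<in> borel_measurable half_line"
      "g \<in> borel_measurable half_line" "g' \<in> borel_measurable half_line"
    and ae: "AE x in half_line. f x = f' x" "AE x in half_line. g x = g' x"
    by (auto simp: L2_eq_def square_integrable_def)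
  note [measurable] = m
  have "(LINT x|half_line. f x * cnj (g x)) = (LINT x|half_line. f' x * cnj (g' x))"
    by (rule integral_cong_AE) (measurable, use ae in \<open>eventually_elim, simp\<close>)
  then show "Re (LINT x|half_line. f x * cnj (g x)) = Re (LINT x|half_line. f' x * cnj (g' x))"
    by simp
qed

definition norm_half_line_L2 :: "half_line_L2 \<Rightarrow> real" where
  "norm_half_line_L2 u = sqrt (inner u u)"

definition sgn_half_line_L2 :: "half_line_L2 \<Rightarrow> half_line_L2" where
  "sgn_half_line_L2 u = u /\<^sub>R norm u"

definition dist_half_line_L2 :: "half_line_L2 \<Rightarrow> half_line_L2 \<Rightarrow> real" where
  "dist_half_line_L2 u v = norm (u - v)"

definition uniformity_half_line_L2 :: "(half_line_L2 \<times> half_line_L2) filter" where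
  "uniformity_half_line_L2 = (INF e\<in>{0<..}. principal {(u, v). dist u v < e})"

definition open_half_line_L2 :: "half_line_L2 set \<Rightarrow> bool" where
  "open_half_line_L2 U \<longleftrightarrow> (\<forall>u\<in>U. eventually (\<lambda>(u', v). u' = u \<longrightarrow> v \<in> U) uniformity)"

instance
proof
  fix a b c :: half_line_L2 and r :: real
  show "sgn a = a /\<^sub>R norm a"
    by (rule sgn_half_line_L2_def)
  show "dist a b = norm (a - b)"
    by (rule dist_half_line_L2_def)
  show "uniformity = (INF e\<in>{0<..}. principal {(u, v :: half_line_L2). dist u v < e})"
    by (rule uniformity_half_line_L2_def)
  show "open U \<longleftrightarrow> (\<forall>u\<in>U. eventually (\<lambda>(u', v). u' = u \<longrightarrow> v \<in> U) uniformity)"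
    for U :: "half_line_L2 set"
    by (rule open_half_line_L2_def)
  show "inner a b = inner b a"
  proof transfer
    fix f g
    have "(LINT x|half_line. f x * cnj (g x)) = (LINT x|half_line. cnj (g x * cnj (f x)))"
      by (simp add: mult.commute)
    also have "\<dots> = cnj (LINT x|half_line. g x * cnj (f x))"
      by (rule Bochner_Integration.integral_cnj)
    finally show "Re (LINT x|half_line. f x * cnj (g x)) = Re (LINT x|half_line. g x * cnj (f x))"
      by simp
  qed
  show "inner (a + b) c = inner a c + inner b c"
    by transfer (simp add: L2_eq_def ring_distribs integrable_mult_cnj)
  show "inner (r *\<^sub>R a) b = r * inner a b"
    by transfer (simp add: mult.assoc)
  show "0 \<le> inner a a"
    by transfer (simp add: complex_norm_square[symmetric] del: of_real_power)
  show "inner a a = 0 \<longleftrightarrow> a = 0"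
  proof transfer
    fix f assume "L2_eq f f"
    then have f: "square_integrable f" by (simp add: L2_eq_def)
    then have i: "integrable half_line (\<lambda>x. (cmod (f x))\<^sup>2)" by (simp add: square_integrable_def)
    have "Re (LINT x|half_line. f x * cnj (f x)) = (LINT x|half_line. (cmod (f x))\<^sup>2)"
      by (simp add: complex_norm_square[symmetric] del: of_real_power)
    then show "Re (LINT x|half_line. f x * cnj (f x)) = 0 \<longleftrightarrow> L2_eq f (\<lambda>x. 0)"
      using integral_nonneg_eq_0_iff_AE[OF i] f
      by (simp add: L2_eq_def square_integrable_zero)
  qed
  show "norm a = sqrt (inner a a)"
    by (rule norm_half_line_L2_def)
qed

end

text \<open>The topology on \<^typ>\<open>half_line_L2\<close> is thus the norm topology of
  \<open>\<parallel>u\<parallel>\<^sup>2 = \<integral>|u|\<^sup>2\<close>; the class \<^class>\<open>real_inner\<close> only sees the real part of the inner product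
  \<open>cinner\<close> below.\<close>

lift_definition cinner :: "half_line_L2 \<Rightarrow> half_line_L2 \<Rightarrow> complex"
  is "\<lambda>f g. LINT x|half_line. f x * cnj (g x)"
proof -
  fix f f' g g' assume "L2_eq f f'" "L2_eq g g'"
  then have m: "f \<in> borel_measurable half_line" "f' \<in> borel_measurable half_line"
      "g \<in> borel_measurable half_line" "g' \<in> borel_measurable half_line"
    and ae: "AE x in half_line. f x = f' x" "AE x in half_line. g x = g' x"
    by (auto simp: L2_eq_def square_integrable_def)
  note [measurable] = m
  show "(LINT x|half_line. f x * cnj (g x)) = (LINT x|half_line. f' x * cnj (g' x))"
    by (rule integral_cong_AE) (measurable, use ae in \<open>eventually_elim, simp\<close>)
qed

lift_definition cscale :: "complex \<Rightarrow> half_line_L2 \<Rightarrow> half_line_L2" is "\<lambda>c f x. c * f x"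
  by (auto simp: L2_eq_def intro!: square_integrable_scale)

interpretation L2: vector_space cscale
proof
  fix a b :: half_line_L2 and c d :: complex
  show "cscale c (a + b) = cscale c a + cscale c b"
    by transfer (auto simp: L2_eq_def ring_distribs intro!: square_integrable_add square_integrable_scale)
  show "cscale (c + d) a = cscale c a + cscale d a"
    by transfer (auto simp: L2_eq_def ring_distribs intro!: square_integrable_add square_integrable_scale)
  show "cscale c (cscale d a) = cscale (c * d) a"
    by transfer (auto simp: L2_eq_def mult.assoc intro!: square_integrable_scale)
  show "cscale 1 a = a"
    by transfer (auto simp: L2_eq_def)
qed


section \<open>Operators, adjoints, deficiency indices\<close>

text \<open>An operator is identified with its graph, so that its domain is \<^const>\<open>Domain\<close> and its closure
  is the closure of the graph in the product topology. The adjoint of a graph is a priori only a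
  linear relation; it is a graph exactly when the operator is densely defined.\<close>

type_synonym L2_operator = "(half_line_L2 \<times> half_line_L2) set"

definition adjoint_op :: "L2_operator \<Rightarrow> L2_operator" where
  "adjoint_op A = {(v, w). \<forall>(u, Au) \<in> A. cinner Au v = cinner u w}"

definition ker_shift :: "L2_operator \<Rightarrow> complex \<Rightarrow> half_line_L2 set" where
  "ker_shift A z = {u. \<exists>v. (u, v) \<in> A \<and> v + cscale z u = 0}"

text \<open>Dimensions are over the complex numbers. The library's \<open>dim\<close> of an infinite-dimensional space
  is \<open>0\<close>, so only positive values of these indices are informative.\<close>

definition deficiency_plus :: "L2_operator \<Rightarrow> nat" where
  "deficiency_plus A = L2.dim (ker_shift (adjoint_op A) \<i>)"

definition deficiency_minus :: "L2_operator \<Rightarrow> nat" where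
  "deficiency_minus A = L2.dim (ker_shift (adjoint_op A) (- \<i>))"

definition is_direct_sum :: "half_line_L2 set \<Rightarrow> half_line_L2 set \<Rightarrow> half_line_L2 set \<Rightarrow> bool" where
  "is_direct_sum V U W \<longleftrightarrow> V = {u + w | u w. u \<in> U \<and> w \<in> W} \<and> U \<inter> W = {0}"


section \<open>Function spaces\<close>

definition abs_continuous_on :: "real \<Rightarrow> real \<Rightarrow> (real \<Rightarrow> complex) \<Rightarrow> bool" where
  "abs_continuous_on a b f \<longleftrightarrow>
     (\<forall>\<epsilon>>0. \<exists>\<delta>>0. \<forall>\<D> T. \<D> division_of T \<and> T \<subseteq> {a..b} \<and> (\<Sum>K\<in>\<D>. Sup K - Inf K) < \<delta>
        \<longrightarrow> (\<Sum>K\<in>\<D>. cmod (f (Sup K) - f (Inf K))) < \<epsilon>)"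

definition locally_abs_continuous :: "(real \<Rightarrow> complex) \<Rightarrow> bool" where
  "locally_abs_continuous f \<longleftrightarrow> (\<forall>a b. 0 < a \<longrightarrow> a < b \<longrightarrow> abs_continuous_on a b f)"

text \<open>Derivatives are taken within \<open>S\<close>, hence one-sided at an endpoint belonging to \<open>S\<close>.\<close>

definition C1_deriv_on :: "real set \<Rightarrow> (real \<Rightarrow> complex) \<Rightarrow> (real \<Rightarrow> complex) \<Rightarrow> bool" where
  "C1_deriv_on S f f' \<longleftrightarrow>
     (\<forall>x\<in>S. (f has_vector_derivative f' x) (at x within S)) \<and> continuous_on S f'"

definition compact_support_in :: "real set \<Rightarrow> (real \<Rightarrow> complex) \<Rightarrow> bool" where
  "compact_support_in S f \<longleftrightarrow> (\<exists>K. compact K \<and> K \<subseteq> S \<and> (\<forall>x\<in>S - K. f x = 0))"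

definition C01_half_line :: "(real \<Rightarrow> complex) set" where
  "C01_half_line = {f. (\<exists>f'. C1_deriv_on {0..} f f') \<and> compact_support_in {0..} f}"

text \<open>Membership in \<open>C01_half_line\<close> does not make the derivative locally absolutely continuous, so
  for \<open>\<xi>\<close> in this space the products of \<open>\<xi>\<close> with powers of \<open>x\<close> need not belong to the maximal domain
  of the Bessel operator; they do exactly when \<open>\<xi>\<close> also belongs to \<open>H2\<close> below.\<close>

text \<open>Weak derivatives are tested against continuously differentiable functions with compact support
  in the open half-line.\<close>

definition weak_deriv :: "half_line_L2 \<Rightarrow> half_line_L2 \<Rightarrow> bool" where
  "weak_deriv u v \<longleftrightarrow>
     (\<forall>\<phi> \<phi>'. C1_deriv_on {0<..} \<phi> \<phi>' \<and> compact_support_in {0<..} \<phi> \<longrightarrow>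
        (LINT x|half_line. L2_rep u x * \<phi>' x) = - (LINT x|half_line. L2_rep v x * \<phi> x))"

definition H2 :: "half_line_L2 set" where
  "H2 = {u. \<exists>u' u''. weak_deriv u u' \<and> weak_deriv u' u''}"

text \<open>The boundary values of an element of \<open>H2\<close> are those of its representative that is
  continuously differentiable up to \<open>0\<close>.\<close>

definition H02 :: "half_line_L2 set" where
  "H02 = {u \<in> H2. \<exists>f f'. square_integrable f \<and> u = L2_class f \<and> C1_deriv_on {0..} f f'
                          \<and> f 0 = 0 \<and> f' 0 = 0}"


section \<open>The Bessel operator\<close>

text \<open>Here \<open>bessel_expr \<nu> f g\<close> says that \<open>f\<close> and \<open>f'\<close> are locally absolutely continuous on the open
  half-line and \<open>g = \<tau>\<^sub>\<nu> f\<close> almost everywhere. Since \<open>f'\<close> is continuous, \<open>f\<close> is differentiable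
  everywhere, whereas \<open>f''\<close> exists only almost everywhere.\<close>

definition bessel_expr :: "real \<Rightarrow> (real \<Rightarrow> complex) \<Rightarrow> (real \<Rightarrow> complex) \<Rightarrow> bool" where
  "bessel_expr \<nu> f g \<longleftrightarrow>
     (\<exists>f' f''. locally_abs_continuous f \<and> locally_abs_continuous f' \<and>
        (\<forall>x>0. (f has_vector_derivative f' x) (at x)) \<and>
        (AE x in half_line. (f' has_vector_derivative f'' x) (at x)) \<and>
        (AE x in half_line. g x = - f'' x + complex_of_real ((\<nu>\<^sup>2 - 1/4) / x\<^sup>2) * f x))"

definition bessel_max :: "real \<Rightarrow> L2_operator" where
  "bessel_max \<nu> = {(L2_class f, L2_class g) | f g.
     square_integrable f \<and> square_integrable g \<and> bessel_expr \<nu> f g}"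

definition bessel_min :: "real \<Rightarrow> L2_operator" where
  "bessel_min \<nu> = closure {(u, v) \<in> bessel_max \<nu>.
     \<exists>f. square_integrable f \<and> u = L2_class f \<and> compact_support_in {0<..} f}"

end

theory Submission
  imports Defs "HOL-Complex_Analysis.Conformal_Mappings"
begin

text \<open>
  Near zero the equation \<open>- f'' + V f = 0\<close>, with \<open>V = (\<nu>\<^sup>2 - 1/4) / x\<^sup>2\<close>, has the solutions
  \<open>x\<^sup>1\<^sup>/\<^sup>2\<^sup>+\<^sup>\<nu>\<close> and \<open>x\<^sup>1\<^sup>/\<^sup>2\<^sup>-\<^sup>\<nu>\<close> (or \<open>x\<^sup>1\<^sup>/\<^sup>2 ln x\<close> when \<open>\<nu> = 0\<close>), and both are
  square-integrable there because \<open>\<nu> < 1\<close>; at infinity the potential is bounded. So an element \<open>f\<close> of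
  the maximal domain carries two boundary values at zero, the limits of its Wronskians with these two
  solutions, and nothing at infinity.

  The two boundary values decide everything. If both vanish, variation of constants writes \<open>f\<close> and
  \<open>f'\<close> as integrals of \<open>\<tau> f\<close> over \<open>(0, x)\<close> (\<open>zero_boundary_bounds\<close>), and Hardy's inequality
  (\<open>hardy_inequality\<close>) turns this into \<open>f / x\<^sup>2 \<in> L\<^sup>2\<close>. Then \<open>f''\<close> is square-integrable and
  \<open>f(0) = f'(0) = 0\<close> (\<open>zero_boundary_imp_H02\<close>). Conversely, for \<open>f \<in> H02\<close> Hardy's inequality applied to
  \<open>f''\<close> controls \<open>f' / x\<close> and \<open>f / x\<^sup>2\<close>, which is just what is needed to cut \<open>f\<close> off near zero and near
  infinity with convergence in the graph norm, so that \<open>f\<close> is in the minimal domain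
  (\<open>H02_subset_bessel_min\<close>). Each boundary value is also a pairing of \<open>(f, \<tau> f)\<close> with a fixed element of
  the maximal operator, a cut-off solution (\<open>boundary_forms_at_zero\<close>); by Green's formula it vanishes on
  the minimal operator. This identifies the minimal domain with \<open>H02\<close>.

  That the adjoint of the minimal operator is the maximal one is the regularity of weak solutions
  (\<open>weak_second_derivative_imp_primitive\<close>), together with Green's formula. The two cut-off solutions realise
  all pairs of boundary values, since the Wronskian of the two solutions is a nonzero constant; this gives
  the direct sum decomposition.

  For the deficiency indices, the function \<open>x\<^sup>1\<^sup>/\<^sup>2 K\<^sub>\<nu>(k x)\<close> with \<open>k\<^sup>2 = \<plusminus>\<i>\<close> and \<open>Re k > 0\<close>,
  built from Macdonald's function, shows that both deficiency spaces are nonzero (\<open>deficiency_element\<close>).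
  By von Neumann's argument their sum embeds into the maximal domain modulo the minimal one, which has
  dimension two, so both have dimension one.
\<close>

section \<open>Absolutely continuous functions and their primitives\<close>

hide_const (open) Polynomial.content

text \<open>The condition \<^const>\<open>abs_continuous_on\<close> for functions with values in any normed space:
  Hardy's inequality will integrate real functions by parts.\<close>
definition ac_on :: "real \<Rightarrow> real \<Rightarrow> (real \<Rightarrow> 'a::real_normed_vector) \<Rightarrow> bool" where
  "ac_on a b f \<longleftrightarrow>
     (\<forall>\<epsilon>>0. \<exists>\<delta>>0. \<forall>\<D> T. \<D> division_of T \<and> T \<subseteq> {a..b} \<and> (\<Sum>K\<in>\<D>. Sup K - Inf K) < \<delta>
        \<longrightarrow> (\<Sum>K\<in>\<D>. norm (f (Sup K) - f (Inf K))) < \<epsilon>)"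

lemma abs_continuous_on_eq_ac_on: "abs_continuous_on a b f \<longleftrightarrow> ac_on a b f"
  unfolding ac_on_def abs_continuous_on_def ..

text \<open>The fundamental theorem of calculus for absolutely continuous functions, with a null set \<open>N\<close>
  of exceptional points. The gauge confines the intervals with tags in \<open>N\<close> to an open set of small measure,
  where absolute continuity bounds the increments of \<open>f\<close>; for the other intervals the definition of the
  derivative does.\<close>
lemma ac_on_FTC:
  fixes f :: "real \<Rightarrow> 'a::banach"
  assumes ac: "ac_on a b f" and ab: "a \<le> b" and N: "negligible N"
    and der: "\<And>x. x \<in> {a..b} - N \<Longrightarrow> (f has_vector_derivative f' x) (at x within {a..b})"
  shows "(f' has_integral f b - f a) {a..b}"
proof -
  define g where "g x = (if x \<in> N then 0 else f' x)" for x
  have "(g has_integral f b - f a) {a..b}"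
    unfolding has_integral_real
  proof (intro allI impI)
    fix e :: real assume e: "0 < e"
    define e1 where "e1 = e / (2 * (b - a + 1))"
    have e1: "0 < e1" using e ab by (simp add: e1_def)
    have "\<exists>d>0. \<forall>y\<in>{a..b}. norm (y - x) < d \<longrightarrow> norm (f y - f x - (y - x) *\<^sub>R f' x) \<le> e1 * norm (y - x)"
      if "x \<in> {a..b} - N" for x
      using der[OF that] e1 unfolding has_vector_derivative_def has_derivative_within_alt by simp
    then have "\<forall>x\<in>{a..b} - N. \<exists>d>0. \<forall>y\<in>{a..b}. norm (y - x) < d \<longrightarrow>
        norm (f y - f x - (y - x) *\<^sub>R f' x) \<le> e1 * norm (y - x)" by (rule ballI)
    then obtain d where d': "\<forall>x\<in>{a..b} - N. 0 < d x \<and> (\<forall>y\<in>{a..b}. norm (y - x) < d x \<longrightarrow>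
        norm (f y - f x - (y - x) *\<^sub>R f' x) \<le> e1 * norm (y - x))"
      by (rule bchoice[THEN exE])
    note d = d'[rule_format, THEN conjunct1] d'[rule_format, THEN conjunct2, rule_format]
    have "\<exists>\<delta>>0. \<forall>\<D> T. \<D> division_of T \<and> T \<subseteq> {a..b} \<and> (\<Sum>K\<in>\<D>. Sup K - Inf K) < \<delta>
        \<longrightarrow> (\<Sum>K\<in>\<D>. norm (f (Sup K) - f (Inf K))) < e/2"
      using ac[unfolded ac_on_def] half_gt_zero[OF e] by (elim allE impE)
    then obtain \<delta> where \<delta>: "0 < \<delta>" and "\<forall>\<D> T. \<D> division_of T \<and> T \<subseteq> {a..b} \<and>
        (\<Sum>K\<in>\<D>. Sup K - Inf K) < \<delta> \<longrightarrow> (\<Sum>K\<in>\<D>. norm (f (Sup K) - f (Inf K))) < e/2"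
      by (elim exE conjE)
    note D = this(2)[rule_format, OF conjI, OF _ conjI]
    obtain U where U: "open U" "N \<subseteq> U" "U - N \<in> lmeasurable" "emeasure lebesgue (U - N) < ennreal \<delta>"
      using sets_lebesgue_outer_open[OF negligible_imp_sets[OF N] \<delta>] by blast
    have Um: "U \<in> lmeasurable"
    proof -
      have "U = (U - N) \<union> N" using U by blast
      then show ?thesis using fmeasurable.Un[OF U(3) negligible_imp_measurable[OF N]] by simp
    qed
    have mU: "measure lebesgue U < \<delta>"
    proof -
      have "measure lebesgue U = measure lebesgue (U - N)"
        by (rule measure_negligible_symdiff[OF Um, symmetric])
          (rule negligible_subset[OF N], auto)
      also have "ennreal \<dots> < ennreal \<delta>"
        using U(4) emeasure_eq_measure2[OF U(3)] by simp
      finally show ?thesis using \<delta> by (simp add: ennreal_less_iff)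
    qed
    \<comment> \<open>points of \<open>N\<close> may only tag intervals inside \<open>U\<close>, the others only intervals with small difference quotients\<close>
    define \<gamma> where "\<gamma> x = (if x \<in> N then U else if x \<in> {a..b} then ball x (d x) else ball x 1)" for x
    have "gauge \<gamma>"
      unfolding gauge_def \<gamma>_def using U d by auto
    moreover have "norm ((\<Sum>(x, K)\<in>\<D>. content K *\<^sub>R g x) - (f b - f a)) < e"
      if p: "\<D> tagged_division_of {a..b}" and fine: "\<gamma> fine \<D>" for \<D>
    proof -
      note tag = tagged_division_ofD[OF p]
      have fin: "finite \<D>" using tag(1) .
      have K: "\<exists>u v. K = {u..v} \<and> u \<le> v \<and> x \<in> {u..v} \<and> a \<le> u \<and> v \<le> b" if "(x, K) \<in> \<D>" for x K
      proof -
        from tag(4)[OF that] obtain u v where uv: "K = {u..v}" by (auto simp: cbox_interval)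
        then show ?thesis using tag(2,3)[OF that] by (intro exI[of _ u] exI[of _ v]) auto
      qed
      define D1 where "D1 = {(x, K) \<in> \<D>. x \<in> N}"
      have D1sub: "D1 \<subseteq> \<D>" by (auto simp: D1_def)
      have D1p: "D1 tagged_division_of (\<Union>(snd ` D1))"
        using tagged_partial_division_of_Union_self tagged_partial_division_subset[OF _ D1sub]
          p[unfolded tagged_division_of_def] by blast
      have D1d: "snd ` D1 division_of (\<Union>(snd ` D1))"
        by (rule division_of_tagged_division[OF D1p])
      have Usub: "\<Union>(snd ` D1) \<subseteq> U"
      proof
        fix y assume "y \<in> \<Union>(snd ` D1)"
        then obtain x K where xK: "(x, K) \<in> \<D>" "x \<in> N" "y \<in> K" by (auto simp: D1_def)
        then have "y \<in> \<gamma> x" using fineD[OF fine xK(1)] by blast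
        then show "y \<in> U" using xK(2) by (simp add: \<gamma>_def)
      qed
      have KD1: "\<exists>u v. K = {u..v} \<and> u \<le> v \<and> a \<le> u \<and> v \<le> b" if "K \<in> snd ` D1" for K
      proof -
        from that obtain x where "(x, K) \<in> \<D>" using D1sub by auto
        from K[OF this] show ?thesis by blast
      qed
      have KD1ne: "K \<noteq> {}" "Sup K - Inf K = measure lebesgue K" if "K \<in> snd ` D1" for K
        using KD1[OF that] by auto
      have "(\<Sum>K\<in>snd ` D1. Sup K - Inf K) = (\<Sum>K\<in>snd ` D1. measure lebesgue K)"
        by (rule sum.cong[OF refl]) (rule KD1ne(2))
      also have "\<dots> = measure lebesgue (\<Union>(snd ` D1))"
        using content_division[OF D1d] by simp
      also have "\<dots> \<le> measure lebesgue U"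
        by (rule measure_mono_fmeasurable[OF Usub _ Um]) 
          (rule fmeasurableD[OF lmeasurable_division[OF D1d]])
      finally have "(\<Sum>K\<in>snd ` D1. Sup K - Inf K) < \<delta>" using mU by simp
      moreover have "\<Union>(snd ` D1) \<subseteq> {a..b}"
      proof
        fix y assume "y \<in> \<Union>(snd ` D1)"
        then obtain K where "K \<in> snd ` D1" "y \<in> K" by blast
        with KD1[of K] show "y \<in> {a..b}" by auto
      qed
      ultimately have s1: "(\<Sum>K\<in>snd ` D1. norm (f (Sup K) - f (Inf K))) < e/2"
        by (intro D[OF D1d])
      \<comment> \<open>the case distinction is needed because \<open>Sup {}\<close> and \<open>Inf {}\<close> may be different real numbers\<close>
      have "(\<Sum>(x, K)\<in>D1. (if K = {} then 0 else norm (f (Sup K) - f (Inf K))))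
          = (\<Sum>K\<in>snd ` D1. (if K = {} then 0 else norm (f (Sup K) - f (Inf K))))"
      proof (rule sum.over_tagged_division_lemma[OF D1p])
        fix u v :: real assume "box u v = {}"
        then have "v < u \<or> u = v" by (auto simp: box_real)
        then show "(if cbox u v = {} then 0 else norm (f (Sup (cbox u v)) - f (Inf (cbox u v)))) = 0"
          by (auto simp: cbox_interval)
      qed
      moreover have "(\<Sum>(x, K)\<in>D1. (if K = {} then 0 else norm (f (Sup K) - f (Inf K))))
          = (\<Sum>(x, K)\<in>D1. norm (f (Sup K) - f (Inf K)))"
      proof (rule sum.cong[OF refl])
        fix p assume "p \<in> D1"
        then have "snd p \<noteq> {}" using KD1ne(1) by blast
        then show "(case p of (x, K) \<Rightarrow> if K = {} then 0 else norm (f (Sup K) - f (Inf K)))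
          = (case p of (x, K) \<Rightarrow> norm (f (Sup K) - f (Inf K)))" by (simp add: split_def)
      qed
      moreover have "(\<Sum>K\<in>snd ` D1. (if K = {} then 0 else norm (f (Sup K) - f (Inf K))))
          = (\<Sum>K\<in>snd ` D1. norm (f (Sup K) - f (Inf K)))"
        by (rule sum.cong[OF refl]) (simp add: KD1ne(1))
      ultimately have "(\<Sum>(x, K)\<in>D1. norm (f (Sup K) - f (Inf K))) = (\<Sum>K\<in>snd ` D1. norm (f (Sup K) - f (Inf K)))"
        by simp
      with s1 have s1: "(\<Sum>(x, K)\<in>D1. norm (f (Sup K) - f (Inf K))) < e/2" by simp
      have bd: "norm (content K *\<^sub>R g x - (f (Sup K) - f (Inf K)))
          \<le> (if x \<in> N then norm (f (Sup K) - f (Inf K)) else 0) + e1 * content K"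
        if xK: "(x, K) \<in> \<D>" for x K
      proof (cases "x \<in> N")
        case True then show ?thesis using e1 by (simp add: g_def norm_minus_commute)
      next
        case False
        obtain u v where uv: "K = {u..v}" "u \<le> v" "x \<in> {u..v}" "a \<le> u" "v \<le> b"
          using K[OF xK] by blast
        have xab: "x \<in> {a..b} - N" using False uv by auto
        have "K \<subseteq> \<gamma> x" using fine xK by (auto simp: fine_def)
        then have "K \<subseteq> ball x (d x)" using xab by (simp add: \<gamma>_def)
        then have "u \<in> ball x (d x)" "v \<in> ball x (d x)" using uv(1,2) by (auto simp del: mem_ball)
        then have n: "norm (u - x) < d x" "norm (v - x) < d x" by (auto simp: dist_norm)
        have "content K *\<^sub>R g x - (f (Sup K) - f (Inf K))
           = (f u - f x - (u - x) *\<^sub>R f' x) - (f v - f x - (v - x) *\<^sub>R f' x)"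
          using uv False by (simp add: g_def algebra_simps)
        also have "norm \<dots> \<le> e1 * norm (u - x) + e1 * norm (v - x)"
          by (rule order_trans[OF norm_triangle_ineq4 add_mono])
            (use d(2)[OF xab _ n(1)] d(2)[OF xab _ n(2)] uv in auto)
        also have "\<dots> = e1 * content K"
          using uv by (simp add: algebra_simps)
        finally show ?thesis using False by simp
      qed
      have "(\<Sum>(x, K)\<in>\<D>. content K *\<^sub>R g x) - (f b - f a)
          = (\<Sum>(x, K)\<in>\<D>. content K *\<^sub>R g x - (f (Sup K) - f (Inf K)))"
        using additive_tagged_division_1[OF ab p, of f] by (simp add: sum_subtractf split_def)
      also have "norm \<dots> \<le> (\<Sum>(x, K)\<in>\<D>. (if x \<in> N then norm (f (Sup K) - f (Inf K)) else 0) + e1 * content K)"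
        by (rule sum_norm_le) (use bd in auto)
      also have "\<dots> = (\<Sum>(x, K)\<in>\<D>. (if x \<in> N then norm (f (Sup K) - f (Inf K)) else 0)) + e1 * (\<Sum>(x, K)\<in>\<D>. content K)"
        by (simp add: sum.distrib split_def sum_distrib_left)
      also have "(\<Sum>(x, K)\<in>\<D>. (if x \<in> N then norm (f (Sup K) - f (Inf K)) else 0))
           = (\<Sum>(x, K)\<in>D1. norm (f (Sup K) - f (Inf K)))"
        unfolding D1_def by (rule sum.mono_neutral_cong_right[OF fin]) (auto split: if_splits)
      also have "(\<Sum>(x, K)\<in>\<D>. content K) = b - a"
        using additive_content_tagged_division[of \<D> a b] p ab by (simp add: cbox_interval)
      also have "e1 * (b - a) \<le> e / 2"
        using ab e by (simp add: e1_def field_simps)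
      finally show ?thesis using s1 by linarith
    qed
    ultimately show "\<exists>\<gamma>. gauge \<gamma> \<and> (\<forall>\<D>. \<D> tagged_division_of {a..b} \<and> \<gamma> fine \<D> \<longrightarrow>
        norm ((\<Sum>(x, k)\<in>\<D>. content k *\<^sub>R g x) - (f b - f a)) < e)"
      by (intro exI[of _ \<gamma>] conjI allI impI) (assumption, simp)
  qed
  then show ?thesis
    by (rule has_integral_spike[OF N, rotated]) (auto simp: g_def)
qed

text \<open>The excess of \<open>|f|\<close> over the constant \<open>n\<close> has an integral that tends to
  \<open>0\<close> as \<open>n\<close> grows, so on a set of measure less than \<open>d\<close> the integral of
  \<open>|f|\<close> is at most \<open>n d\<close> plus something small.\<close>
lemma ac_on_indefinite_integral:
  fixes f F :: "real \<Rightarrow> 'a::euclidean_space"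
  assumes f: "f absolutely_integrable_on {a..b}"
    and F: "\<And>u v. \<lbrakk>a \<le> u; u \<le> v; v \<le> b\<rbrakk> \<Longrightarrow> (f has_integral F v - F u) {u..v}"
  shows "ac_on a b F"
  unfolding ac_on_def
proof (intro allI impI)
  fix e :: real assume e: "0 < e"
  define h where "h n x = max 0 (norm (f x) - real n)" for n x
  have nf: "(\<lambda>x. norm (f x)) absolutely_integrable_on {a..b}" 
    using absolutely_integrable_norm[OF f] by (simp add: o_def)
  have hint: "h n absolutely_integrable_on {a..b}" for n
    unfolding h_def by (intro absolutely_integrable_max_1 nf set_integral_diff) simp_all
  have "(\<lambda>n. integral {a..b} (h n)) \<longlonglongrightarrow> integral {a..b} (\<lambda>x. 0)"
  proof (rule dominated_convergence(2)[where h="\<lambda>x. norm (f x)"])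
    show "h n integrable_on {a..b}" for n using hint set_lebesgue_integral_eq_integral(1) by blast
    show "(\<lambda>x. norm (f x)) integrable_on {a..b}" using nf set_lebesgue_integral_eq_integral(1) by blast
    show "norm (h n x) \<le> norm (f x)" for n x by (auto simp: h_def)
    show "(\<lambda>n. h n x) \<longlonglongrightarrow> 0" for x
    proof (rule tendsto_eventually)
      obtain N :: nat where "norm (f x) \<le> real N" using real_arch_simple by blast
      then show "\<forall>\<^sub>F n in sequentially. h n x = 0"
        unfolding h_def by (intro eventually_sequentiallyI[of N]) auto
    qed
  qed
  then have "\<forall>\<^sub>F n in sequentially. integral {a..b} (h n) < e/2"
    using e by (intro order_tendstoD(2)[where y=0]) auto
  then obtain n where n: "integral {a..b} (h n) < e/2"
    by (auto simp: eventually_sequentially)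
  define d where "d = e / (2 * (real n + 1))"
  have d: "0 < d" using e by (simp add: d_def)
  show "\<exists>\<delta>>0. \<forall>\<D> T. \<D> division_of T \<and> T \<subseteq> {a..b} \<and> (\<Sum>K\<in>\<D>. Sup K - Inf K) < \<delta>
        \<longrightarrow> (\<Sum>K\<in>\<D>. norm (F (Sup K) - F (Inf K))) < e"
  proof (intro exI[of _ d] conjI d allI impI)
    fix \<D> T assume "\<D> division_of T \<and> T \<subseteq> {a..b} \<and> (\<Sum>K\<in>\<D>. Sup K - Inf K) < d"
    then have D: "\<D> division_of T" and T: "T \<subseteq> {a..b}" and s: "(\<Sum>K\<in>\<D>. Sup K - Inf K) < d" by auto
    have K: "\<exists>u v. K = {u..v} \<and> u \<le> v \<and> a \<le> u \<and> v \<le> b \<and> {u..v} \<subseteq> T" if "K \<in> \<D>" for K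
    proof -
      from division_ofD(4)[OF D that] obtain u v where "K = {u..v}" by (auto simp: cbox_interval)
      moreover have "K \<subseteq> T" "K \<noteq> {}" using division_ofD(2,3)[OF D that] by auto
      ultimately have "u \<le> v" "{u..v} \<subseteq> T" by auto
      moreover from this T have "{u..v} \<subseteq> {a..b}" by blast
      ultimately show ?thesis using \<open>K = {u..v}\<close> by (intro exI[of _ u] exI[of _ v]) simp
    qed
    have hi: "h n integrable_on S" if "S = {u..v}" "{u..v} \<subseteq> {a..b}" for u v S
      using integrable_subinterval_real[OF set_lebesgue_integral_eq_integral(1)[OF hint[of n]] that(2)] that(1)
      by simp
    have hK: "h n integrable_on K" if "K \<in> \<D>" for K
    proof -
      from K[OF that] obtain u v where "K = {u..v}" "a \<le> u" "v \<le> b" by blast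
      then show ?thesis using hi[of K u v] by simp
    qed
    have "norm (F (Sup K) - F (Inf K)) \<le> integral K (h n) + real n * (Sup K - Inf K)" if "K \<in> \<D>" for K
    proof -
      from K[OF that] obtain u v where uv: "K = {u..v}" "u \<le> v" "a \<le> u" "v \<le> b" by blast
      have i: "(f has_integral F v - F u) {u..v}" using F uv by blast
      have "norm (integral {u..v} f) \<le> integral {u..v} (\<lambda>x. h n x + real n)"
      proof (rule integral_norm_bound_integral)
        show "(\<lambda>x. h n x + real n) integrable_on {u..v}"
          using hi[of K u v] uv by (intro integrable_add) auto
      qed (use i in \<open>auto simp: h_def\<close>)
      also have "\<dots> = integral {u..v} (h n) + real n * (v - u)"
        using hi[of K u v] uv by (subst integral_add) (auto simp: mult.commute)
      finally show ?thesis using uv i by (simp add: integral_unique)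
    qed
    then have "(\<Sum>K\<in>\<D>. norm (F (Sup K) - F (Inf K))) \<le> (\<Sum>K\<in>\<D>. integral K (h n)) + real n * (\<Sum>K\<in>\<D>. Sup K - Inf K)"
      by (simp add: sum_distrib_left flip: sum.distrib) (rule sum_mono, blast)
    also have "(\<Sum>K\<in>\<D>. integral K (h n)) = integral T (h n)"
      using integral_combine_division_bottomup[OF D, of "h n"] hK by simp
    also have "integral T (h n) \<le> integral {a..b} (h n)"
    proof (rule integral_subset_le[OF T])
      show "h n integrable_on T" 
        by (rule integrable_combine_division[OF D]) (rule hK)
      show "h n integrable_on {a..b}" using hi[of "{a..b}" a b] by simp
    qed (auto simp: h_def)
    also have "real n * (\<Sum>K\<in>\<D>. Sup K - Inf K) \<le> real n * d"
      using s by (intro mult_left_mono) auto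
    also have "real n * d \<le> e / 2" using e by (simp add: d_def field_simps)
    finally show "(\<Sum>K\<in>\<D>. norm (F (Sup K) - F (Inf K))) < e" using n by linarith
  qed
qed

text \<open>Local absolute continuity on \<open>(0, \<infinity>)\<close> in integrated form: \<open>F\<close> has the
  locally integrable derivative \<open>f\<close>. The calculus below uses this relation because it hides the exceptional
  null sets; \<open>primitive_AE_derivative\<close> and \<open>ac_on_AE_derivative_primitive\<close> pass to the
  formulation with derivatives almost everywhere and back.\<close>
definition primitive :: "(real \<Rightarrow> 'a::euclidean_space) \<Rightarrow> (real \<Rightarrow> 'a) \<Rightarrow> bool" where
  "primitive F f \<longleftrightarrow> (\<forall>a b. 0 < a \<longrightarrow> a \<le> b \<longrightarrow>
     f absolutely_integrable_on {a..b} \<and> (f has_integral F b - F a) {a..b})"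

lemma primitive_absolutely_integrable:
  "primitive F f \<Longrightarrow> 0 < a \<Longrightarrow> f absolutely_integrable_on {a..b}"
  by (cases "a \<le> b") (auto simp: primitive_def)

lemma primitive_has_integral:
  "primitive F f \<Longrightarrow> 0 < a \<Longrightarrow> a \<le> b \<Longrightarrow> (f has_integral F b - F a) {a..b}"
  by (auto simp: primitive_def)

lemma primitive_ac_on: "primitive F f \<Longrightarrow> 0 < a \<Longrightarrow> ac_on a b F"
  using primitive_has_integral[of F f] primitive_absolutely_integrable[of F f a b]
  by (intro ac_on_indefinite_integral[where f=f]) auto

lemma AE_half_line_iff:
  "(AE x in half_line. P x) \<longleftrightarrow> (\<exists>N. negligible N \<and> (\<forall>x>0. x \<notin> N \<longrightarrow> P x))"
proof -
  have "(AE x in half_line. P x) \<longleftrightarrow> (AE x in lebesgue. 0 < x \<longrightarrow> P x)"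
    using AE_restrict_space_iff[of "{0<..}" lebesgue P] by simp
  also have "\<dots> \<longleftrightarrow> (\<exists>N. negligible N \<and> (\<forall>x>0. x \<notin> N \<longrightarrow> P x))"
    unfolding eventually_ae_filter_negligible by blast
  finally show ?thesis .
qed

text \<open>The one-dimensional case of \<open>integrable_ccontinuous_explicit\<close>, where \<open>x\<close> is a
  corner of the cubes; hence only the derivative from the right.\<close>
lemma integrable_AE_right_derivative:
  fixes g :: "real \<Rightarrow> 'a::euclidean_space"
  assumes "\<And>u v. g integrable_on cbox u v"
  shows "\<exists>N. negligible N \<and> (\<forall>x e. x \<notin> N \<longrightarrow> 0 < e \<longrightarrow>
    (\<exists>d>0. \<forall>h. 0 < h \<and> h < d \<longrightarrow> norm (integral {x..x + h} g /\<^sub>R h - g x) < e))"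
proof -
  obtain N where N: "negligible N" and *: "\<And>x e. \<lbrakk>x \<notin> N; 0 < e\<rbrakk> \<Longrightarrow> \<exists>d>0. \<forall>h. 0 < h \<and> h < d \<longrightarrow>
      norm (integral (cbox x (x + h *\<^sub>R One)) g /\<^sub>R h ^ DIM(real) - g x) < e"
    by (rule integrable_ccontinuous_explicit[OF assms]) blast
  have "(One :: real) = 1" by simp
  with * have "\<And>x e. \<lbrakk>x \<notin> N; 0 < e\<rbrakk> \<Longrightarrow> \<exists>d>0. \<forall>h. 0 < h \<and> h < d \<longrightarrow>
      norm (integral {x..x + h} g /\<^sub>R h - g x) < e"
    by (simp only: cbox_interval real_scaleR_def mult_1_right DIM_real power_one_right)
  with N show ?thesis by blast
qed

text \<open>Lebesgue's differentiation theorem. The derivative from the left is the one from the right of the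
  reflected function, and countably many intervals \<open>[1/n, n]\<close> exhaust the half-line.\<close>
lemma primitive_AE_derivative:
  assumes F: "primitive F f"
  shows "AE x in half_line. (F has_vector_derivative f x) (at x)"
proof -
  define Q where "Q n x \<longleftrightarrow> (x \<in> {inverse (real (Suc n))<..<real (Suc n)} \<longrightarrow> (F has_vector_derivative f x) (at x))" for n x
  have "\<exists>N. negligible N \<and> (\<forall>x>0. x \<notin> N \<longrightarrow> Q n x)" for n
  proof -
    define c where "c = real (Suc n)"
    have "1 \<le> c" by (simp add: c_def)
    then have c: "0 < inverse c" "inverse c \<le> c" "0 < c"
      using inverse_le_1_iff[of c] by auto
    define g where "g x = (if x \<in> {inverse c..c} then f x else 0)" for x
    have gU: "g absolutely_integrable_on UNIV"
      using primitive_absolutely_integrable[OF F c(1)] absolutely_integrable_restrict_UNIV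
      unfolding g_def by blast
    then have gI: "g integrable_on cbox u v" for u v :: real
      by (meson absolutely_integrable_on_subcbox set_lebesgue_integral_eq_integral(1) subset_UNIV)
    have g'I: "(\<lambda>x. g (- x)) integrable_on cbox u v" for u v :: real
      using gI[of "-v" "-u"] Henstock_Kurzweil_Integration.integrable_reflect_real[where f=g and a="-v" and b="-u"] by (simp add: cbox_interval)
    obtain N1 where N1: "negligible N1" "\<And>x e. \<lbrakk>x \<notin> N1; 0 < e\<rbrakk> \<Longrightarrow> \<exists>d>0. \<forall>h. 0 < h \<and> h < d \<longrightarrow>
        norm (integral {x..x + h} g /\<^sub>R h - g x) < e"
      using integrable_AE_right_derivative[OF gI] by blast
    obtain N2 where N2: "negligible N2" "\<And>x e. \<lbrakk>x \<notin> N2; 0 < e\<rbrakk> \<Longrightarrow> \<exists>d>0. \<forall>h. 0 < h \<and> h < d \<longrightarrow>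
        norm (integral {x..x + h} (\<lambda>x. g (- x)) /\<^sub>R h - g (- x)) < e"
      using integrable_AE_right_derivative[OF g'I] by blast
    have "negligible (uminus ` N2)"
      by (rule negligible_differentiable_image_negligible)
        (use N2 in \<open>auto intro!: differentiable_on_minus differentiable_on_ident\<close>)
    then have neg: "negligible (N1 \<union> uminus ` N2)" using N1 by auto
    have "(F has_vector_derivative f x) (at x)"
      if x: "x \<in> {inverse c<..<c}" and xN: "x \<notin> N1 \<union> uminus ` N2" for x
      unfolding has_vector_derivative_def has_derivative_at_alt
    proof (intro conjI allI impI)
      show "bounded_linear (\<lambda>h. h *\<^sub>R f x)" by (rule bounded_linear_scaleR_left)
      fix e :: real assume e: "0 < e"
      have x1: "x \<notin> N1" and x2: "- x \<notin> N2" using xN by (auto simp: image_iff) 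
      from N1(2)[OF x1 e] obtain d1 where d1: "d1 > 0" 
        "\<And>h. 0 < h \<Longrightarrow> h < d1 \<Longrightarrow> norm (integral {x..x + h} g /\<^sub>R h - g x) < e" by blast
      from N2(2)[OF x2 e] obtain d2 where d2: "d2 > 0" 
        "\<And>h. 0 < h \<Longrightarrow> h < d2 \<Longrightarrow> norm (integral {-x..-x + h} (\<lambda>x. g (- x)) /\<^sub>R h - g x) < e" by auto
      define d where "d = min (min d1 d2) (min (x - inverse c) (c - x))"
      have d: "0 < d" using d1 d2 x by (auto simp: d_def)
      have gx: "g x = f x" using x by (auto simp: g_def)
      have Fi: "integral {u..v} g = F v - F u" if "inverse c \<le> u" "u \<le> v" "v \<le> c" for u v
      proof -
        have "integral {u..v} g = integral {u..v} f"
          by (rule integral_cong) (use that in \<open>auto simp: g_def\<close>)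
        also have "\<dots> = F v - F u"
          by (rule integral_unique, rule primitive_has_integral[OF F]) (use that c(1) in linarith)+
        finally show ?thesis .
      qed
      show "\<exists>d>0. \<forall>y. norm (y - x) < d \<longrightarrow> norm (F y - F x - (y - x) *\<^sub>R f x) \<le> e * norm (y - x)"
      proof (intro exI[of _ d] conjI d allI impI)
        fix y assume y: "norm (y - x) < d"
        consider "y = x" | "x < y" | "y < x" by linarith
        then show "norm (F y - F x - (y - x) *\<^sub>R f x) \<le> e * norm (y - x)"
        proof cases
          case 2
          then have "norm (integral {x..x + (y - x)} g /\<^sub>R (y - x) - g x) < e"
            using y d1(2)[of "y - x"] by (simp add: d_def)
          moreover have "integral {x..x + (y - x)} g = F y - F x"
            using 2 x y Fi[of x y] by (simp add: d_def)
          ultimately have "norm ((F y - F x) /\<^sub>R (y - x) - f x) < e" by (simp add: gx)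
          moreover have "F y - F x - (y - x) *\<^sub>R f x = (y - x) *\<^sub>R ((F y - F x) /\<^sub>R (y - x) - f x)"
            using 2 by (simp add: scaleR_diff_right)
          then have "norm (F y - F x - (y - x) *\<^sub>R f x) = norm ((F y - F x) /\<^sub>R (y - x) - f x) * norm (y - x)"
            by simp
          ultimately show ?thesis by (simp add: mult_right_mono)
        next
          case 3
          then have "norm (integral {-x..-x + (x - y)} (\<lambda>x. g (- x)) /\<^sub>R (x - y) - g x) < e"
            using y d2(2)[of "x - y"] by (simp add: d_def)
          moreover have "integral {-x..-x + (x - y)} (\<lambda>x. g (- x)) = F x - F y"
            using 3 x y Fi[of y x] Henstock_Kurzweil_Integration.integral_reflect_real[where a=y and b=x and f=g]
            by (simp add: d_def)
          ultimately have "norm ((F x - F y) /\<^sub>R (x - y) - f x) < e" by (simp add: gx)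
          moreover have "F y - F x - (y - x) *\<^sub>R f x = - ((x - y) *\<^sub>R ((F x - F y) /\<^sub>R (x - y) - f x))"
            using 3 by (simp add: scaleR_diff_right) (simp add: algebra_simps)
          then have "norm (F y - F x - (y - x) *\<^sub>R f x) = norm ((F x - F y) /\<^sub>R (x - y) - f x) * norm (y - x)"
            by (simp add: abs_minus_commute)
          ultimately show ?thesis by (simp add: mult_right_mono)
        qed simp
      qed
    qed
    with neg show ?thesis unfolding Q_def c_def[symmetric] by blast
  qed
  then have "AE x in half_line. Q n x" for n by (simp add: AE_half_line_iff)
  then have "AE x in half_line. \<forall>n. Q n x" by (simp add: AE_all_countable)
  moreover have "AE x in half_line. 0 < x" by (rule AE_I2) (simp add: space_restrict_space)
  ultimately show ?thesis
  proof eventually_elim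
    case (elim x)
    obtain n1 :: nat where "inverse x < real n1" using reals_Archimedean2 by blast
    moreover obtain n2 :: nat where "x < real n2" using reals_Archimedean2 by blast
    ultimately have "x \<in> {inverse (real (Suc (n1 + n2)))<..<real (Suc (n1 + n2))}"
      using elim(2) less_imp_inverse_less[of "inverse x" "real (Suc (n1 + n2))"]
      by (auto intro: less_trans[OF _ less_le_trans])
    then show ?case using elim(1) unfolding Q_def by blast
  qed
qed

lemma ac_on_AE_derivative_primitive:
  assumes ac: "\<And>a b. 0 < a \<Longrightarrow> a < b \<Longrightarrow> ac_on a b F"
    and der: "AE x in half_line. (F has_vector_derivative f x) (at x)"
    and int: "\<And>a b. 0 < a \<Longrightarrow> a \<le> b \<Longrightarrow> f absolutely_integrable_on {a..b}"
  shows "primitive F f"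
  unfolding primitive_def
proof (intro allI impI conjI)
  fix a b :: real assume ab: "0 < a" "a \<le> b"
  show "f absolutely_integrable_on {a..b}" using int ab by blast
  show "(f has_integral F b - F a) {a..b}"
  proof (cases "a = b")
    case False
    obtain N where N: "negligible N" "\<And>x. 0 < x \<Longrightarrow> x \<notin> N \<Longrightarrow> (F has_vector_derivative f x) (at x)"
      using der unfolding AE_half_line_iff by blast
    show ?thesis
      by (rule ac_on_FTC[OF ac _ N(1)]) (use ab False N in \<open>auto intro: has_vector_derivative_at_within\<close>)
  qed (simp add: has_integral_refl(2)[where a=b, simplified])
qed


lemma primitive_of_C1:
  assumes "\<And>x. 0 < x \<Longrightarrow> (F has_vector_derivative f x) (at x)" "continuous_on {0<..} f"
  shows "primitive F f"
  unfolding primitive_def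
proof (intro allI impI conjI)
  fix a b :: real assume ab: "0 < a" "a \<le> b"
  then have "{a..b} \<subseteq> {0<..}" by auto
  then show "f absolutely_integrable_on {a..b}"
    using absolutely_integrable_continuous_real continuous_on_subset[OF assms(2)] by blast
  show "(f has_integral F b - F a) {a..b}"
    by (rule fundamental_theorem_of_calculus)
      (use ab assms(1) in \<open>auto intro: has_vector_derivative_at_within\<close>)
qed

lemma primitive_continuous_on:
  assumes "primitive F f" shows "continuous_on {0<..} F"
proof (rule continuous_at_imp_continuous_on, rule ballI)
  fix x :: real assume "x \<in> {0<..}"
  then have x: "0 < x / 2" "x / 2 < x" "x < 2 * x" by auto
  have "continuous_on {x/2..2*x} (\<lambda>y. F (x/2) + integral {x/2..y} f)"
    using primitive_absolutely_integrable[OF assms x(1)] set_lebesgue_integral_eq_integral(1)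
    by (intro continuous_intros indefinite_integral_continuous_1) blast
  moreover have "F (x/2) + integral {x/2..y} f = F y" if "y \<in> {x/2..2*x}" for y
    using primitive_has_integral[OF assms x(1), of y] that by (simp add: integral_unique)
  ultimately have "continuous_on {x/2..2*x} F" by (rule continuous_on_eq)
  then have "continuous_on {x/2<..<2*x} F" by (rule continuous_on_subset) auto
  then show "isCont F x" using x by (simp add: continuous_on_eq_continuous_at)
qed

lemma primitive_cong_AE:
  assumes F: "primitive F f" and g: "AE x in half_line. f x = g x"
    and G: "\<And>x. 0 < x \<Longrightarrow> F x = G x"
  shows "primitive G g"
  unfolding primitive_def
proof (intro allI impI conjI)
  fix a b :: real assume ab: "0 < a" "a \<le> b"
  obtain N where N: "negligible N" "\<forall>x>0. x \<notin> N \<longrightarrow> f x = g x"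
    using g unfolding AE_half_line_iff by blast
  show "g absolutely_integrable_on {a..b}"
    by (rule absolutely_integrable_spike[OF primitive_absolutely_integrable[OF F ab(1)] N(1)])
      (use N(2) ab in auto)
  have "(g has_integral F b - F a) {a..b}"
    by (rule has_integral_spike[OF N(1) _ primitive_has_integral[OF F ab]]) (use N(2) ab in auto)
  then show "(g has_integral G b - G a) {a..b}" using G ab by simp
qed

lemma primitive_add:
  assumes "primitive F f" "primitive G g"
  shows "primitive (\<lambda>x. F x + G x) (\<lambda>x. f x + g x)"
  unfolding primitive_def
proof (intro allI impI conjI)
  fix a b :: real assume ab: "0 < a" "a \<le> b"
  show "(\<lambda>x. f x + g x) absolutely_integrable_on {a..b}"
    by (intro set_integral_add primitive_absolutely_integrable[OF assms(1) ab(1)]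
       primitive_absolutely_integrable[OF assms(2) ab(1)])
  show "((\<lambda>x. f x + g x) has_integral F b + G b - (F a + G a)) {a..b}"
    using has_integral_add[OF primitive_has_integral[OF assms(1) ab] primitive_has_integral[OF assms(2) ab]]
    by (simp add: algebra_simps)
qed

lemma primitive_linear:
  assumes F: "primitive F f" and h: "bounded_linear h"
  shows "primitive (\<lambda>x. h (F x)) (\<lambda>x. h (f x))"
  unfolding primitive_def
proof (intro allI impI conjI)
  fix a b :: real assume ab: "0 < a" "a \<le> b"
  show "(\<lambda>x. h (f x)) absolutely_integrable_on {a..b}"
    using absolutely_integrable_linear[OF primitive_absolutely_integrable[OF F ab(1)] h] by (simp add: o_def)
  show "((\<lambda>x. h (f x)) has_integral h (F b) - h (F a)) {a..b}"
    using has_integral_linear[OF primitive_has_integral[OF F ab] h]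
    by (simp add: o_def linear_diff[OF bounded_linear.linear[OF h]])
qed

lemma primitive_diff:
  assumes "primitive F f" "primitive G g"
  shows "primitive (\<lambda>x. F x - G x) (\<lambda>x. f x - g x)"
proof -
  have "primitive (\<lambda>x. - G x) (\<lambda>x. - g x)"
    by (rule primitive_linear[OF assms(2) bounded_linear_minus[OF bounded_linear_ident]])
  from primitive_add[OF assms(1) this] show ?thesis by simp
qed

lemma primitive_const: "primitive (\<lambda>x. c) (\<lambda>x. 0)"
  by (rule primitive_of_C1) (auto intro!: derivative_eq_intros)

lemma ac_on_mult:
  fixes F G :: "real \<Rightarrow> 'a::{euclidean_space,real_normed_algebra}"
  assumes F: "ac_on a b F" and G: "ac_on a b G"
    and cF: "continuous_on {a..b} F" and cG: "continuous_on {a..b} G"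
  shows "ac_on a b (\<lambda>x. F x * G x)"
proof -
  obtain B where B: "0 < B" "\<And>x. x \<in> {a..b} \<Longrightarrow> norm (F x) \<le> B"
    using compact_imp_bounded[OF compact_continuous_image[OF cF compact_Icc]] by (auto simp: bounded_pos)
  obtain C where C: "0 < C" "\<And>x. x \<in> {a..b} \<Longrightarrow> norm (G x) \<le> C"
    using compact_imp_bounded[OF compact_continuous_image[OF cG compact_Icc]] by (auto simp: bounded_pos)
  show ?thesis
    unfolding ac_on_def
  proof (intro allI impI)
    fix e :: real assume e: "0 < e"
    have eC: "0 < e / (2 * C)" and eB: "0 < e / (2 * B)" using e B C by auto
    obtain d1 where d1: "0 < d1" "\<forall>\<D> T. \<D> division_of T \<and> T \<subseteq> {a..b} \<and> (\<Sum>K\<in>\<D>. Sup K - Inf K) < d1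
        \<longrightarrow> (\<Sum>K\<in>\<D>. norm (F (Sup K) - F (Inf K))) < e / (2 * C)"
      using F[unfolded ac_on_def, rule_format, OF eC] by (elim exE conjE)
    obtain d2 where d2: "0 < d2" "\<forall>\<D> T. \<D> division_of T \<and> T \<subseteq> {a..b} \<and> (\<Sum>K\<in>\<D>. Sup K - Inf K) < d2
        \<longrightarrow> (\<Sum>K\<in>\<D>. norm (G (Sup K) - G (Inf K))) < e / (2 * B)"
      using G[unfolded ac_on_def, rule_format, OF eB] by (elim exE conjE)
    show "\<exists>\<delta>>0. \<forall>\<D> T. \<D> division_of T \<and> T \<subseteq> {a..b} \<and> (\<Sum>K\<in>\<D>. Sup K - Inf K) < \<delta>
        \<longrightarrow> (\<Sum>K\<in>\<D>. norm (F (Sup K) * G (Sup K) - F (Inf K) * G (Inf K))) < e"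
    proof (intro exI[of _ "min d1 d2"] conjI allI impI)
      show "0 < min d1 d2" using d1 d2 by simp
      fix \<D> T assume "\<D> division_of T \<and> T \<subseteq> {a..b} \<and> (\<Sum>K\<in>\<D>. Sup K - Inf K) < min d1 d2"
      then have D: "\<D> division_of T" and T: "T \<subseteq> {a..b}" 
        and s1: "(\<Sum>K\<in>\<D>. Sup K - Inf K) < d1" and s2: "(\<Sum>K\<in>\<D>. Sup K - Inf K) < d2" by auto
      have K: "Sup K \<in> {a..b} \<and> Inf K \<in> {a..b}" if "K \<in> \<D>" for K
      proof -
        from division_ofD(4)[OF D that] obtain u v where uv: "K = {u..v}" by (auto simp: cbox_interval)
        moreover have "K \<subseteq> T" "K \<noteq> {}" using division_ofD(2,3)[OF D that] by auto
        ultimately have "u \<le> v" "{u..v} \<subseteq> {a..b}" using order_trans[of K T "{a..b}"] T by auto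
        then show ?thesis using uv by auto
      qed
      have "norm (F (Sup K) * G (Sup K) - F (Inf K) * G (Inf K))
          \<le> C * norm (F (Sup K) - F (Inf K)) + B * norm (G (Sup K) - G (Inf K))" if "K \<in> \<D>" for K
      proof -
        have "F (Sup K) * G (Sup K) - F (Inf K) * G (Inf K)
          = (F (Sup K) - F (Inf K)) * G (Sup K) + F (Inf K) * (G (Sup K) - G (Inf K))"
          by (simp add: algebra_simps)
        also have "norm \<dots> \<le> norm (F (Sup K) - F (Inf K)) * norm (G (Sup K)) + norm (F (Inf K)) * norm (G (Sup K) - G (Inf K))"
          by (intro norm_triangle_le add_mono norm_mult_ineq)
        also have "\<dots> \<le> norm (F (Sup K) - F (Inf K)) * C + B * norm (G (Sup K) - G (Inf K))"
          using B(2) C(2) K[OF that] by (intro add_mono mult_left_mono mult_right_mono) auto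
        finally show ?thesis by (simp add: mult.commute)
      qed
      then have "(\<Sum>K\<in>\<D>. norm (F (Sup K) * G (Sup K) - F (Inf K) * G (Inf K)))
          \<le> (\<Sum>K\<in>\<D>. C * norm (F (Sup K) - F (Inf K)) + B * norm (G (Sup K) - G (Inf K)))"
        by (rule sum_mono)
      also have "\<dots> = C * (\<Sum>K\<in>\<D>. norm (F (Sup K) - F (Inf K))) + B * (\<Sum>K\<in>\<D>. norm (G (Sup K) - G (Inf K)))"
        by (simp add: sum.distrib sum_distrib_left)
      also have "\<dots> < C * (e / (2 * C)) + B * (e / (2 * B))"
        using d1(2)[rule_format, of \<D> T] d2(2)[rule_format, of \<D> T] D T s1 s2 B(1) C(1)
        by (intro add_strict_mono mult_strict_left_mono) simp_all
      also have "\<dots> = e" using B(1) C(1) by simp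
      finally show "(\<Sum>K\<in>\<D>. norm (F (Sup K) * G (Sup K) - F (Inf K) * G (Inf K))) < e" .
    qed
  qed
qed

lemma absolutely_integrable_mult_continuous:
  fixes F g :: "real \<Rightarrow> 'a::{euclidean_space,real_normed_algebra}"
  assumes F: "continuous_on {a..b} F" and g: "g absolutely_integrable_on {a..b}"
  shows "(\<lambda>x. F x * g x) absolutely_integrable_on {a..b}" "(\<lambda>x. g x * F x) absolutely_integrable_on {a..b}"
proof -
  have m: "F \<in> borel_measurable (lebesgue_on {a..b})"
    using F by (rule continuous_imp_measurable_on_sets_lebesgue) simp
  have b: "bounded (F ` {a..b})"
    using compact_imp_bounded[OF compact_continuous_image[OF F compact_Icc]] .
  show "(\<lambda>x. F x * g x) absolutely_integrable_on {a..b}"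
    by (rule absolutely_integrable_bounded_measurable_product[OF _ m _ b g])
      (auto simp: bilinear_conv_bounded_bilinear bounded_bilinear_mult)
  show "(\<lambda>x. g x * F x) absolutely_integrable_on {a..b}"
    by (rule absolutely_integrable_bounded_measurable_product[OF _ m _ b g, where h="\<lambda>x y. y * x"])
      (auto simp: bilinear_conv_bounded_bilinear bounded_bilinear.flip[OF bounded_bilinear_mult])
qed

text \<open>The product rule holds at almost every point, and the product of absolutely continuous functions is
  absolutely continuous; this is the source of all integrations by parts.\<close>
lemma primitive_mult:
  fixes F G :: "real \<Rightarrow> 'a::{euclidean_space,real_normed_algebra}"
  assumes F: "primitive F f" and G: "primitive G g"
  shows "primitive (\<lambda>x. F x * G x) (\<lambda>x. F x * g x + f x * G x)"
proof (rule ac_on_AE_derivative_primitive)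
  have cont: "continuous_on {a..b} F" "continuous_on {a..b} G" if "0 < a" for a b :: real
    using primitive_continuous_on[OF F] primitive_continuous_on[OF G] that
    by (auto elim!: continuous_on_subset)
  show "ac_on a b (\<lambda>x. F x * G x)" if "0 < a" "a < b" for a b
    by (rule ac_on_mult[OF primitive_ac_on[OF F] primitive_ac_on[OF G]]) (use that cont in auto)
  show "AE x in half_line. ((\<lambda>x. F x * G x) has_vector_derivative F x * g x + f x * G x) (at x)"
    using primitive_AE_derivative[OF F] primitive_AE_derivative[OF G]
    by eventually_elim (rule has_vector_derivative_mult)
  show "(\<lambda>x. F x * g x + f x * G x) absolutely_integrable_on {a..b}" if "0 < a" "a \<le> b" for a b
    by (intro set_integral_add absolutely_integrable_mult_continuous cont[OF that(1)]
       primitive_absolutely_integrable[OF F that(1)] primitive_absolutely_integrable[OF G that(1)])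
qed

section \<open>Square-integrable functions on the half-line\<close>

lemma L2_eq_refl_iff [simp]: "L2_eq f f \<longleftrightarrow> square_integrable f"
  by (simp add: L2_eq_def)

lemma L2_class_eq_iff:
  "square_integrable f \<Longrightarrow> square_integrable g \<Longrightarrow>
     L2_class f = L2_class g \<longleftrightarrow> (AE x in half_line. f x = g x)"
  using Quotient3_rel[OF Quotient3_half_line_L2, of f g] by (simp add: L2_eq_def)

lemma square_integrable_L2_rep [simp]: "square_integrable (L2_rep u)"
  using Quotient3_rep_reflp[OF Quotient3_half_line_L2, of u] by simp

lemma L2_class_rep [simp]: "L2_class (L2_rep u) = u"
  by (rule Quotient3_abs_rep[OF Quotient3_half_line_L2])

lemma L2_rep_class:
  "square_integrable f \<Longrightarrow> AE x in half_line. L2_rep (L2_class f) x = f x"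
  using L2_class_eq_iff[of "L2_rep (L2_class f)" f] by simp

lemmas L2_class_ops =
  cinner.abs_eq[unfolded L2_eq_refl_iff] plus_half_line_L2.abs_eq[unfolded L2_eq_refl_iff]
  cscale.abs_eq[unfolded L2_eq_refl_iff] uminus_half_line_L2.abs_eq[unfolded L2_eq_refl_iff]
  zero_half_line_L2.abs_eq

lemma square_integrable_uminus: "square_integrable f \<Longrightarrow> square_integrable (\<lambda>x. - f x)"
  by (simp add: square_integrable_def)

lemma square_integrable_diff:
  "square_integrable f \<Longrightarrow> square_integrable g \<Longrightarrow> square_integrable (\<lambda>x. f x - g x)"
  using square_integrable_add[OF _ square_integrable_uminus, of f g] by simp

lemma L2_class_diff:
  "square_integrable f \<Longrightarrow> square_integrable g \<Longrightarrow>
     L2_class f - L2_class g = L2_class (\<lambda>x. f x - g x)"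
  by (simp add: minus_half_line_L2_def L2_class_ops square_integrable_uminus)

lemma square_integrable_cnj: "square_integrable f \<Longrightarrow> square_integrable (\<lambda>x. cnj (f x))"
  by (auto simp: square_integrable_def)

lemma square_integrable_measurable: "square_integrable f \<Longrightarrow> f \<in> borel_measurable half_line"
  by (simp add: square_integrable_def)

lemma integrable_half_line_iff: "integrable half_line f \<longleftrightarrow> f absolutely_integrable_on {0<..}"
  by (simp add: integrable_restrict_space set_integrable_def)

lemma integrable_mult_square_integrable:
  assumes "square_integrable f" "square_integrable g"
  shows "integrable half_line (\<lambda>x. f x * g x)"
  using integrable_mult_cnj[OF assms(1) square_integrable_cnj[OF assms(2)]] by simp

lemma square_integrable_bound:
  assumes f: "f \<in> borel_measurable half_line" and g: "square_integrable g"
    and le: "AE x in half_line. cmod (f x) \<le> C * cmod (g x)"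
  shows "square_integrable f"
proof -
  have "integrable half_line (\<lambda>x. C\<^sup>2 * (cmod (g x))\<^sup>2)"
    using g by (simp add: square_integrable_def)
  moreover have "(\<lambda>x. (cmod (f x))\<^sup>2) \<in> borel_measurable half_line" using f by measurable
  moreover have "AE x in half_line. norm ((cmod (f x))\<^sup>2) \<le> norm (C\<^sup>2 * (cmod (g x))\<^sup>2)"
    using le
  proof eventually_elim
    case (elim x)
    then have "(cmod (f x))\<^sup>2 \<le> (C * cmod (g x))\<^sup>2" by (intro power_mono) auto
    then show ?case by (simp add: power_mult_distrib)
  qed
  ultimately have "integrable half_line (\<lambda>x. (cmod (f x))\<^sup>2)"
    by (rule Bochner_Integration.integrable_bound)
  with f show ?thesis by (simp add: square_integrable_def)
qed

lemma half_line_space [simp]: "space half_line = {0<..}"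
  by (simp add: space_restrict_space)

lemma AE_half_line_I: "(\<And>x. 0 < x \<Longrightarrow> P x) \<Longrightarrow> AE x in half_line. P x"
  by (rule AE_I2) simp

lemma continuous_imp_half_line_measurable:
  fixes f :: "real \<Rightarrow> 'a::{euclidean_space}"
  shows "continuous_on {0<..} f \<Longrightarrow> f \<in> borel_measurable half_line"
  by (rule continuous_imp_measurable_on_sets_lebesgue) auto

lemma primitive_measurable: "primitive F f \<Longrightarrow> F \<in> borel_measurable half_line"
  by (intro continuous_imp_half_line_measurable primitive_continuous_on)

lemma absolutely_integrable_Icc_0:
  fixes f :: "real \<Rightarrow> 'a::euclidean_space"
  assumes "integrable half_line f" shows "f absolutely_integrable_on {0..b}"
proof -
  have "f absolutely_integrable_on {0<..}" using assms by (simp add: integrable_half_line_iff)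
  then have "f absolutely_integrable_on {0..}"
    by (rule absolutely_integrable_spike_set) (auto intro: negligible_subset[of "{0}"])
  then show ?thesis by (rule set_integrable_subset) auto
qed

lemma square_integrable_absolutely_integrable:
  assumes f: "square_integrable f" shows "f absolutely_integrable_on {0..b}"
proof -
  have "square_integrable (\<lambda>x. indicator {0..b} x)"
  proof -
    have "integrable half_line (indicat_real {0..b})"
      using fmeasurable_Int_fmeasurable[of "{0..b}" lebesgue "{0<..}"] lmeasurable_interval(1)[of 0 b]
      by (simp add: integrable_half_line_iff set_integrable_def indicator_inter_arith[symmetric]
          lmeasurable_iff_integrable Int_commute)
    moreover have "(\<lambda>x. (cmod (indicator {0..b} x))\<^sup>2) = indicat_real {0..b}" by (auto simp: indicator_def)
    moreover have "(\<lambda>x. indicator {0..b} x :: complex) \<in> borel_measurable half_line"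
      by (rule measurable_restrict_space1) (rule borel_measurable_indicator, simp)
    ultimately show ?thesis by (simp add: square_integrable_def)
  qed
  from integrable_mult_square_integrable[OF f this] 
  have "(\<lambda>x. f x * indicator {0..b} x) absolutely_integrable_on {0..b}" by (rule absolutely_integrable_Icc_0)
  then show ?thesis 
    by (rule absolutely_integrable_spike[where S="{}", simplified]) auto
qed

text \<open>Monotone convergence along the intervals \<open>[1/n, n]\<close>.\<close>
lemma integrable_half_line_bounded_integrals:
  fixes h :: "real \<Rightarrow> real"
  assumes int: "\<And>a b. 0 < a \<Longrightarrow> a \<le> b \<Longrightarrow> h integrable_on {a..b}"
    and nn: "\<And>x. 0 < x \<Longrightarrow> 0 \<le> h x"
    and B: "\<And>a b. 0 < a \<Longrightarrow> a \<le> b \<Longrightarrow> integral {a..b} h \<le> B"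
  shows "integrable half_line h"
proof -
  define I where "I n = {inverse (real (Suc n))..real (Suc n)}" for n
  define f where "f n x = (if x \<in> I n then h x else 0)" for n x
  have one: "1 \<le> real (Suc n)" for n by simp
  have I0: "0 < inverse (real (Suc n))" "inverse (real (Suc n)) \<le> real (Suc n)" for n
    using one[of n] inverse_le_1_iff[of "real (Suc n)"] by (simp, linarith)
  have "0 < x" if "x \<in> I n" for x n
    using I0(1)[of n] that unfolding I_def atLeastAtMost_iff by linarith
  then have Isub: "I n \<inter> {0<..} = I n" "I n \<subseteq> {0<..}" for n
    by auto
  have mono: "I n \<subseteq> I (Suc n)" for n
  proof -
    have "inverse (real (Suc (Suc n))) \<le> inverse (real (Suc n))"
      by (rule le_imp_inverse_le) auto
    then show ?thesis unfolding I_def by auto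
  qed
  have int_f: "f n integrable_on {0<..}" for n
    unfolding f_def using int[OF I0[of n]] I_def Isub
    by (subst integrable_restrict_Int) simp
  have "h integrable_on {0<..} \<and> (\<lambda>n. integral {0<..} (f n)) \<longlonglongrightarrow> integral {0<..} h"
  proof (rule monotone_convergence_increasing[OF int_f])
    show "f n x \<le> f (Suc n) x" if "x \<in> {0<..}" for n x
      using mono[of n] nn[of x] that by (auto simp: f_def)
    show "(\<lambda>n. f n x) \<longlonglongrightarrow> h x" if x: "x \<in> {0<..}" for x
    proof (rule tendsto_eventually)
      obtain n1 :: nat where n1: "inverse x < real n1" using reals_Archimedean2 by blast
      obtain n2 :: nat where n2: "x < real n2" using reals_Archimedean2 by blast
      show "\<forall>\<^sub>F n in sequentially. f n x = h x"
      proof (rule eventually_sequentiallyI[of "n1 + n2"])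
        fix n assume n: "n1 + n2 \<le> n"
        have "inverse x \<le> real (Suc n)" using n1 n by linarith
        then have "inverse (real (Suc n)) \<le> inverse (inverse x)"
          using x by (intro le_imp_inverse_le) auto
        then have "x \<in> I n" using n2 n x by (simp add: I_def)
        then show "f n x = h x" by (simp add: f_def)
      qed
    qed
    show "bounded (range (\<lambda>n. integral {0<..} (f n)))"
    proof (rule boundedI)
      fix y assume "y \<in> range (\<lambda>n. integral {0<..} (f n))"
      then obtain n where y: "y = integral {0<..} (f n)" by blast
      have "y = integral (I n) h" unfolding y f_def by (subst integral_restrict_Int) (simp add: Isub)
      moreover have "integral (I n) h \<le> B" unfolding I_def by (rule B[OF I0])
      moreover have "0 \<le> integral (I n) h" 
        by (rule integral_nonneg) (use int[OF I0[of n]] nn Isub(2)[of n] in \<open>auto simp: I_def subset_iff\<close>)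
      ultimately show "norm y \<le> B" by simp
    qed
  qed
  then have "h absolutely_integrable_on {0<..}"
    using nn by (intro nonnegative_absolutely_integrable_1) auto
  then show ?thesis by (simp add: integrable_half_line_iff)
qed

text \<open>If the derivative is integrable up to \<open>0\<close>, then \<open>F\<close> has a limit \<open>L\<close>
  there. Boundary values of Wronskians arise in this way.\<close>
lemma primitive_eq_from_0:
  assumes F: "primitive F f" and f: "\<And>b. f absolutely_integrable_on {0..b}"
  obtains L where "\<And>x. 0 < x \<Longrightarrow> F x = L + integral {0..x} f"
proof
  have fi: "f integrable_on {0..b}" for b using f set_lebesgue_integral_eq_integral(1) by blast
  have *: "F y - F x = integral {0..y} f - integral {0..x} f" if "0 < x" "x \<le> y" for x y
    using Henstock_Kurzweil_Integration.integral_combine[of 0 x y f] that fi[of y] primitive_has_integral[OF F that]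
    by (simp add: integral_unique algebra_simps)
  show "F x = (F 1 - integral {0..1} f) + integral {0..x} f" if "0 < x" for x
    using *[of x 1] *[of 1 x] that by (cases "x \<le> 1") (auto simp: algebra_simps)
qed

lemma integral_from_0_tendsto_0:
  fixes f :: "real \<Rightarrow> 'a::euclidean_space"
  assumes f: "f absolutely_integrable_on {0..1}"
  shows "((\<lambda>x. integral {0..x} f) \<longlongrightarrow> 0) (at_right 0)"
proof -
  have "continuous_on {0..1} (\<lambda>x. integral {0..x} f)"
    using f set_lebesgue_integral_eq_integral(1) by (intro indefinite_integral_continuous_1) blast
  from continuous_on_Icc_at_rightD[OF this] show ?thesis by simp
qed

lemma integral_to_infinity:
  fixes f :: "real \<Rightarrow> 'a::euclidean_space"
  assumes f: "integrable half_line f"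
  shows "(\<lambda>n. integral {0..real n} f) \<longlonglongrightarrow> (LINT x|half_line. f x)"
proof -
  have "(\<lambda>n. LINT x|half_line. indicator {0<..real n} x *\<^sub>R f x) \<longlonglongrightarrow> (LINT x|half_line. f x)"
  proof (rule integral_dominated_convergence[where w="\<lambda>x. norm (f x)"])
    show "AE x in half_line. (\<lambda>n. indicator {0<..real n} x *\<^sub>R f x) \<longlonglongrightarrow> f x"
    proof (rule AE_half_line_I, rule tendsto_eventually)
      fix x :: real assume "0 < x"
      obtain n2 :: nat where n2: "x < real n2" using reals_Archimedean2 by blast
      show "\<forall>\<^sub>F n in sequentially. indicator {0<..real n} x *\<^sub>R f x = f x"
        by (rule eventually_sequentiallyI[of n2]) (use n2 \<open>0 < x\<close> in auto)
    qed
    have [measurable]: "f \<in> borel_measurable half_line" using f by simp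
    show "(\<lambda>x. indicator {0<..real n} x *\<^sub>R f x) \<in> borel_measurable half_line" for n
      by (intro borel_measurable_scaleR borel_measurable_indicator) (auto simp: sets_restrict_space)
  qed (use f in \<open>auto simp: indicator_def\<close>)
  moreover have "(LINT x|half_line. indicator {0<..real n} x *\<^sub>R f x) = integral {0..real n} f" for n
  proof -
    have "(LINT x|half_line. indicator {0<..real n} x *\<^sub>R f x) = (LINT x:{0<..real n}|lebesgue. f x)"
      by (subst integral_restrict_space) (auto simp: set_lebesgue_integral_def indicator_def intro!: Bochner_Integration.integral_cong)
    also have "\<dots> = integral {0<..real n} f"
      by (rule set_lebesgue_integral_eq_integral(2), rule set_integrable_subset[OF absolutely_integrable_Icc_0[OF f]]) auto
    also have "\<dots> = integral {0..real n} f"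
      by (rule integral_spike_set) (auto intro: negligible_subset[of "{0}"])
    finally show ?thesis .
  qed
  ultimately show ?thesis by simp
qed

text \<open>The integral of \<open>F'\<close> over the half-line picks up only the boundary term at zero, because
  \<open>F\<close> vanishes near infinity.\<close>
lemma primitive_boundary_value:
  assumes F: "primitive F f" and f: "integrable half_line f"
    and F0: "\<And>x. b \<le> x \<Longrightarrow> F x = 0" and L: "\<And>x. 0 < x \<Longrightarrow> F x = L + integral {0..x} f"
  shows "(LINT x|half_line. f x) = - L"
proof (rule LIMSEQ_unique[OF integral_to_infinity[OF f]])
  show "(\<lambda>n. integral {0..real n} f) \<longlonglongrightarrow> - L"
  proof (rule tendsto_eventually)
    obtain n2 :: nat where n2: "max b 0 < real n2" using reals_Archimedean2 by blast
    show "\<forall>\<^sub>F n in sequentially. integral {0..real n} f = - L"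
    proof (rule eventually_sequentiallyI[of n2])
      fix n assume "n2 \<le> n"
      then have "0 < real n" "b \<le> real n" using n2 by auto
      with F0 L[of "real n"] show "integral {0..real n} f = - L" by (simp add: eq_neg_iff_add_eq_0 add.commute)
    qed
  qed
qed

lemma AE_half_line_continuous_eq:
  fixes f g :: "real \<Rightarrow> complex"
  assumes "continuous_on {0<..} f" "continuous_on {0<..} g" and ae: "AE x in half_line. f x = g x" and x: "0 < x"
  shows "f x = g x"
proof (rule ccontr)
  assume ne: "f x \<noteq> g x"
  have c: "continuous_on {0<..} (\<lambda>x. f x - g x)" using assms by (intro continuous_intros)
  have "open ((\<lambda>x. f x - g x) -` (- {0}) \<inter> {0<..})"
    by (rule continuous_open_preimage[OF c, of "- {0}", unfolded Int_commute[of "{0<..}"]]) auto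
  moreover have "x \<in> (\<lambda>x. f x - g x) -` (- {0}) \<inter> {0<..}" using ne x by auto
  ultimately have "\<not> negligible ((\<lambda>x. f x - g x) -` (- {0}) \<inter> {0<..})"
    using open_not_negligible by blast
  moreover obtain N where "negligible N" "\<forall>x>0. x \<notin> N \<longrightarrow> f x = g x"
    using ae unfolding AE_half_line_iff by blast
  then have "negligible ((\<lambda>x. f x - g x) -` (- {0}) \<inter> {0<..})"
    by (elim negligible_subset) auto
  ultimately show False by blast
qed

section \<open>Hardy's inequality\<close>

lemma square_integrable_powr_near_0:
  assumes a: "- 1 / 2 < a"
  shows "square_integrable (\<lambda>x. complex_of_real (if x \<le> b then x powr a else 0))"
proof -
  have "(\<lambda>x. x powr (2 * a)) absolutely_integrable_on {0..max b 0}"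
    by (rule nonnegative_absolutely_integrable_1)
      (use a integrable_on_powr_from_0[of "2 * a" "max b 0"] in auto)
  then have "(\<lambda>x. x powr (2 * a)) absolutely_integrable_on {0<..max b 0}"
    by (rule set_integrable_subset) auto
  moreover have "indicator {0<..max b 0} x *\<^sub>R x powr (2 * a)
      = indicator {0<..} x *\<^sub>R (cmod (complex_of_real (if x \<le> b then x powr a else 0)))\<^sup>2" for x
    by (auto simp: indicator_def power2_eq_square simp flip: powr_add)
  ultimately have 1: "integrable half_line (\<lambda>x. (cmod (complex_of_real (if x \<le> b then x powr a else 0)))\<^sup>2)"
    unfolding integrable_half_line_iff set_integrable_def by simp
  have "(\<lambda>x::real. if x \<le> b then x powr a else 0) \<in> borel_measurable borel"
    by measurable
  then have "(\<lambda>x::real. if x \<le> b then x powr a else 0) \<in> borel_measurable half_line"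
    by (intro measurable_restrict_space1) (simp add: measurable_completion)
  then have "(\<lambda>x. complex_of_real (if x \<le> b then x powr a else 0)) \<in> borel_measurable half_line"
    by measurable
  with 1 show ?thesis by (simp add: square_integrable_def)
qed

lemma absolutely_integrable_mult_L2_near_0:
  assumes g: "square_integrable g" and h: "square_integrable (\<lambda>x. if x \<le> b then h x else 0)"
  shows "(\<lambda>x. g x * h x) absolutely_integrable_on {0..b}"
  by (rule absolutely_integrable_spike[OF absolutely_integrable_Icc_0[OF integrable_mult_square_integrable[OF g h]]
       negligible_empty]) auto

text \<open>The integral operator of Hardy's inequality. The weight dominates the singularity at \<open>0\<close> of
  the kernel in the variation of constants; for \<open>\<mu> = 1/2\<close> it is constant.\<close>
definition weighted_integral :: "real \<Rightarrow> (real \<Rightarrow> complex) \<Rightarrow> real \<Rightarrow> real" where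
  "weighted_integral \<mu> g x = integral {0..x} (\<lambda>s. s powr (1/2 - \<mu>) * cmod (g s))"

lemma weighted_absolutely_integrable:
  assumes g: "square_integrable g" and \<mu>: "\<mu> < 1"
  shows "(\<lambda>s. s powr (1/2 - \<mu>) * cmod (g s)) absolutely_integrable_on {0..b}"
proof -
  have "(\<lambda>s. g s * complex_of_real (s powr (1/2 - \<mu>))) absolutely_integrable_on {0..b}"
  proof (rule absolutely_integrable_mult_L2_near_0[OF g])
    have "square_integrable (\<lambda>x. complex_of_real (if x \<le> b then x powr (1/2 - \<mu>) else 0))"
      by (rule square_integrable_powr_near_0) (use \<mu> in simp)
    then show "square_integrable (\<lambda>x. if x \<le> b then complex_of_real (x powr (1/2 - \<mu>)) else 0)"
      by (simp add: if_distrib cong: if_cong)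
  qed
  from absolutely_integrable_norm[OF this] show ?thesis by (simp add: o_def norm_mult mult.commute)
qed

lemma primitive_integral_from_0:
  fixes h :: "real \<Rightarrow> 'a::euclidean_space"
  assumes "\<And>b. h absolutely_integrable_on {0..b}"
  shows "primitive (\<lambda>x. integral {0..x} h) h"
  unfolding primitive_def
proof (intro allI impI conjI)
  fix a b :: real assume ab: "0 < a" "a \<le> b"
  show abs': "h absolutely_integrable_on {a..b}"
    by (rule set_integrable_subset[OF assms[of b]]) (use ab in auto)
  have "h integrable_on {a..b}" using abs' set_lebesgue_integral_eq_integral(1) by blast
  moreover have "h integrable_on {0..b}" using assms set_lebesgue_integral_eq_integral(1) by blast
  ultimately show "(h has_integral integral {0..b} h - integral {0..a} h) {a..b}"
    using Henstock_Kurzweil_Integration.integral_combine[of 0 a b h] ab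
    by (simp add: has_integral_iff algebra_simps)
qed

lemma primitive_weighted_integral:
  assumes g: "square_integrable g" and \<mu>: "\<mu> < 1"
  shows "primitive (weighted_integral \<mu> g) (\<lambda>s. s powr (1/2 - \<mu>) * cmod (g s))"
  using primitive_integral_from_0[OF weighted_absolutely_integrable[OF assms]]
  unfolding weighted_integral_def by simp

lemma weighted_integral_nonneg:
  assumes g: "square_integrable g" and \<mu>: "\<mu> < 1"
  shows "0 \<le> weighted_integral \<mu> g x"
  unfolding weighted_integral_def
  by (rule integral_nonneg[OF set_lebesgue_integral_eq_integral(1)[OF weighted_absolutely_integrable[OF g \<mu>]]]) auto

lemma square_integrable_norm_integrable:
  assumes g: "square_integrable g" and a: "0 \<le> a"
  shows "(\<lambda>s. (cmod (g s))\<^sup>2) integrable_on {a..b}"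
    and "integral {a..b} (\<lambda>s. (cmod (g s))\<^sup>2) \<le> (LINT s|half_line. (cmod (g s))\<^sup>2)"
proof -
  have i: "integrable half_line (\<lambda>s. (cmod (g s))\<^sup>2)" using g by (simp add: square_integrable_def)
  show i0: "(\<lambda>s. (cmod (g s))\<^sup>2) integrable_on {a..b}"
    by (rule integrable_on_subinterval[OF set_lebesgue_integral_eq_integral(1)[OF absolutely_integrable_Icc_0[OF i, of b]]])
      (use a in auto)
  have i1: "(\<lambda>s. (cmod (g s))\<^sup>2) absolutely_integrable_on {0..}"
    using i unfolding integrable_half_line_iff
    by (rule absolutely_integrable_spike_set) (auto intro: negligible_subset[of "{0}"])
  have "integral {a..b} (\<lambda>s. (cmod (g s))\<^sup>2) \<le> integral {0..} (\<lambda>s. (cmod (g s))\<^sup>2)"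
    by (rule integral_subset_le) (use i0 i1 a set_lebesgue_integral_eq_integral(1) in auto)
  also have "integral {0..} (\<lambda>s. (cmod (g s))\<^sup>2) = integral {0<..} (\<lambda>s. (cmod (g s))\<^sup>2)"
    by (rule integral_spike_set) (auto intro: negligible_subset[of "{0}"])
  also have "\<dots> = (LINT s|half_line. (cmod (g s))\<^sup>2)"
    using lebesgue_integral_eq_integral[OF i] by simp
  finally show "integral {a..b} (\<lambda>s. (cmod (g s))\<^sup>2) \<le> (LINT s|half_line. (cmod (g s))\<^sup>2)" .
qed

lemma young_inequality:
  fixes l p q :: real assumes "0 < l"
  shows "p * q \<le> (l * p\<^sup>2 + q\<^sup>2 / l) / 2"
proof -
  have "0 \<le> (l * p - q)\<^sup>2 / l" using assms by simp
  also have "\<dots> = l * p\<^sup>2 + q\<^sup>2 / l - 2 * (p * q)"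
    using assms by (simp add: power2_eq_square field_simps)
  finally show ?thesis by simp
qed

text \<open>The Cauchy-Schwarz inequality in the form of a pointwise Young inequality, with the parameter
  \<open>l\<close> chosen so that both terms scale like \<open>x powr (1 - \<mu>)\<close>.\<close>
lemma weighted_integral_bound:
  assumes g: "square_integrable g" and \<mu>: "\<mu> < 1"
  obtains K where "0 \<le> K" "\<And>x. 0 < x \<Longrightarrow> weighted_integral \<mu> g x \<le> K * x powr (1 - \<mu>)"
proof
  define G where "G = (LINT s|half_line. (cmod (g s))\<^sup>2)"
  show "0 \<le> (1 / (2 - 2 * \<mu>) + G) / 2" using \<mu> by (simp add: G_def)
  fix x :: real assume x: "0 < x"
  define l where "l = x powr (\<mu> - 1)"
  have l: "0 < l" using x by (simp add: l_def)
  have i1: "((\<lambda>s. s powr (1 - 2 * \<mu>)) has_integral (x powr (2 - 2 * \<mu>) / (2 - 2 * \<mu>))) {0..x}"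
    using has_integral_powr_from_0[of "1 - 2 * \<mu>" x] x \<mu> by (simp add: add.commute)
  have i2: "(\<lambda>s. (cmod (g s))\<^sup>2) integrable_on {0..x}"
    by (rule square_integrable_norm_integrable(1)[OF g]) simp
  have "weighted_integral \<mu> g x \<le> integral {0..x} (\<lambda>s. (l * s powr (1 - 2 * \<mu>) + (cmod (g s))\<^sup>2 / l) / 2)"
    unfolding weighted_integral_def
  proof (rule integral_le)
    show "(\<lambda>s. s powr (1/2 - \<mu>) * cmod (g s)) integrable_on {0..x}"
      using weighted_absolutely_integrable[OF g \<mu>] set_lebesgue_integral_eq_integral(1) by blast
    show "(\<lambda>s. (l * s powr (1 - 2 * \<mu>) + (cmod (g s))\<^sup>2 / l) / 2) integrable_on {0..x}"
      using i1 i2 by (intro integrable_on_divide integrable_add integrable_on_mult_right) auto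
    show "s powr (1/2 - \<mu>) * cmod (g s) \<le> (l * s powr (1 - 2 * \<mu>) + (cmod (g s))\<^sup>2 / l) / 2" for s
      using young_inequality[OF l, of "s powr (1/2 - \<mu>)" "cmod (g s)"]
      by (simp add: power2_eq_square flip: powr_add)
  qed
  also have "\<dots> = (l * (x powr (2 - 2 * \<mu>) / (2 - 2 * \<mu>)) + integral {0..x} (\<lambda>s. (cmod (g s))\<^sup>2) / l) / 2"
    by (rule integral_unique) 
      (intro has_integral_divide has_integral_add has_integral_mult_right i1 integrable_integral[OF i2])
  also have "\<dots> \<le> (l * (x powr (2 - 2 * \<mu>) / (2 - 2 * \<mu>)) + G / l) / 2"
    using square_integrable_norm_integrable(2)[OF g, of 0 x] l unfolding G_def
    by (intro divide_right_mono add_left_mono) auto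
  also have "\<dots> = (1 / (2 - 2 * \<mu>) + G) / 2 * x powr (1 - \<mu>)"
  proof -
    have "l * x powr (2 - 2 * \<mu>) = x powr (1 - \<mu>)" unfolding l_def by (simp flip: powr_add)
    then have "l * (x powr (2 - 2 * \<mu>) / (2 - 2 * \<mu>)) = x powr (1 - \<mu>) / (2 - 2 * \<mu>)"
      by (metis times_divide_eq_right)
    moreover have "1 / l = x powr (1 - \<mu>)" unfolding l_def by (simp add: powr_minus_divide[symmetric])
    then have "G / l = G * x powr (1 - \<mu>)" by (metis mult.right_neutral times_divide_eq_right)
    ultimately show ?thesis by (simp only: distrib_right times_divide_eq_left mult_1_left)
  qed
  finally show "weighted_integral \<mu> g x \<le> (1 / (2 - 2 * \<mu>) + G) / 2 * x powr (1 - \<mu>)" .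
qed

lemma primitive_powr: "primitive (\<lambda>x. x powr a) (\<lambda>x. a * x powr (a - 1))"
proof (rule primitive_of_C1)
  show "((\<lambda>x. x powr a) has_vector_derivative a * x powr (a - 1)) (at x)" if "0 < x" for x
    using has_real_derivative_powr[OF that, of a] by (simp add: has_real_derivative_iff_has_vector_derivative)
qed (auto intro!: continuous_intros)

text \<open>Write \<open>H\<close> for the weighted integral, \<open>P = x powr (\<mu> - 3/2) * H\<close> and \<open>Q
  = x powr (2 * \<mu> - 2) * H\<^sup>2\<close>. Then \<open>Q' = 2 P |g| - (2 - 2 \<mu>) P\<^sup>2\<close>, where
  Young's inequality absorbs half of the last term. As \<open>Q\<close> is nonnegative, and bounded near
  \<open>0\<close> by the preceding lemma, the integrals of \<open>P\<^sup>2\<close> over compact intervals are bounded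
  uniformly.\<close>
lemma hardy_inequality:
  assumes g: "square_integrable g" and \<mu>: "\<mu> < 1"
  shows "square_integrable (\<lambda>x. complex_of_real (x powr (\<mu> - 3/2) * weighted_integral \<mu> g x))"
proof -
  define H where "H = weighted_integral \<mu> g"
  define h where "h s = s powr (1/2 - \<mu>) * cmod (g s)" for s
  define P where "P x = x powr (\<mu> - 3/2) * H x" for x
  define G where "G = (LINT s|half_line. (cmod (g s))\<^sup>2)"
  have H: "primitive H h" unfolding H_def h_def by (rule primitive_weighted_integral[OF g \<mu>])
  obtain K where K: "0 \<le> K" "\<And>x. 0 < x \<Longrightarrow> H x \<le> K * x powr (1 - \<mu>)"
    unfolding H_def using weighted_integral_bound[OF g \<mu>] by blast
  have H0: "0 \<le> H x" for x unfolding H_def by (rule weighted_integral_nonneg[OF g \<mu>])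
  define Q where "Q x = x powr (2 * \<mu> - 2) * (H x * H x)" for x
  define D where "D x = x powr (2 * \<mu> - 2) * (H x * h x + h x * H x)
      + (2 * \<mu> - 2) * x powr (2 * \<mu> - 2 - 1) * (H x * H x)" for x
  have Q: "primitive Q D"
    unfolding Q_def D_def by (rule primitive_mult[OF primitive_powr primitive_mult[OF H H]])
  have Pc: "continuous_on {0<..} P"
    unfolding P_def using primitive_continuous_on[OF H] by (intro continuous_intros) auto
  have Pi: "(\<lambda>x. (P x)\<^sup>2) integrable_on {a..b}" if "0 < a" for a b
    by (rule integrable_continuous_real, rule continuous_on_subset[OF continuous_on_power[OF Pc]])
      (use that in auto)
  have P2: "(P x)\<^sup>2 = x powr (2 * \<mu> - 2 - 1) * (H x * H x)" if "0 < x" for x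
  proof -
    have "x powr (\<mu> - 3/2) * x powr (\<mu> - 3/2) = x powr (2 * \<mu> - 2 - 1)" by (simp flip: powr_add)
    then show ?thesis unfolding P_def power2_eq_square by (metis mult.assoc mult.left_commute)
  qed
  have PH: "x powr (2 * \<mu> - 2) * (H x * h x) = P x * cmod (g x)" if "0 < x" for x
  proof -
    have "x powr (2 * \<mu> - 2) * x powr (1/2 - \<mu>) = x powr (\<mu> - 3/2)" by (simp flip: powr_add)
    then show ?thesis unfolding P_def h_def by (metis mult.assoc mult.left_commute)
  qed
  have D_le: "D x \<le> (cmod (g x))\<^sup>2 / (1 - \<mu>) - (1 - \<mu>) * (P x)\<^sup>2" if "0 < x" for x
  proof -
    have "D x = 2 * (x powr (2 * \<mu> - 2) * (H x * h x)) + (2 * \<mu> - 2) * (x powr (2 * \<mu> - 2 - 1) * (H x * H x))"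
      unfolding D_def by (simp add: algebra_simps)
    also have "\<dots> = 2 * (P x * cmod (g x)) + (2 * \<mu> - 2) * (P x)\<^sup>2"
      by (simp only: PH[OF that] P2[OF that])
    also have "\<dots> \<le> (cmod (g x))\<^sup>2 / (1 - \<mu>) - (1 - \<mu>) * (P x)\<^sup>2"
      using young_inequality[of "1 - \<mu>" "P x" "cmod (g x)"] \<mu> by (simp add: field_simps)
    finally show ?thesis .
  qed
  have "integrable half_line (\<lambda>x. (P x)\<^sup>2)"
  proof (rule integrable_half_line_bounded_integrals)
    fix a b :: real assume ab: "0 < a" "a \<le> b"
    show "(\<lambda>x. (P x)\<^sup>2) integrable_on {a..b}" using Pi ab by blast
    have gi: "(\<lambda>x. (cmod (g x))\<^sup>2) integrable_on {a..b}"
      by (rule square_integrable_norm_integrable(1)[OF g]) (use ab in simp)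
    have Qa: "Q a \<le> K\<^sup>2"
    proof -
      have "H a * H a \<le> (K * a powr (1 - \<mu>)) * (K * a powr (1 - \<mu>))"
        by (intro mult_mono K(2) ab H0) (use K in auto)
      then have "Q a \<le> a powr (2 * \<mu> - 2) * ((K * a powr (1 - \<mu>)) * (K * a powr (1 - \<mu>)))"
        unfolding Q_def by (intro mult_left_mono) auto
      also have "\<dots> = K\<^sup>2 * (a powr (2 * \<mu> - 2) * (a powr (1 - \<mu>) * a powr (1 - \<mu>)))"
        by (simp add: power2_eq_square)
      also have "a powr (2 * \<mu> - 2) * (a powr (1 - \<mu>) * a powr (1 - \<mu>)) = 1"
        using ab by (simp flip: powr_add)
      finally show ?thesis by simp
    qed
    have "0 \<le> Q b" unfolding Q_def by simp
    with Qa have "- (K\<^sup>2) \<le> Q b - Q a" by linarith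
    also have "Q b - Q a = integral {a..b} D"
      using primitive_has_integral[OF Q ab] by (simp add: integral_unique)
    also have "\<dots> \<le> integral {a..b} (\<lambda>x. (cmod (g x))\<^sup>2 / (1 - \<mu>) - (1 - \<mu>) * (P x)\<^sup>2)"
      by (rule integral_le)
        (use D_le ab gi Pi[OF ab(1)] primitive_has_integral[OF Q ab] in
          \<open>auto intro!: integrable_diff integrable_on_mult_right integrable_on_divide\<close>)
    also have "\<dots> = integral {a..b} (\<lambda>x. (cmod (g x))\<^sup>2) / (1 - \<mu>) - (1 - \<mu>) * integral {a..b} (\<lambda>x. (P x)\<^sup>2)"
      by (rule integral_unique)
        (intro has_integral_divide has_integral_diff has_integral_mult_right integrable_integral gi Pi[OF ab(1)])
    finally have "(1 - \<mu>) * integral {a..b} (\<lambda>x. (P x)\<^sup>2) \<le> K\<^sup>2 + integral {a..b} (\<lambda>x. (cmod (g x))\<^sup>2) / (1 - \<mu>)"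
      by simp
    also have "\<dots> \<le> K\<^sup>2 + G / (1 - \<mu>)"
      using square_integrable_norm_integrable(2)[OF g, of a b] ab \<mu> unfolding G_def
      by (intro add_left_mono divide_right_mono) auto
    finally show "integral {a..b} (\<lambda>x. (P x)\<^sup>2) \<le> (K\<^sup>2 + G / (1 - \<mu>)) / (1 - \<mu>)"
      using \<mu> by (subst pos_le_divide_eq) (simp_all add: mult.commute)
  qed simp
  moreover have "(\<lambda>x. complex_of_real (P x)) \<in> borel_measurable half_line"
    using Pc by (intro continuous_imp_half_line_measurable continuous_on_of_real)
  ultimately have "square_integrable (\<lambda>x. complex_of_real (P x))"
    by (simp add: square_integrable_def)
  then show ?thesis by (simp add: P_def H_def)
qed

section \<open>The Bessel expression and its solutions at energy zero\<close>

definition bessel_V :: "real \<Rightarrow> real \<Rightarrow> real" where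
  "bessel_V \<nu> x = (\<nu>\<^sup>2 - 1/4) / x\<^sup>2"

text \<open>The expression \<open>g = - f'' + V f\<close> as a first-order system: \<open>f\<close> has the derivative
  \<open>f'\<close> everywhere, and \<open>f'\<close> has the locally integrable derivative \<open>V f -
  g\<close>.\<close>
definition bessel_pair :: "real \<Rightarrow> (real \<Rightarrow> complex) \<Rightarrow> (real \<Rightarrow> complex) \<Rightarrow> (real \<Rightarrow> complex) \<Rightarrow> bool" where
  "bessel_pair \<nu> f f' g \<longleftrightarrow>
     (\<forall>x>0. (f has_vector_derivative f' x) (at x)) \<and>
     primitive f' (\<lambda>x. complex_of_real (bessel_V \<nu> x) * f x - g x)"

lemma continuous_on_bessel_V: "continuous_on {0<..} (bessel_V \<nu>)"
  unfolding bessel_V_def by (intro continuous_intros) auto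

lemma has_vector_derivative_imp_continuous_on:
  "(\<And>x. 0 < x \<Longrightarrow> (f has_vector_derivative f' x) (at x)) \<Longrightarrow> continuous_on {0<..} f"
  by (rule continuous_at_imp_continuous_on) (auto dest: has_vector_derivative_continuous)

lemma has_vector_derivative_cong_half_line:
  assumes "(f has_vector_derivative d) (at x)" "0 < x" "\<And>x. 0 < x \<Longrightarrow> f x = g x"
  shows "(g has_vector_derivative d) (at x)"
  using assms(1) unfolding has_vector_derivative_def
  by (rule has_derivative_transform_within_open[where s="{0<..}"]) (use assms in auto)

lemma bessel_pair_continuous:
  assumes "bessel_pair \<nu> f f' g"
  shows "continuous_on {0<..} f" "continuous_on {0<..} f'"
  using assms has_vector_derivative_imp_continuous_on[of f f'] primitive_continuous_on
  unfolding bessel_pair_def by auto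

lemma bessel_pair_primitive:
  assumes "bessel_pair \<nu> f f' g" shows "primitive f f'"
  using assms bessel_pair_continuous[OF assms] unfolding bessel_pair_def by (intro primitive_of_C1) auto

text \<open>Continuous representatives that agree almost everywhere are equal, hence so are their derivatives; this
  makes the maximal operator single-valued.\<close>
lemma bessel_pair_AE_unique:
  assumes 1: "bessel_pair \<nu> f1 f1' g1" and 2: "bessel_pair \<nu> f2 f2' g2"
    and ae: "AE x in half_line. f1 x = f2 x"
  shows "\<And>x. 0 < x \<Longrightarrow> f1 x = f2 x" "AE x in half_line. g1 x = g2 x"
proof -
  show eq: "f1 x = f2 x" if "0 < x" for x
    by (rule AE_half_line_continuous_eq[OF bessel_pair_continuous(1)[OF 1] bessel_pair_continuous(1)[OF 2] ae that])
  have "f1' x = f2' x" if "0 < x" for x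
  proof -
    have "(f1 has_vector_derivative f2' x) (at x)"
      by (rule has_vector_derivative_cong_half_line[where f=f2])
        (use 2 that eq in \<open>simp_all add: bessel_pair_def\<close>)
    then show ?thesis using 1 that unfolding bessel_pair_def by (meson vector_derivative_unique_at)
  qed
  then have "primitive (\<lambda>x. 0) (\<lambda>x. (complex_of_real (bessel_V \<nu> x) * f1 x - g1 x) - (complex_of_real (bessel_V \<nu> x) * f2 x - g2 x))"
  proof -
    have "primitive (\<lambda>x. f1' x - f2' x) (\<lambda>x. (complex_of_real (bessel_V \<nu> x) * f1 x - g1 x) - (complex_of_real (bessel_V \<nu> x) * f2 x - g2 x))"
      by (rule primitive_diff) (use 1 2 in \<open>simp_all add: bessel_pair_def\<close>)
    then show ?thesis
      by (rule primitive_cong_AE) (use \<open>\<And>x. 0 < x \<Longrightarrow> f1' x = f2' x\<close> in auto)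
  qed
  from primitive_AE_derivative[OF this] have "AE x in half_line.
      (complex_of_real (bessel_V \<nu> x) * f1 x - g1 x) - (complex_of_real (bessel_V \<nu> x) * f2 x - g2 x) = 0"
    by eventually_elim (metis vector_derivative_unique_at has_vector_derivative_const)
  moreover have "AE x in half_line. f1 x = f2 x" by (rule ae)
  ultimately show "AE x in half_line. g1 x = g2 x"
    by eventually_elim auto
qed

lemma bessel_pair_add:
  assumes "bessel_pair \<nu> f f' g" "bessel_pair \<nu> h h' k"
  shows "bessel_pair \<nu> (\<lambda>x. f x + h x) (\<lambda>x. f' x + h' x) (\<lambda>x. g x + k x)"
  using assms primitive_add[of f' "\<lambda>x. complex_of_real (bessel_V \<nu> x) * f x - g x" h' "\<lambda>x. complex_of_real (bessel_V \<nu> x) * h x - k x"]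
  unfolding bessel_pair_def by (auto intro!: has_vector_derivative_add simp: algebra_simps)

lemma bessel_pair_scale:
  assumes "bessel_pair \<nu> f f' g"
  shows "bessel_pair \<nu> (\<lambda>x. c * f x) (\<lambda>x. c * f' x) (\<lambda>x. c * g x)"
  using assms primitive_linear[of f' "\<lambda>x. complex_of_real (bessel_V \<nu> x) * f x - g x", OF _ bounded_linear_mult_right[of c]]
  unfolding bessel_pair_def by (auto intro!: has_vector_derivative_mult_right simp: algebra_simps)

lemma bessel_pair_cnj:
  assumes "bessel_pair \<nu> f f' g"
  shows "bessel_pair \<nu> (\<lambda>x. cnj (f x)) (\<lambda>x. cnj (f' x)) (\<lambda>x. cnj (g x))"
  using assms primitive_linear[of f' "\<lambda>x. complex_of_real (bessel_V \<nu> x) * f x - g x", OF _ bounded_linear_cnj]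
  unfolding bessel_pair_def by (auto intro!: bounded_linear.has_vector_derivative[OF bounded_linear_cnj])

text \<open>Lagrange's identity: in the derivative of the Wronskian the potential cancels.\<close>
lemma wronskian_primitive:
  assumes f: "bessel_pair \<nu> f f' g" and h: "bessel_pair \<nu> h h' k"
  shows "primitive (\<lambda>x. f x * h' x - f' x * h x) (\<lambda>x. g x * h x - f x * k x)"
proof -
  let ?V = "\<lambda>x. complex_of_real (bessel_V \<nu> x)"
  have "primitive (\<lambda>x. f x * h' x) (\<lambda>x. f x * (?V x * h x - k x) + f' x * h' x)"
    by (rule primitive_mult[OF bessel_pair_primitive[OF f]]) (use h in \<open>simp add: bessel_pair_def\<close>)
  moreover have "primitive (\<lambda>x. f' x * h x) (\<lambda>x. f' x * h' x + (?V x * f x - g x) * h x)"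
    by (rule primitive_mult[OF _ bessel_pair_primitive[OF h]]) (use f in \<open>simp add: bessel_pair_def\<close>)
  ultimately have "primitive (\<lambda>x. f x * h' x - f' x * h x)
     (\<lambda>x. f x * (?V x * h x - k x) + f' x * h' x - (f' x * h' x + (?V x * f x - g x) * h x))"
    by (rule primitive_diff)
  moreover have "(\<lambda>x. f x * (?V x * h x - k x) + f' x * h' x - (f' x * h' x + (?V x * f x - g x) * h x))
     = (\<lambda>x. g x * h x - f x * k x)"
    by (auto simp: algebra_simps)
  ultimately show ?thesis by simp
qed

lemma bessel_expr_iff:
  assumes f: "square_integrable f" and g: "square_integrable g"
  shows "bessel_expr \<nu> f g \<longleftrightarrow> (\<exists>f'. bessel_pair \<nu> f f' g)"
proof
  assume "bessel_expr \<nu> f g"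
  then obtain f' f'' where ac: "locally_abs_continuous f'" 
    and d: "\<And>x. 0 < x \<Longrightarrow> (f has_vector_derivative f' x) (at x)"
    and d2: "AE x in half_line. (f' has_vector_derivative f'' x) (at x)"
    and e: "AE x in half_line. g x = - f'' x + complex_of_real ((\<nu>\<^sup>2 - 1/4) / x\<^sup>2) * f x"
    unfolding bessel_expr_def by blast
  have "primitive f' (\<lambda>x. complex_of_real (bessel_V \<nu> x) * f x - g x)"
  proof (rule ac_on_AE_derivative_primitive)
    show "ac_on a b f'" if "0 < a" "a < b" for a b
      using ac that unfolding locally_abs_continuous_def abs_continuous_on_eq_ac_on by blast
    show "AE x in half_line. (f' has_vector_derivative complex_of_real (bessel_V \<nu> x) * f x - g x) (at x)"
      using d2 e by eventually_elim (simp add: bessel_V_def)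
    show "(\<lambda>x. complex_of_real (bessel_V \<nu> x) * f x - g x) absolutely_integrable_on {a..b}" if "0 < a" "a \<le> b" for a b
    proof (rule set_integral_diff(1))
      have "continuous_on {0<..} (\<lambda>x. complex_of_real (bessel_V \<nu> x) * f x)"
        using d by (intro continuous_intros continuous_on_bessel_V has_vector_derivative_imp_continuous_on) auto
      then show "(\<lambda>x. complex_of_real (bessel_V \<nu> x) * f x) absolutely_integrable_on {a..b}"
        by (rule absolutely_integrable_continuous_real[OF continuous_on_subset]) (use that in auto)
      show "g absolutely_integrable_on {a..b}"
        by (rule set_integrable_subset[OF square_integrable_absolutely_integrable[OF g, of b]]) (use that in auto)
    qed
  qed
  with d show "\<exists>f'. bessel_pair \<nu> f f' g" unfolding bessel_pair_def by blast
next
  assume "\<exists>f'. bessel_pair \<nu> f f' g"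
  then obtain f' where p: "bessel_pair \<nu> f f' g" by blast
  let ?f'' = "\<lambda>x. complex_of_real (bessel_V \<nu> x) * f x - g x"
  have p': "primitive f' ?f''" using p by (simp add: bessel_pair_def)
  show "bessel_expr \<nu> f g"
    unfolding bessel_expr_def
  proof (rule exI[of _ f'], rule exI[of _ ?f''], intro conjI)
    show "locally_abs_continuous f" "locally_abs_continuous f'"
      unfolding locally_abs_continuous_def abs_continuous_on_eq_ac_on
      using primitive_ac_on[OF bessel_pair_primitive[OF p]] primitive_ac_on[OF p'] by auto
    show "\<forall>x>0. (f has_vector_derivative f' x) (at x)" using p by (simp add: bessel_pair_def)
    show "AE x in half_line. (f' has_vector_derivative ?f'' x) (at x)"
      by (rule primitive_AE_derivative[OF p'])
  qed (simp add: bessel_V_def)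
qed

definition sol_pos :: "real \<Rightarrow> real \<Rightarrow> real" where
  "sol_pos \<nu> x = x powr (1/2 + \<nu>)"

definition sol_pos' :: "real \<Rightarrow> real \<Rightarrow> real" where
  "sol_pos' \<nu> x = (1/2 + \<nu>) * x powr (\<nu> - 1/2)"

text \<open>At \<open>\<nu> = 0\<close> the two powers coincide and a logarithm takes the place of the second
  one.\<close>
definition sol_neg :: "real \<Rightarrow> real \<Rightarrow> real" where
  "sol_neg \<nu> x = (if \<nu> = 0 then x powr (1/2) * ln x else x powr (1/2 - \<nu>))"

definition sol_neg' :: "real \<Rightarrow> real \<Rightarrow> real" where
  "sol_neg' \<nu> x = (if \<nu> = 0 then x powr (- 1/2) * (ln x / 2 + 1) else (1/2 - \<nu>) * x powr (- \<nu> - 1/2))"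

definition sol_wronskian :: "real \<Rightarrow> real" where
  "sol_wronskian \<nu> = (if \<nu> = 0 then 1 else - 2 * \<nu>)"

lemma sol_wronskian_nonzero: "sol_wronskian \<nu> \<noteq> 0"
  by (simp add: sol_wronskian_def)

lemma bessel_V_powr: "0 < x \<Longrightarrow> bessel_V \<nu> x * x powr a = (\<nu>\<^sup>2 - 1/4) * x powr (a - 2)"
  by (simp add: bessel_V_def powr_diff powr_numeral)

lemma bessel_pair_of_real:
  assumes 1: "\<And>x. 0 < x \<Longrightarrow> (F has_real_derivative F' x) (at x)"
    and 2: "\<And>x. 0 < x \<Longrightarrow> (F' has_real_derivative bessel_V \<nu> x * F x) (at x)"
  shows "bessel_pair \<nu> (\<lambda>x. complex_of_real (F x)) (\<lambda>x. complex_of_real (F' x)) (\<lambda>x. 0)"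
proof -
  have c: "continuous_on {0<..} (\<lambda>x. bessel_V \<nu> x * F x)"
    using 1 by (intro continuous_intros continuous_on_bessel_V has_vector_derivative_imp_continuous_on)
      (auto simp: has_real_derivative_iff_has_vector_derivative)
  have "primitive F' (\<lambda>x. bessel_V \<nu> x * F x)"
    by (rule primitive_of_C1[OF _ c]) (use 2 in \<open>simp add: has_real_derivative_iff_has_vector_derivative\<close>)
  from primitive_linear[OF this bounded_linear_of_real[where 'a=complex]] show ?thesis
    using 1 unfolding bessel_pair_def
    by (auto intro!: bounded_linear.has_vector_derivative[OF bounded_linear_of_real[where 'a=complex]]
        simp: has_real_derivative_iff_has_vector_derivative)
qed

lemma bessel_pair_sol_pos:
  "bessel_pair \<nu> (\<lambda>x. complex_of_real (sol_pos \<nu> x)) (\<lambda>x. complex_of_real (sol_pos' \<nu> x)) (\<lambda>x. 0)"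
proof (rule bessel_pair_of_real)
  fix x :: real assume x: "0 < x"
  show "(sol_pos \<nu> has_real_derivative sol_pos' \<nu> x) (at x)"
    unfolding sol_pos_def sol_pos'_def using x
    by (auto intro!: derivative_eq_intros simp: algebra_simps)
  have "((\<lambda>x. (1/2 + \<nu>) * x powr (\<nu> - 1/2)) has_real_derivative (1/2 + \<nu>) * ((\<nu> - 1/2) * x powr (\<nu> - 1/2 - 1))) (at x)"
    by (rule DERIV_cmult, rule has_real_derivative_powr[OF x])
  moreover have "(1/2 + \<nu>) * ((\<nu> - 1/2) * x powr (\<nu> - 1/2 - 1)) = bessel_V \<nu> x * sol_pos \<nu> x"
    unfolding sol_pos_def bessel_V_powr[OF x] by (simp add: algebra_simps power2_eq_square)
  ultimately show "(sol_pos' \<nu> has_real_derivative bessel_V \<nu> x * sol_pos \<nu> x) (at x)"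
    unfolding sol_pos'_def by simp
qed

lemma bessel_pair_sol_neg:
  "bessel_pair \<nu> (\<lambda>x. complex_of_real (sol_neg \<nu> x)) (\<lambda>x. complex_of_real (sol_neg' \<nu> x)) (\<lambda>x. 0)"
proof (rule bessel_pair_of_real)
  fix x :: real assume x: "0 < x"
  have r: "x powr (a - 1) = x powr a / x" for a using x by (simp add: powr_diff)
  have h: "x powr (1/2) = x powr (- 1/2) * x"
    using x r[of "1/2"] by simp
  show "(sol_neg \<nu> has_real_derivative sol_neg' \<nu> x) (at x)"
  proof (cases "\<nu> = 0")
    case True
    have "((\<lambda>x. x powr (1/2) * ln x) has_real_derivative x powr (1/2) * (1 / x) + (1/2) * x powr (1/2 - 1) * ln x) (at x)"
      using DERIV_mult[OF has_real_derivative_powr[OF x, of "1/2"] DERIV_ln_divide[OF x]] by (simp add: add.commute mult.commute)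
    moreover have "x powr (1/2) * (1 / x) + (1/2) * x powr (1/2 - 1) * ln x = x powr (- 1/2) * (ln x / 2 + 1)"
      using h x by (simp add: field_simps)
    ultimately show ?thesis using True unfolding sol_neg_def sol_neg'_def by simp
  next
    case False
    have "((\<lambda>x. x powr (1/2 - \<nu>)) has_real_derivative (1/2 - \<nu>) * x powr (1/2 - \<nu> - 1)) (at x)"
      by (rule has_real_derivative_powr[OF x])
    then show ?thesis using False unfolding sol_neg_def sol_neg'_def by (simp add: algebra_simps)
  qed
  show "(sol_neg' \<nu> has_real_derivative bessel_V \<nu> x * sol_neg \<nu> x) (at x)"
  proof (cases "\<nu> = 0")
    case True
    have "((\<lambda>x. x powr (- 1/2) * (ln x / 2 + 1)) has_real_derivative
        x powr (- 1/2) * (1 / x / 2) + (- 1/2) * x powr (- 1/2 - 1) * (ln x / 2 + 1)) (at x)"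
      using x by (auto intro!: derivative_eq_intros simp: field_simps)
    moreover have "x powr (- 1/2) * (1 / x / 2) + (- 1/2) * x powr (- 1/2 - 1) * (ln x / 2 + 1)
       = bessel_V 0 x * (x powr (1/2) * ln x)"
      unfolding r bessel_V_def h using x by (simp add: field_simps power2_eq_square)
    ultimately show ?thesis using True unfolding sol_neg_def sol_neg'_def by simp
  next
    case False
    have "((\<lambda>x. (1/2 - \<nu>) * x powr (- \<nu> - 1/2)) has_real_derivative (1/2 - \<nu>) * ((- \<nu> - 1/2) * x powr (- \<nu> - 1/2 - 1))) (at x)"
      by (rule DERIV_cmult, rule has_real_derivative_powr[OF x])
    moreover have "(1/2 - \<nu>) * ((- \<nu> - 1/2) * x powr (- \<nu> - 1/2 - 1)) = bessel_V \<nu> x * x powr (1/2 - \<nu>)"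
    proof -
      have "(1/2 - \<nu>) * (- \<nu> - 1/2) = \<nu>\<^sup>2 - 1/4" by (simp add: field_simps power2_eq_square)
      moreover have "- \<nu> - 1/2 - 1 = 1/2 - \<nu> - 2" by simp
      ultimately show ?thesis unfolding bessel_V_powr[OF x] by (metis mult.assoc)
    qed
    ultimately show ?thesis using False unfolding sol_neg_def sol_neg'_def by simp
  qed
qed

lemma wronskian_sol_pos_sol_neg:
  assumes x: "0 < x"
  shows "sol_pos \<nu> x * sol_neg' \<nu> x - sol_pos' \<nu> x * sol_neg \<nu> x = sol_wronskian \<nu>"
proof (cases "\<nu> = 0")
  case True
  have "x powr (1/2) * x powr (- 1/2) = 1" using x by (simp flip: powr_add)
  then show ?thesis using True
    by (simp add: sol_pos_def sol_pos'_def sol_neg_def sol_neg'_def sol_wronskian_def algebra_simps)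
next
  case False
  have "x powr (1/2 + \<nu>) * x powr (- \<nu> - 1/2) = 1" "x powr (\<nu> - 1/2) * x powr (1/2 - \<nu>) = 1"
    using x by (simp_all flip: powr_add)
  then have e: "x powr (1/2 + \<nu>) * ((1/2 - \<nu>) * x powr (- \<nu> - 1/2)) = 1/2 - \<nu>"
    "(1/2 + \<nu>) * x powr (\<nu> - 1/2) * x powr (1/2 - \<nu>) = 1/2 + \<nu>"
    by (metis mult.left_commute mult.right_neutral, metis mult.assoc mult.right_neutral)
  show ?thesis
    unfolding sol_pos_def sol_pos'_def sol_neg_def sol_neg'_def sol_wronskian_def if_not_P[OF False] e
    by simp
qed

section \<open>Boundary values of Wronskians at zero\<close>

text \<open>For \<open>s \<le> x\<close> the expression increases with the exponent, so that one weight dominates both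
  terms of the variation-of-constants kernel.\<close>
lemma powr_kernel_mono:
  fixes s x \<alpha> \<mu> :: real
  assumes "0 < s" "s \<le> x" "\<alpha> \<le> \<mu>"
  shows "x powr (1/2 + \<alpha>) * s powr (1/2 - \<alpha>) \<le> x powr (1/2 + \<mu>) * s powr (1/2 - \<mu>)"
proof -
  have x: "0 < x" using assms by linarith
  have "s powr (\<mu> - \<alpha>) \<le> x powr (\<mu> - \<alpha>)" using assms by (intro powr_mono2) auto
  then have "x powr (1/2 + \<alpha>) * s powr (1/2 - \<mu>) * s powr (\<mu> - \<alpha>) \<le> x powr (1/2 + \<alpha>) * s powr (1/2 - \<mu>) * x powr (\<mu> - \<alpha>)"
    by (intro mult_left_mono) auto
  moreover have "s powr (1/2 - \<mu>) * s powr (\<mu> - \<alpha>) = s powr (1/2 - \<alpha>)"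
    "x powr (1/2 + \<alpha>) * x powr (\<mu> - \<alpha>) = x powr (1/2 + \<mu>)"
    using assms x by (simp_all flip: powr_add)
  ultimately show ?thesis by (metis mult.assoc mult.commute)
qed

lemma powr_kernel_mono':
  fixes s x \<alpha> \<mu> :: real
  assumes "0 < s" "s \<le> x" "\<alpha> \<le> \<mu>"
  shows "x powr (\<alpha> - 1/2) * s powr (1/2 - \<alpha>) \<le> x powr (\<mu> - 1/2) * s powr (1/2 - \<mu>)"
proof -
  have x: "0 < x" using assms by linarith
  have e: "x powr (1/2 + a) = x powr (a - 1/2) * x" for a
    using x powr_add[of x "a - 1/2" 1] by (simp add: add.commute)
  have "x powr (\<alpha> - 1/2) * s powr (1/2 - \<alpha>) * x \<le> x powr (\<mu> - 1/2) * s powr (1/2 - \<mu>) * x"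
    using powr_kernel_mono[OF assms] unfolding e by (simp add: mult.commute mult.left_commute)
  with x show ?thesis by simp
qed

lemma ln_ratio_bound:
  assumes "0 < s" "s \<le> (x::real)"
  shows "0 \<le> ln x - ln s" "ln x - ln s \<le> 2 * (x powr (1/2) * s powr (- 1/2)) - 2"
proof -
  have x: "0 < x" using assms by linarith
  show "0 \<le> ln x - ln s" using assms x by simp
  have "ln (x powr (1/2) * s powr (- 1/2)) \<le> x powr (1/2) * s powr (- 1/2) - 1"
    using assms x by (intro ln_le_minus_one) auto
  moreover have "ln (x powr (1/2) * s powr (- 1/2)) = (ln x - ln s) / 2"
    using assms x by (simp add: ln_mult ln_powr)
  ultimately show "ln x - ln s \<le> 2 * (x powr (1/2) * s powr (- 1/2)) - 2" by simp
qed

text \<open>The kernel of the variation of constants. At \<open>\<nu> = 0\<close> the two logarithms combine to that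
  of \<open>x / s\<close>, which a square root of \<open>x / s\<close> dominates; therefore \<open>\<mu> = 1/2\<close>
  is large enough there.\<close>
lemma sol_kernel_bound:
  assumes \<nu>: "0 \<le> \<nu>" and s: "0 < s" "s \<le> x" and \<mu>: "\<nu> \<le> \<mu>" "1/2 \<le> \<mu>"
  shows "\<bar>sol_pos \<nu> x * sol_neg \<nu> s - sol_neg \<nu> x * sol_pos \<nu> s\<bar> \<le> 2 * (x powr (1/2 + \<mu>) * s powr (1/2 - \<mu>))"
proof (cases "\<nu> = 0")
  case True
  have x: "0 < x" using s by linarith
  have "sol_pos \<nu> x * sol_neg \<nu> s - sol_neg \<nu> x * sol_pos \<nu> s = - (x powr (1/2) * s powr (1/2) * (ln x - ln s))"
    using True by (simp add: sol_pos_def sol_neg_def algebra_simps)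
  then have "\<bar>sol_pos \<nu> x * sol_neg \<nu> s - sol_neg \<nu> x * sol_pos \<nu> s\<bar> = x powr (1/2) * s powr (1/2) * (ln x - ln s)"
    using ln_ratio_bound(1)[OF s] by simp
  also have "\<dots> \<le> x powr (1/2) * s powr (1/2) * (2 * (x powr (1/2) * s powr (- 1/2)))"
    using ln_ratio_bound(2)[OF s] by (intro mult_left_mono) auto
  also have "\<dots> = 2 * ((x powr (1/2) * x powr (1/2)) * (s powr (1/2) * s powr (- 1/2)))"
    by (simp add: algebra_simps)
  also have "x powr (1/2) * x powr (1/2) = x powr (1/2 + 1/2)" by (simp flip: powr_add)
  also have "s powr (1/2) * s powr (- 1/2) = s powr (1/2 - 1/2)" using s by (simp flip: powr_add)
  also have "x powr (1/2 + 1/2) * s powr (1/2 - 1/2) \<le> x powr (1/2 + \<mu>) * s powr (1/2 - \<mu>)"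
    by (rule powr_kernel_mono[OF s \<mu>(2)])
  finally show ?thesis by simp
next
  case False
  have "\<bar>sol_pos \<nu> x * sol_neg \<nu> s - sol_neg \<nu> x * sol_pos \<nu> s\<bar>
     \<le> x powr (1/2 + \<nu>) * s powr (1/2 - \<nu>) + x powr (1/2 + - \<nu>) * s powr (1/2 - - \<nu>)"
    using False by (simp add: sol_pos_def sol_neg_def abs_le_iff)
  then show ?thesis
    using powr_kernel_mono[OF s, of \<nu> \<mu>] powr_kernel_mono[OF s, of "- \<nu>" \<mu>] \<mu> \<nu> by linarith
qed

text \<open>The derivative of the preceding kernel in \<open>x\<close>.\<close>
lemma sol_kernel_bound':
  assumes \<nu>: "0 \<le> \<nu>" "\<nu> < 1" and s: "0 < s" "s \<le> x" and \<mu>: "\<nu> \<le> \<mu>" "1/2 \<le> \<mu>"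
  shows "\<bar>sol_pos' \<nu> x * sol_neg \<nu> s - sol_neg' \<nu> x * sol_pos \<nu> s\<bar> \<le> 2 * (x powr (\<mu> - 1/2) * s powr (1/2 - \<mu>))"
proof (cases "\<nu> = 0")
  case True
  have x: "0 < x" using s by linarith
  have "sol_pos' \<nu> x * sol_neg \<nu> s - sol_neg' \<nu> x * sol_pos \<nu> s = - (x powr (- 1/2) * s powr (1/2) * ((ln x - ln s) / 2 + 1))"
    using True by (simp add: sol_pos_def sol_neg_def sol_pos'_def sol_neg'_def algebra_simps diff_divide_distrib add_divide_distrib)
  then have "\<bar>sol_pos' \<nu> x * sol_neg \<nu> s - sol_neg' \<nu> x * sol_pos \<nu> s\<bar> = x powr (- 1/2) * s powr (1/2) * ((ln x - ln s) / 2 + 1)"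
    using ln_ratio_bound(1)[OF s] by simp
  also have "\<dots> \<le> x powr (- 1/2) * s powr (1/2) * (x powr (1/2) * s powr (- 1/2))"
  proof (rule mult_left_mono)
    show "(ln x - ln s) / 2 + 1 \<le> x powr (1/2) * s powr (- 1/2)"
    proof -
      have "d \<le> 2 * P - 2 \<Longrightarrow> d / 2 + 1 \<le> P" for d P :: real by simp
      from this[OF ln_ratio_bound(2)[OF s]] show ?thesis .
    qed
  qed simp
  also have "\<dots> = (x powr (- 1/2) * x powr (1/2)) * (s powr (1/2) * s powr (- 1/2))"
    by (simp add: algebra_simps)
  also have "x powr (- 1/2) * x powr (1/2) = x powr (1/2 - 1/2)" using x by (simp flip: powr_add)
  also have "s powr (1/2) * s powr (- 1/2) = s powr (1/2 - 1/2)" using s by (simp flip: powr_add)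
  also have "x powr (1/2 - 1/2) * s powr (1/2 - 1/2) \<le> x powr (\<mu> - 1/2) * s powr (1/2 - \<mu>)"
    by (rule powr_kernel_mono'[OF s \<mu>(2)])
  finally have *: "\<bar>sol_pos' \<nu> x * sol_neg \<nu> s - sol_neg' \<nu> x * sol_pos \<nu> s\<bar> \<le> x powr (\<mu> - 1/2) * s powr (1/2 - \<mu>)" .
  have "a \<le> R \<Longrightarrow> 0 \<le> R \<Longrightarrow> a \<le> 2 * R" for a R :: real by simp
  from this[OF *] show ?thesis by simp
next
  case False
  let ?R = "x powr (\<mu> - 1/2) * s powr (1/2 - \<mu>)"
  define A where "A = x powr (\<nu> - 1/2) * s powr (1/2 - \<nu>)"
  define B where "B = x powr (- \<nu> - 1/2) * s powr (1/2 - - \<nu>)"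
  have A: "A \<le> ?R" "0 \<le> A" unfolding A_def using powr_kernel_mono'[OF s, of \<nu> \<mu>] \<mu> by auto
  have B: "B \<le> ?R" "0 \<le> B" unfolding B_def using powr_kernel_mono'[OF s, of "- \<nu>" \<mu>] \<mu> \<nu> by auto
  have "sol_pos' \<nu> x * sol_neg \<nu> s - sol_neg' \<nu> x * sol_pos \<nu> s = (1/2 + \<nu>) * A - (1/2 - \<nu>) * B"
    using False by (simp add: sol_pos_def sol_neg_def sol_pos'_def sol_neg'_def A_def B_def)
  also have "\<bar>\<dots>\<bar> \<le> \<bar>(1/2 + \<nu>) * A\<bar> + \<bar>(1/2 - \<nu>) * B\<bar>" by (rule abs_triangle_ineq4)
  also have "\<dots> = (1/2 + \<nu>) * A + \<bar>1/2 - \<nu>\<bar> * B"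
    using A B \<nu> by (simp add: abs_mult)
  also have "\<dots> \<le> (1/2 + \<nu>) * ?R + \<bar>1/2 - \<nu>\<bar> * ?R"
    using A B \<nu> by (intro add_mono mult_left_mono) auto
  also have "\<dots> = (1/2 + \<nu> + \<bar>1/2 - \<nu>\<bar>) * ?R" by (simp add: algebra_simps)
  also have "\<dots> \<le> 2 * ?R" using \<nu> by (intro mult_right_mono) auto
  finally show ?thesis .
qed

lemma sol_pos_L2_near_0:
  "0 \<le> \<nu> \<Longrightarrow> square_integrable (\<lambda>x. if x \<le> b then complex_of_real (sol_pos \<nu> x) else 0)"
  using square_integrable_powr_near_0[of "1/2 + \<nu>" b] by (simp add: sol_pos_def if_distrib cong: if_cong)

text \<open>The limit circle case at zero: the more singular solution is still square-integrable, and \<open>\<nu> <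
  1\<close> is exactly what this takes.\<close>
lemma sol_neg_L2_near_0:
  assumes \<nu>: "0 \<le> \<nu>" "\<nu> < 1"
  shows "square_integrable (\<lambda>x. if x \<le> b then complex_of_real (sol_neg \<nu> x) else 0)"
proof (cases "\<nu> = 0")
  case False
  then show ?thesis
    using square_integrable_powr_near_0[of "1/2 - \<nu>" b] \<nu> by (simp add: sol_neg_def if_distrib cong: if_cong)
next
  case True
  let ?g = "\<lambda>x. complex_of_real (if x \<le> b then x powr (3/2) else 0) + 2 * complex_of_real (if x \<le> b then x powr 0 else 0)"
  have g: "square_integrable ?g"
    by (intro square_integrable_add square_integrable_scale square_integrable_powr_near_0) auto
  show ?thesis
  proof (rule square_integrable_bound[OF _ g, where C=1])
    have "(\<lambda>x::real. complex_of_real (if x \<le> b then x powr (1/2) * ln x else 0)) \<in> borel_measurable borel"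
      by measurable
    then have "(\<lambda>x::real. complex_of_real (if x \<le> b then x powr (1/2) * ln x else 0)) \<in> borel_measurable half_line"
      by (intro measurable_restrict_space1) (simp add: measurable_completion)
    then show "(\<lambda>x. if x \<le> b then complex_of_real (sol_neg \<nu> x) else 0) \<in> borel_measurable half_line"
      using True by (simp add: sol_neg_def if_distrib cong: if_cong)
    show "AE x in half_line. cmod (if x \<le> b then complex_of_real (sol_neg \<nu> x) else 0) \<le> 1 * cmod (?g x)"
    proof (rule AE_half_line_I)
      fix x :: real assume x: "0 < x"
      have *: "\<bar>x powr (1/2) * ln x\<bar> \<le> x powr (3/2) + 2"
      proof (cases "1 \<le> x")
        case True
        have "x powr (1/2) * ln x \<le> x powr (1/2) * x" using x ln_bound[OF x] by (intro mult_left_mono) auto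
        also have "\<dots> = x powr (3/2)" using x powr_add[of x "1/2" 1] by simp
        finally show ?thesis using True x by simp
      next
        case False
        have "x powr (1/2) * (ln 1 - ln x) \<le> x powr (1/2) * (2 * (1 powr (1/2) * x powr (- 1/2)))"
          using ln_ratio_bound(2)[of x 1] False x by (intro mult_left_mono) auto
        also have "\<dots> = 2" using x by (simp flip: powr_add)
        finally have "- (x powr (1/2) * ln x) \<le> 2" by simp
        moreover have "x powr (1/2) * ln x \<le> 0" using False x by (intro mult_nonneg_nonpos) auto
        moreover have "0 \<le> x powr (3/2)" by simp
        ultimately show ?thesis by linarith
      qed
      have "cmod (complex_of_real (x powr (3/2)) + 2) = x powr (3/2) + 2"
        by (metis norm_of_real of_real_add of_real_numeral abs_of_nonneg add_nonneg_nonneg powr_ge_zero zero_le_numeral)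
      then show "cmod (if x \<le> b then complex_of_real (sol_neg \<nu> x) else 0) \<le> 1 * cmod (?g x)"
        using * x True by (simp add: sol_neg_def abs_mult norm_mult)
    qed
  qed
qed

lemma wronskian_boundary:
  assumes f: "bessel_pair \<nu> f f' g" and g: "square_integrable g"
    and s: "bessel_pair \<nu> s s' (\<lambda>x. 0)" and sL2: "\<And>b. square_integrable (\<lambda>x. if x \<le> b then s x else 0)"
  obtains L where "\<And>x. 0 < x \<Longrightarrow> f x * s' x - f' x * s x = L + integral {0..x} (\<lambda>t. g t * s t)"
proof -
  have "primitive (\<lambda>x. f x * s' x - f' x * s x) (\<lambda>x. g x * s x)"
    using wronskian_primitive[OF f s] by simp
  from primitive_eq_from_0[OF this absolutely_integrable_mult_L2_near_0[OF g sL2]] that show ?thesis by blast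
qed

text \<open>The Wronskian of the two solutions is constant, so \<open>f\<close> and \<open>f'\<close> are linear
  combinations of the Wronskians of \<open>f\<close> with them. When these vanish at \<open>0\<close>, the combination
  is an integral of \<open>g\<close> against the kernels estimated above, without a homogeneous part.\<close>
lemma zero_boundary_bounds:
  assumes \<nu>: "0 \<le> \<nu>" "\<nu> < 1" and \<mu>: "\<nu> \<le> \<mu>" "1/2 \<le> \<mu>" "\<mu> < 1"
    and g: "square_integrable g" 
    and Wp: "\<And>x. 0 < x \<Longrightarrow> f x * complex_of_real (sol_pos' \<nu> x) - f' x * complex_of_real (sol_pos \<nu> x)
       = integral {0..x} (\<lambda>t. g t * complex_of_real (sol_pos \<nu> t))"
    and Wn: "\<And>x. 0 < x \<Longrightarrow> f x * complex_of_real (sol_neg' \<nu> x) - f' x * complex_of_real (sol_neg \<nu> x)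
       = integral {0..x} (\<lambda>t. g t * complex_of_real (sol_neg \<nu> t))"
    and x: "0 < x"
  shows "cmod (f x) \<le> 2 / \<bar>sol_wronskian \<nu>\<bar> * (x powr (1/2 + \<mu>) * weighted_integral \<mu> g x)"
    and "cmod (f' x) \<le> 2 / \<bar>sol_wronskian \<nu>\<bar> * (x powr (\<mu> - 1/2) * weighted_integral \<mu> g x)"
proof -
  let ?w = "complex_of_real (sol_wronskian \<nu>)"
  let ?p = "\<lambda>x. complex_of_real (sol_pos \<nu> x)" and ?n = "\<lambda>x. complex_of_real (sol_neg \<nu> x)"
  let ?p' = "complex_of_real (sol_pos' \<nu> x)" and ?n' = "complex_of_real (sol_neg' \<nu> x)"
  have ip: "(\<lambda>t. g t * ?p t) integrable_on {0..x}"
    using absolutely_integrable_mult_L2_near_0[OF g sol_pos_L2_near_0[OF \<nu>(1)]] set_lebesgue_integral_eq_integral(1) by blast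
  have "(\<lambda>t. g t * ?n t) integrable_on {0..x}"
    using absolutely_integrable_mult_L2_near_0[OF g sol_neg_L2_near_0[OF \<nu>]] set_lebesgue_integral_eq_integral(1) by blast
  note i = ip this
  have w: "?p x * ?n' - ?p' * ?n x = ?w"
    using arg_cong[OF wronskian_sol_pos_sol_neg[OF x, of \<nu>], of complex_of_real] by simp
  have est: "cmod z \<le> 2 / \<bar>sol_wronskian \<nu>\<bar> * (c * weighted_integral \<mu> g x)"
    if z: "z * ?w = complex_of_real A * integral {0..x} (\<lambda>t. g t * ?n t) - complex_of_real B * integral {0..x} (\<lambda>t. g t * ?p t)"
      and AB: "\<And>t. 0 < t \<Longrightarrow> t \<le> x \<Longrightarrow> \<bar>A * sol_neg \<nu> t - B * sol_pos \<nu> t\<bar> \<le> 2 * (c * t powr (1/2 - \<mu>))"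
    for z A B c
  proof -
    have "z * ?w = integral {0..x} (\<lambda>t. complex_of_real A * (g t * ?n t) - complex_of_real B * (g t * ?p t))"
      unfolding z using i by (simp add: integral_diff integrable_on_mult_right)
    also have "cmod \<dots> \<le> integral {0..x} (\<lambda>t. 2 * c * (t powr (1/2 - \<mu>) * cmod (g t)))"
    proof (rule integral_norm_bound_integral)
      show "(\<lambda>t. complex_of_real A * (g t * ?n t) - complex_of_real B * (g t * ?p t)) integrable_on {0..x}"
        using i by (intro integrable_diff integrable_on_mult_right)
      show "(\<lambda>t. 2 * c * (t powr (1/2 - \<mu>) * cmod (g t))) integrable_on {0..x}"
        using weighted_absolutely_integrable[OF g \<mu>(3)] set_lebesgue_integral_eq_integral(1)
        by (intro integrable_on_mult_right) blast
      fix t assume t: "t \<in> {0..x}"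
      have "cmod (complex_of_real A * (g t * ?n t) - complex_of_real B * (g t * ?p t)) 
          = cmod (g t * complex_of_real (A * sol_neg \<nu> t - B * sol_pos \<nu> t))"
        by (rule arg_cong[where f=cmod]) (simp add: algebra_simps)
      also have "\<dots> = cmod (g t) * \<bar>A * sol_neg \<nu> t - B * sol_pos \<nu> t\<bar>" by (simp only: norm_mult norm_of_real)
      also have "\<dots> \<le> cmod (g t) * (2 * (c * t powr (1/2 - \<mu>)))"
      proof (cases "t = 0")
        case False with t AB show ?thesis by (intro mult_left_mono) auto
      qed (use \<nu> in \<open>auto simp: sol_neg_def sol_pos_def\<close>)
      finally show "cmod (complex_of_real A * (g t * ?n t) - complex_of_real B * (g t * ?p t)) \<le> 2 * c * (t powr (1/2 - \<mu>) * cmod (g t))"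
        by (simp add: algebra_simps)
    qed
    also have "\<dots> = 2 * c * weighted_integral \<mu> g x" unfolding weighted_integral_def by simp
    finally show ?thesis using sol_wronskian_nonzero[of \<nu>] by (simp add: norm_mult field_simps)
  qed
  have "f x * ?w = ?p x * (f x * ?n' - f' x * ?n x) - ?n x * (f x * ?p' - f' x * ?p x)"
    unfolding w[symmetric] by (simp add: algebra_simps)
  then show "cmod (f x) \<le> 2 / \<bar>sol_wronskian \<nu>\<bar> * (x powr (1/2 + \<mu>) * weighted_integral \<mu> g x)"
    unfolding Wp[OF x] Wn[OF x] by (rule est) (use sol_kernel_bound[OF \<nu>(1)] \<mu> in auto)
  have "f' x * ?w = ?p' * (f x * ?n' - f' x * ?n x) - ?n' * (f x * ?p' - f' x * ?p x)"
    unfolding w[symmetric] by (simp add: algebra_simps)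
  then show "cmod (f' x) \<le> 2 / \<bar>sol_wronskian \<nu>\<bar> * (x powr (\<mu> - 1/2) * weighted_integral \<mu> g x)"
    unfolding Wp[OF x] Wn[OF x] by (rule est) (use sol_kernel_bound'[OF \<nu>] \<mu> in auto)
qed

section \<open>Weak derivatives\<close>

lemma primitive_boundary_limit:
  fixes F f :: "real \<Rightarrow> 'a::euclidean_space"
  assumes L: "\<And>x. 0 < x \<Longrightarrow> F x = L + integral {0..x} f" and f: "\<And>b. f absolutely_integrable_on {0..b}"
    and l: "(F \<longlongrightarrow> l) (at_right 0)"
  shows "L = l"
proof -
  have "((\<lambda>x. L + integral {0..x} f) \<longlongrightarrow> L + 0) (at_right 0)"
    by (intro tendsto_intros integral_from_0_tendsto_0 f)
  moreover have "\<forall>\<^sub>F x in at_right 0. L + integral {0..x} f = F x"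
    using L by (auto simp: eventually_at_filter)
  ultimately have "(F \<longlongrightarrow> L) (at_right 0)" by (simp add: tendsto_cong)
  with l show ?thesis using tendsto_unique trivial_limit_at_right_real by blast
qed

lemma primitive_compact_support_integral:
  assumes F: "primitive F f" and f: "integrable half_line f" and a: "0 < a"
    and F0: "\<And>x. 0 < x \<Longrightarrow> x < a \<Longrightarrow> F x = 0" and Fb: "\<And>x. b \<le> x \<Longrightarrow> F x = 0"
  shows "(LINT x|half_line. f x) = 0"
proof -
  obtain L where L: "\<And>x. 0 < x \<Longrightarrow> F x = L + integral {0..x} f"
    using primitive_eq_from_0[OF F absolutely_integrable_Icc_0[OF f]] by blast
  have lim: "(F \<longlongrightarrow> 0) (at_right 0)"
    by (rule tendsto_eventually) (use eventually_at_right_real[OF a] F0 in \<open>auto elim: eventually_mono\<close>)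
  have "L = 0" by (rule primitive_boundary_limit[OF L absolutely_integrable_Icc_0[OF f] lim])
  with primitive_boundary_value[OF F f Fb L] show ?thesis by simp
qed

lemma integrable_half_line_compact:
  fixes f :: "real \<Rightarrow> 'a::euclidean_space"
  assumes a: "0 < a" and f: "f absolutely_integrable_on {a..b}" and 0: "\<And>x. 0 < x \<Longrightarrow> x \<notin> {a..b} \<Longrightarrow> f x = 0"
  shows "integrable half_line f" "(LINT x|half_line. f x) = integral {a..b} f"
proof -
  have eq: "(\<lambda>x. if x \<in> {0<..} then f x else 0) = (\<lambda>x. if x \<in> {a..b} then f x else 0)"
    using a 0 by fastforce
  have "(\<lambda>x. if x \<in> {0<..} then f x else 0) absolutely_integrable_on UNIV"
    unfolding eq using f absolutely_integrable_restrict_UNIV by blast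
  then show 1: "integrable half_line f"
    unfolding integrable_half_line_iff using absolutely_integrable_restrict_UNIV by blast
  have "(LINT x|half_line. f x) = integral {0<..} f"
    using lebesgue_integral_eq_integral[OF 1] by simp
  also have "\<dots> = integral {a..b} f"
    using arg_cong[OF eq, of "integral UNIV"] by (simp only: integral_restrict_UNIV)
  finally show "(LINT x|half_line. f x) = integral {a..b} f" .
qed

lemma compact_support_interval:
  assumes "compact_support_in {0<..} \<phi>"
  obtains a b where "0 < a" "a < b" "\<And>x. 0 < x \<Longrightarrow> x \<notin> {a..b} \<Longrightarrow> \<phi> x = 0"
proof -
  obtain K where K: "compact K" "K \<subseteq> {0<..}" "\<forall>x\<in>{0<..} - K. \<phi> x = 0"
    using assms unfolding compact_support_in_def by blast
  have "\<exists>a b. 0 < a \<and> a < b \<and> K \<subseteq> {a..b}"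
  proof (cases "K = {}")
    case False
    obtain m where m: "m \<in> K" "\<forall>y\<in>K. m \<le> y" using compact_attains_inf[OF K(1) False] by blast
    obtain M where M: "M \<in> K" "\<forall>y\<in>K. y \<le> M" using compact_attains_sup[OF K(1) False] by blast
    have "0 < m" using m K by auto
    moreover have "m \<le> M" using m M by blast
    moreover have "K \<subseteq> {m..M+1}" using m M by force
    ultimately show ?thesis by (intro exI[of _ m] exI[of _ "M + 1"]) auto
  next
    case True
    then have "0 < (1::real) \<and> (1::real) < 2 \<and> K \<subseteq> {1..2}" by simp
    then show ?thesis by blast
  qed
  then obtain a b where "0 < a" "a < b" "K \<subseteq> {a..b}" by blast
  with K(3) show thesis by (intro that[of a b]) auto
qed

lemma derivative_of_locally_constant:
  fixes f :: "real \<Rightarrow> 'a::real_normed_vector"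
  assumes "(f has_vector_derivative d) (at x)" "open S" "x \<in> S" "\<And>y. y \<in> S \<Longrightarrow> f y = c"
  shows "d = 0"
proof -
  have "(f has_vector_derivative 0) (at x)"
    unfolding has_vector_derivative_def
    by (rule has_derivative_transform_within_open[OF _ assms(2,3), where f="\<lambda>x. c"]) (use assms(4) in auto)
  with assms(1) show ?thesis by (rule vector_derivative_unique_at)
qed

lemma vanishing_derivative:
  fixes f :: "real \<Rightarrow> 'a::real_normed_vector"
  assumes d: "\<And>x. 0 < x \<Longrightarrow> (f has_vector_derivative f' x) (at x)"
    and 0: "\<And>x. 0 < x \<Longrightarrow> x \<notin> {a..b} \<Longrightarrow> f x = 0" and x: "0 < x" "x \<notin> {a..b}"
  shows "f' x = 0"
  by (rule derivative_of_locally_constant[OF d[OF x(1)], of "{0<..} \<inter> - {a..b}" 0])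
    (use x 0 in \<open>auto intro!: open_Int simp: open_Compl\<close>)

lemma C1_deriv_on_open_iff:
  "C1_deriv_on {0<..} f f' \<longleftrightarrow> (\<forall>x>0. (f has_vector_derivative f' x) (at x)) \<and> continuous_on {0<..} f'"
  unfolding C1_deriv_on_def by (auto simp: at_within_open[OF _ open_greaterThan])

lemma primitive_exists:
  fixes m :: "real \<Rightarrow> 'a::euclidean_space"
  assumes "\<And>a b. 0 < a \<Longrightarrow> m absolutely_integrable_on {a..b}"
  obtains M where "primitive M m"
proof
  have mi: "m integrable_on {a..b}" if "0 < a" for a b
    using assms[OF that] set_lebesgue_integral_eq_integral(1) by blast
  define M where "M x = (if 1 \<le> x then integral {1..x} m else - integral {x..1} m)" for x
  have c: "integral {a..c} m + integral {c..b} m = integral {a..b} m" if "0 < a" "a \<le> c" "c \<le> b" for a b c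
    by (rule Henstock_Kurzweil_Integration.integral_combine) (use that mi in auto)
  show "primitive M m"
    unfolding primitive_def
  proof (intro allI impI conjI assms)
    fix a b :: real assume ab: "0 < a" "a \<le> b"
    have "M b - M a = integral {a..b} m"
    proof -
      consider "1 \<le> a" | "a < 1" "1 \<le> b" | "b < 1" by linarith
      then show ?thesis
        using c[of 1 a b] c[of a 1 b] c[of a b 1] ab by cases (auto simp: M_def algebra_simps)
    qed
    then show "(m has_integral M b - M a) {a..b}" using mi[OF ab(1)] by (simp add: integrable_integral)
  qed
qed

text \<open>Continuous functions that increase to the indicator of \<open>(a, b)\<close>.\<close>
definition trapezoid :: "nat \<Rightarrow> real \<Rightarrow> real \<Rightarrow> real \<Rightarrow> real" where
  "trapezoid n a b x = min 1 (max 0 (real n * min (x - a) (b - x)))"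

lemma trapezoid_0: "x \<notin> {a<..<b} \<Longrightarrow> trapezoid n a b x = 0"
proof -
  assume "x \<notin> {a<..<b}"
  then have "min (x - a) (b - x) \<le> 0" by auto
  then have "real n * min (x - a) (b - x) \<le> 0" by (intro mult_nonneg_nonpos) auto
  then show ?thesis by (simp add: trapezoid_def)
qed

lemma trapezoid_bounds: "0 \<le> trapezoid n a b x" "trapezoid n a b x \<le> 1"
  by (auto simp: trapezoid_def)

lemma continuous_trapezoid: "continuous_on S (trapezoid n a b)"
  unfolding trapezoid_def by (intro continuous_intros)

lemma trapezoid_tendsto:
  assumes "x \<in> {a<..<b}" shows "(\<lambda>n. trapezoid n a b x) \<longlonglongrightarrow> 1"
proof (rule tendsto_eventually)
  define d where "d = min (x - a) (b - x)"
  have d: "0 < d" using assms by (simp add: d_def)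
  obtain N :: nat where N: "1 / d < real N" using reals_Archimedean2 by blast
  have "trapezoid n a b x = 1" if "N \<le> n" for n
  proof -
    have "1 / d < real n" using N that by linarith
    then have "1 < real n * d" using d by (simp add: field_simps)
    then show ?thesis by (simp add: trapezoid_def flip: d_def)
  qed
  then show "\<forall>\<^sub>F n in sequentially. trapezoid n a b x = 1" by (rule eventually_sequentiallyI)
qed

lemma integral_trapezoid_tendsto:
  fixes E :: "real \<Rightarrow> complex"
  assumes E: "E absolutely_integrable_on {a..b}"
  shows "(\<lambda>n. integral {a..b} (\<lambda>x. E x * complex_of_real (trapezoid n a b x))) \<longlonglongrightarrow> integral {a..b} E"
proof -
  have E': "E absolutely_integrable_on {a<..<b}" by (rule set_integrable_subset[OF E]) auto
  have "(\<lambda>n. integral {a<..<b} (\<lambda>x. E x * complex_of_real (trapezoid n a b x))) \<longlonglongrightarrow> integral {a<..<b} E"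
  proof (rule dominated_convergence(2)[where h="\<lambda>x. cmod (E x)"])
    show "(\<lambda>x. E x * complex_of_real (trapezoid n a b x)) integrable_on {a<..<b}" for n
    proof -
      have "(\<lambda>x. E x * complex_of_real (trapezoid n a b x)) absolutely_integrable_on {a..b}"
        by (rule absolutely_integrable_mult_continuous(2)[OF _ E])
          (intro continuous_on_of_real continuous_trapezoid)
      then have "(\<lambda>x. E x * complex_of_real (trapezoid n a b x)) absolutely_integrable_on {a<..<b}"
        by (rule set_integrable_subset) auto
      then show ?thesis using set_lebesgue_integral_eq_integral(1) by blast
    qed
    show "(\<lambda>x. cmod (E x)) integrable_on {a<..<b}"
      using absolutely_integrable_norm[OF E'] set_lebesgue_integral_eq_integral(1) by (auto simp: o_def)
    show "cmod (E x * complex_of_real (trapezoid n a b x)) \<le> cmod (E x)" for n x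
      using trapezoid_bounds[of n a b x] by (simp add: norm_mult mult_left_le)
    show "(\<lambda>n. E x * complex_of_real (trapezoid n a b x)) \<longlonglongrightarrow> E x" if "x \<in> {a<..<b}" for x
      using tendsto_mult[OF tendsto_const tendsto_of_real[OF trapezoid_tendsto[OF that]], of "E x"] by simp
  qed
  then show ?thesis by (simp add: integral_open_interval_real)
qed

text \<open>A continuous function with compact support and vanishing integral is the derivative of a test function.
  The lower limit \<open>a / 2\<close> lies to the left of the support and inside the half-line.\<close>
lemma continuous_compact_antiderivative:
  fixes k :: "real \<Rightarrow> complex"
  assumes k: "continuous_on {0<..} k" and a: "0 < a" "a \<le> b" and k0: "\<And>x. 0 < x \<Longrightarrow> x \<notin> {a..b} \<Longrightarrow> k x = 0"
    and int: "integral {a..b} k = 0"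
  shows "C1_deriv_on {0<..} (\<lambda>x. integral {a/2..x} k) k" "compact_support_in {0<..} (\<lambda>x. integral {a/2..x} k)"
proof -
  have kc: "continuous_on {u..v} k" if "0 < u" for u v
    by (rule continuous_on_subset[OF k]) (use that in auto)
  have ki: "k integrable_on {u..v}" if "0 < u" for u v
    by (rule integrable_continuous_real[OF kc[OF that]])
  have left: "integral {a/2..x} k = 0" if "x \<le> a" for x
  proof -
    have "integral {a/2..x} k = integral {a/2..x} (\<lambda>x. 0)"
      by (rule integral_spike[of "{a}"]) (use that a in \<open>auto intro!: k0\<close>)
    then show ?thesis by simp
  qed
  show "C1_deriv_on {0<..} (\<lambda>x. integral {a/2..x} k) k"
    unfolding C1_deriv_on_open_iff
  proof (intro conjI allI impI k)
    fix x :: real assume x: "0 < x"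
    show "((\<lambda>x. integral {a/2..x} k) has_vector_derivative k x) (at x)"
    proof (cases "x < a")
      case True
      have "((\<lambda>x. 0) has_vector_derivative k x) (at x)" using k0[OF x] True by auto
      then show ?thesis unfolding has_vector_derivative_def
        by (rule has_derivative_transform_within_open[where s="{..<a}"]) (use True left in auto)
    next
      case False
      have "((\<lambda>x. integral {a/2..x} k) has_vector_derivative k x) (at x within {a/2..x+1})"
        by (rule integral_has_vector_derivative) (use False a kc[of "a/2" "x+1"] in auto)
      then show ?thesis using at_within_Icc_at[of "a/2" x "x + 1"] False a by simp
    qed
  qed
  show "compact_support_in {0<..} (\<lambda>x. integral {a/2..x} k)"
    unfolding compact_support_in_def
  proof (intro exI[of _ "{a..b}"] conjI ballI)
    fix x assume "x \<in> {0<..} - {a..b}"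
    then consider "x \<le> a" | "b < x" by fastforce
    then show "integral {a/2..x} k = 0"
    proof cases
      case 2
      have "integral {a/2..a} k + integral {a..b} k = integral {a/2..b} k"
        by (rule Henstock_Kurzweil_Integration.integral_combine) (use a ki in auto)
      moreover have "integral {a/2..b} k + integral {b..x} k = integral {a/2..x} k"
        by (rule Henstock_Kurzweil_Integration.integral_combine) (use a 2 ki in auto)
      moreover have "integral {b..x} k = integral {b..x} (\<lambda>x. 0)"
        by (rule integral_spike[of "{b}"]) (use a in \<open>auto intro!: k0\<close>)
      ultimately show ?thesis using int left[of a] by simp
    qed (rule left)
  qed (use a in auto)
qed

text \<open>The lemma of du Bois-Reymond. The combination of trapezoids over \<open>(a, b)\<close> and \<open>(1,
  2)\<close> with vanishing integral is the derivative of a test function; in the limit it gives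
  \<open>\<integral>\<^sub>a\<^sup>b E = (b - a) c\<close> with a fixed \<open>c\<close>, and \<open>E = c\<close>
  almost everywhere by differentiation.\<close>
lemma weak_derivative_zero_imp_const:
  fixes E :: "real \<Rightarrow> complex"
  assumes E: "\<And>a b. 0 < a \<Longrightarrow> E absolutely_integrable_on {a..b}"
    and w: "\<And>\<phi> \<phi>'. C1_deriv_on {0<..} \<phi> \<phi>' \<Longrightarrow> compact_support_in {0<..} \<phi> \<Longrightarrow> (LINT x|half_line. E x * \<phi>' x) = 0"
  shows "\<exists>c. AE x in half_line. E x = c"
proof -
  define c where "c = integral {1..2} E"
  have main: "integral {a..b} E = (b - a) * c" if ab: "0 < a" "a < b" for a b
  proof -
    define t where "t n a b x = complex_of_real (trapezoid n a b x)" for n a b x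
    define I where "I n a b = integral {a..b} (t n a b)" for n a b
    have tc: "continuous_on S (t n a b)" for S n a b
      unfolding t_def by (intro continuous_on_of_real continuous_trapezoid)
    have t0: "t n a b x = 0" if "x \<notin> {a..b}" for n a b x
      using trapezoid_0[of x a b n] that by (auto simp: t_def)
    have ti: "integral {u..v} (t n a b) = I n a b" "(t n a b) integrable_on {u..v}" if "u \<le> a" "b \<le> v" for u v n a b
    proof -
      show "(t n a b) integrable_on {u..v}" by (rule integrable_continuous_real[OF tc])
      have "integral {u..v} (t n a b) = integral {u..v} (\<lambda>x. if x \<in> {a..b} then t n a b x else 0)"
        by (rule integral_cong) (simp add: t0)
      also have "\<dots> = I n a b" using that unfolding I_def by (subst integral_restrict_Int) (simp add: Int_absorb1)
      finally show "integral {u..v} (t n a b) = I n a b" .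
    qed
    have Et: "integrable half_line (\<lambda>x. E x * t n a b x)"
      "(LINT x|half_line. E x * t n a b x) = integral {a..b} (\<lambda>x. E x * t n a b x)" if "0 < a" for n a b
      by (rule integrable_half_line_compact[OF that absolutely_integrable_mult_continuous(2)[OF tc E[OF that, of b]]],
          simp add: t0)+
    have eq: "I n 1 2 * integral {a..b} (\<lambda>x. E x * t n a b x) - I n a b * integral {1..2} (\<lambda>x. E x * t n 1 2 x) = 0" for n
    proof -
      define k where "k x = I n 1 2 * t n a b x - I n a b * t n 1 2 x" for x
      have kc: "continuous_on {0<..} k" unfolding k_def by (intro continuous_intros tc)
      have k0: "k x = 0" if "x \<notin> {min a 1..max b 2}" for x
      proof -
        have "x \<notin> {a..b}" "x \<notin> {1..2}" using that by auto
        then show ?thesis unfolding k_def by (simp add: t0 del: atLeastAtMost_iff)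
      qed
      have "integral {min a 1..max b 2} k = I n 1 2 * I n a b - I n a b * I n 1 2"
        unfolding k_def by (subst integral_diff) (simp_all add: integrable_on_mult_right ti)
      then have ki: "integral {min a 1..max b 2} k = 0" by simp
      have "0 < min a 1" "min a 1 \<le> max b 2" using ab by auto
      from w[OF continuous_compact_antiderivative[OF kc this k0 ki]]
      have "(LINT x|half_line. E x * k x) = 0" .
      also have "(\<lambda>x. E x * k x) = (\<lambda>x. I n 1 2 * (E x * t n a b x) - I n a b * (E x * t n 1 2 x))"
        by (auto simp: k_def algebra_simps)
      finally show ?thesis
        using Et(1)[of a n b] Et(1)[of 1 n 2] ab by (simp add: Et(2))
    qed
    have lim1: "(\<lambda>n. I n a b) \<longlonglongrightarrow> complex_of_real (b - a)" if "a < b" for a b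
      using integral_trapezoid_tendsto[where E="\<lambda>x. 1" and a=a and b=b] that unfolding I_def t_def by (simp add: scaleR_conv_of_real)
    have lim2: "(\<lambda>n. integral {a..b} (\<lambda>x. E x * t n a b x)) \<longlonglongrightarrow> integral {a..b} E" if "0 < a" for a b
      unfolding t_def by (rule integral_trapezoid_tendsto[OF E[OF that]])
    have "(\<lambda>n. I n 1 2 * integral {a..b} (\<lambda>x. E x * t n a b x) - I n a b * integral {1..2} (\<lambda>x. E x * t n 1 2 x))
       \<longlonglongrightarrow> complex_of_real (2 - 1) * integral {a..b} E - complex_of_real (b - a) * integral {1..2} E"
      by (intro tendsto_diff tendsto_mult lim1 lim2) (use ab in auto)
    then have "(\<lambda>n. 0) \<longlonglongrightarrow> complex_of_real (2 - 1) * integral {a..b} E - complex_of_real (b - a) * integral {1..2} E"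
      unfolding eq .
    from LIMSEQ_unique[OF this tendsto_const] show ?thesis by (simp add: c_def)
  qed
  have "primitive (\<lambda>x. 0) (\<lambda>x. E x - c)"
    unfolding primitive_def
  proof (intro allI impI conjI)
    fix a b :: real assume ab: "0 < a" "a \<le> b"
    show "(\<lambda>x. E x - c) absolutely_integrable_on {a..b}"
      by (intro set_integral_diff E ab) simp
    have "E integrable_on {a..b}" using E[OF ab(1)] set_lebesgue_integral_eq_integral(1) by blast
    then have "((\<lambda>x. E x - c) has_integral (integral {a..b} E - content {a..b} *\<^sub>R c)) {a..b}"
      using has_integral_const_real[of c a b] by (intro has_integral_diff) (auto simp: integrable_integral)
    moreover have "integral {a..b} E = (b - a) * c" using main[of a b] ab by (cases "a = b") auto
    ultimately show "((\<lambda>x. E x - c) has_integral 0 - 0) {a..b}" using ab by (simp add: scaleR_conv_of_real)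
  qed
  from primitive_AE_derivative[OF this] have "AE x in half_line. E x = c"
  proof eventually_elim
    case (elim x)
    from vector_derivative_unique_at[OF this has_vector_derivative_const] show ?case by simp
  qed
  then show ?thesis by blast
qed

text \<open>The difference of \<open>u\<close> and a primitive of \<open>v\<close> has the weak derivative
  zero.\<close>
lemma weak_derivative_imp_primitive:
  fixes u v :: "real \<Rightarrow> complex"
  assumes u: "\<And>a b. 0 < a \<Longrightarrow> u absolutely_integrable_on {a..b}"
    and v: "\<And>a b. 0 < a \<Longrightarrow> v absolutely_integrable_on {a..b}"
    and w: "\<And>\<phi> \<phi>'. C1_deriv_on {0<..} \<phi> \<phi>' \<Longrightarrow> compact_support_in {0<..} \<phi> \<Longrightarrow>
       (LINT x|half_line. u x * \<phi>' x) = - (LINT x|half_line. v x * \<phi> x)"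
  obtains f where "AE x in half_line. u x = f x" "primitive f v"
proof -
  obtain V where V: "primitive V v" using primitive_exists v by blast
  have Vc: "continuous_on {a..b} V" if "0 < a" for a b
    by (rule continuous_on_subset[OF primitive_continuous_on[OF V]]) (use that in auto)
  have "\<exists>c. AE x in half_line. u x - V x = c"
  proof (rule weak_derivative_zero_imp_const)
    show "(\<lambda>x. u x - V x) absolutely_integrable_on {a..b}" if "0 < a" for a b
      by (intro set_integral_diff u that absolutely_integrable_continuous_real Vc)
    fix \<phi> \<phi>' :: "real \<Rightarrow> complex"
    assume C: "C1_deriv_on {0<..} \<phi> \<phi>'" and S: "compact_support_in {0<..} \<phi>"
    obtain a b where ab: "0 < a" "a < b" "\<And>x. 0 < x \<Longrightarrow> x \<notin> {a..b} \<Longrightarrow> \<phi> x = 0"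
      using compact_support_interval[OF S] by blast
    have d: "\<And>x. 0 < x \<Longrightarrow> (\<phi> has_vector_derivative \<phi>' x) (at x)" and c': "continuous_on {0<..} \<phi>'"
      using C unfolding C1_deriv_on_open_iff by auto
    have ab': "\<phi>' x = 0" if "0 < x" "x \<notin> {a..b}" for x
      by (rule vanishing_derivative[OF d ab(3) that])
    have sub: "{a..b} \<subseteq> {0<..}" using ab by auto
    have c1: "continuous_on {a..b} \<phi>'" by (rule continuous_on_subset[OF c' sub])
    have c0: "continuous_on {a..b} \<phi>"
      by (rule continuous_on_subset[OF has_vector_derivative_imp_continuous_on[OF d] sub])
    have i1: "integrable half_line (\<lambda>x. u x * \<phi>' x)"
      by (rule integrable_half_line_compact[OF ab(1) absolutely_integrable_mult_continuous(2)[OF c1 u[OF ab(1)]]]) (simp add: ab')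
    have i2: "integrable half_line (\<lambda>x. v x * \<phi> x)"
      by (rule integrable_half_line_compact[OF ab(1) absolutely_integrable_mult_continuous(2)[OF c0 v[OF ab(1)]]]) (simp add: ab)
    have i3: "integrable half_line (\<lambda>x. V x * \<phi>' x)"
      by (rule integrable_half_line_compact[OF ab(1) absolutely_integrable_mult_continuous(1)[OF Vc absolutely_integrable_continuous_real[OF c1]]])
        (use ab ab' in auto)
    have "(LINT x|half_line. V x * \<phi>' x + v x * \<phi> x) = 0"
      by (rule primitive_compact_support_integral[OF primitive_mult[OF V primitive_of_C1[OF d c']] _ ab(1), where b="b + 1"])
        (use ab i2 i3 in auto)
    then have "(LINT x|half_line. V x * \<phi>' x) = - (LINT x|half_line. v x * \<phi> x)"
      using i2 i3 by (simp add: add_eq_0_iff2)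
    then show "(LINT x|half_line. (u x - V x) * \<phi>' x) = 0"
      using w[OF C S] i1 i3 by (simp add: left_diff_distrib)
  qed
  then obtain c where c: "AE x in half_line. u x - V x = c" by blast
  show thesis
  proof
    show "AE x in half_line. u x = V x + c" using c by eventually_elim (simp add: algebra_simps)
    show "primitive (\<lambda>x. V x + c) v" using primitive_add[OF V primitive_const[of c]] by simp
  qed
qed

lemma primitive_continuous_derivative:
  assumes F: "primitive F f" and f: "continuous_on {0<..} f" and x: "0 < x"
  shows "(F has_vector_derivative f x) (at x)"
proof -
  have "((\<lambda>y. integral {x/2..y} f) has_vector_derivative f x) (at x within {x/2..x+1})"
    by (rule integral_has_vector_derivative) (use x in \<open>auto intro: continuous_on_subset[OF f]\<close>)
  then have "((\<lambda>y. F (x/2) + integral {x/2..y} f) has_vector_derivative f x) (at x)"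
    using at_within_Icc_at[of "x/2" x "x + 1"] x
    by (auto intro: has_vector_derivative_add[OF has_vector_derivative_const, simplified])
  then show ?thesis unfolding has_vector_derivative_def
  proof (rule has_derivative_transform_within_open[where s="{x/2<..}"])
    fix y assume "y \<in> {x/2<..}"
    then show "F (x/2) + integral {x/2..y} f = F y"
      using primitive_has_integral[OF F, of "x/2" y] x by (simp add: integral_unique)
  qed (use x in auto)
qed

text \<open>Powers of the positive part are the building blocks of all explicit test and cut-off functions
  below.\<close>
lemma deriv_max_power:
  "((\<lambda>t::real. (max 0 t) ^ Suc (Suc n)) has_real_derivative real (Suc (Suc n)) * (max 0 t) ^ Suc n) (at t)"
proof -
  consider "t < 0" | "t = 0" | "0 < t" by linarith
  then show ?thesis
  proof cases
    case 1
    have "((\<lambda>t::real. 0) has_real_derivative real (Suc (Suc n)) * (max 0 t) ^ Suc n) (at t)"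
      using 1 by simp
    then show ?thesis
      by (rule has_field_derivative_transform_within_open[where S="{..<0}"]) (use 1 in auto)
  next
    case 2
    have "isCont (\<lambda>t::real. t ^ n * max 0 t) 0" by (intro continuous_intros)
    moreover have "(max 0 z) ^ Suc (Suc n) = (z ^ n * max 0 z) * z" for z :: real
      by (simp add: max_def)
    ultimately show ?thesis using 2 unfolding CARAT_DERIV
      by (intro exI[of _ "\<lambda>t. t ^ n * max 0 t"]) simp
  next
    case 3
    have "((\<lambda>t::real. t ^ Suc (Suc n)) has_real_derivative real (Suc (Suc n)) * (max 0 t) ^ Suc n) (at t)"
      using 3 by (auto intro!: derivative_eq_intros simp del: power_Suc)
    then show ?thesis
      by (rule has_field_derivative_transform_within_open[where S="{0<..}"]) (use 3 in auto)
  qed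
qed

text \<open>The square of the positive part of \<open>(x - 1) (2 - x)\<close>; an explicit antiderivative gives its
  integral \<open>1/30\<close>.\<close>
lemma C1_bump:
  obtains \<phi> \<phi>' :: "real \<Rightarrow> complex" where "\<And>x. (\<phi> has_vector_derivative \<phi>' x) (at x)" "continuous_on UNIV \<phi>'"
    "\<And>x. x \<notin> {1..2} \<Longrightarrow> \<phi> x = 0" "\<And>x. x \<notin> {1..2} \<Longrightarrow> \<phi>' x = 0" "integral {1..2} \<phi> \<noteq> 0"
proof
  define q where "q x = (x - 1) * (2 - x)" for x :: real
  define p where "p x = (max 0 (q x)) ^ Suc (Suc 0)" for x :: real
  define p' where "p' x = 2 * max 0 (q x) * (3 - 2 * x)" for x :: real
  have q0: "max 0 (q x) = 0" if "x \<notin> {1..2}" for x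
  proof -
    have "q x \<le> 0" using that unfolding q_def by (cases "x < 1") (auto intro: mult_nonpos_nonneg mult_nonneg_nonpos)
    then show ?thesis by simp
  qed
  have qd: "(q has_real_derivative (3 - 2 * x)) (at x)" for x
    unfolding q_def by (auto intro!: derivative_eq_intros)
  have "(p has_real_derivative p' x) (at x)" for x
    using DERIV_chain[OF deriv_max_power[of 0 "q x"] qd[of x]] unfolding p_def p'_def o_def
    by (simp add: numeral_2_eq_2)
  then show "((\<lambda>x. complex_of_real (p x)) has_vector_derivative complex_of_real (p' x)) (at x)" for x
    by (intro bounded_linear.has_vector_derivative[OF bounded_linear_of_real])
      (simp add: has_real_derivative_iff_has_vector_derivative)
  show "continuous_on UNIV (\<lambda>x. complex_of_real (p' x))"
    unfolding p'_def q_def by (intro continuous_intros)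
  show "complex_of_real (p x) = 0" "complex_of_real (p' x) = 0" if "x \<notin> {1..2}" for x
    using q0[OF that] by (simp_all add: p_def p'_def)
  define P where "P x = x^5/5 - 3*x^4/2 + 13*x^3/3 - 6*x^2 + 4*x" for x :: real
  have "(p has_integral P 2 - P 1) {1..2}"
  proof (rule fundamental_theorem_of_calculus)
    fix x :: real assume x: "x \<in> {1..2}"
    have "max 0 (q x) = q x" using x by (simp add: q_def)
    then have "p x = x^4 - 6*x^3 + 13*x^2 - 12*x + 4"
      unfolding p_def q_def by (simp add: power2_eq_square power3_eq_cube power4_eq_xxxx algebra_simps)
    moreover have "(P has_real_derivative x^4 - 6*x^3 + 13*x^2 - 12*x + 4) (at x within {1..2})"
      unfolding P_def by (auto intro!: derivative_eq_intros)
    ultimately show "(P has_vector_derivative p x) (at x within {1..2})"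
      by (simp add: has_real_derivative_iff_has_vector_derivative)
  qed simp
  from has_integral_linear[OF this bounded_linear_of_real[where 'a=complex]]
  show "integral {1..2} (\<lambda>x. complex_of_real (p x)) \<noteq> 0"
    by (simp add: o_def integral_unique P_def)
qed

lemma integrable_mult_compact:
  fixes q \<phi> :: "real \<Rightarrow> complex"
  assumes "0 < a" "q absolutely_integrable_on {a..b}" "continuous_on {0<..} \<phi>"
    "\<And>x. 0 < x \<Longrightarrow> x \<notin> {a..b} \<Longrightarrow> \<phi> x = 0"
  shows "integrable half_line (\<lambda>x. q x * \<phi> x)"
  by (rule integrable_half_line_compact[OF assms(1) absolutely_integrable_mult_continuous(2)[OF continuous_on_subset[OF assms(3)] assms(2)]])
    (use assms(1,4) in auto)

text \<open>Reduction to the first order. For a test function \<open>\<phi>\<close> with integral \<open>c\<close> and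
  a bump \<open>\<phi>0\<close> with integral \<open>c0 \<noteq> 0\<close>, the function \<open>c0 \<phi> - c
  \<phi>0\<close> is the derivative of a test function, and testing with the latter shows that \<open>y\<close> has the
  weak derivative \<open>M - \<kappa> / c0\<close>, where \<open>M\<close> is a primitive of \<open>m\<close>.\<close>
lemma weak_second_derivative_imp_primitive:
  fixes y m :: "real \<Rightarrow> complex"
  assumes y: "\<And>a b. 0 < a \<Longrightarrow> y absolutely_integrable_on {a..b}"
    and m: "\<And>a b. 0 < a \<Longrightarrow> m absolutely_integrable_on {a..b}"
    and w: "\<And>f f' f''. C1_deriv_on {0<..} f f' \<Longrightarrow> C1_deriv_on {0<..} f' f'' \<Longrightarrow> compact_support_in {0<..} f \<Longrightarrow>
       (LINT x|half_line. y x * f'' x) = (LINT x|half_line. m x * f x)"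
  obtains Y Y' where "AE x in half_line. y x = Y x" "\<And>x. 0 < x \<Longrightarrow> (Y has_vector_derivative Y' x) (at x)" "primitive Y' m"
proof -
  obtain M where M: "primitive M m" using primitive_exists m by blast
  have Mi: "M absolutely_integrable_on {a..b}" if "0 < a" for a b
    by (rule absolutely_integrable_continuous_real[OF continuous_on_subset[OF primitive_continuous_on[OF M]]]) (use that in auto)
  obtain \<phi>0 \<phi>0' :: "real \<Rightarrow> complex" where b0: "\<And>x. (\<phi>0 has_vector_derivative \<phi>0' x) (at x)" "continuous_on UNIV \<phi>0'"
    "\<And>x. x \<notin> {1..2} \<Longrightarrow> \<phi>0 x = 0" "\<And>x. x \<notin> {1..2} \<Longrightarrow> \<phi>0' x = 0" "integral {1..2} \<phi>0 \<noteq> 0"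
    using C1_bump by blast
  define c0 where "c0 = (LINT x|half_line. \<phi>0 x)"
  have b0c: "continuous_on S \<phi>0" for S 
    by (rule continuous_on_subset[OF continuous_at_imp_continuous_on[of UNIV]])
      (use has_vector_derivative_continuous[OF b0(1)] in auto)
  have b0c': "continuous_on S \<phi>0'" for S by (rule continuous_on_subset[OF b0(2)]) simp
  have c0: "integrable half_line \<phi>0" "c0 = integral {1..2} \<phi>0"
  proof -
    have "x \<notin> {1..2} \<Longrightarrow> \<phi>0 x = 0" for x by (rule b0(3))
    note * = integrable_half_line_compact[OF zero_less_one absolutely_integrable_continuous_real[OF b0c] this]
    show "integrable half_line \<phi>0" by (rule *(1))
    show "c0 = integral {1..2} \<phi>0" unfolding c0_def by (rule *(2))
  qed
  have c0n: "c0 \<noteq> 0" using c0 b0(5) by simp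
  define \<kappa> where "\<kappa> = (LINT x|half_line. y x * \<phi>0' x) + (LINT x|half_line. M x * \<phi>0 x)"
  have "\<exists>Y. (AE x in half_line. y x = Y x) \<and> primitive Y (\<lambda>x. M x - \<kappa> / c0)"
  proof (rule weak_derivative_imp_primitive[of y "\<lambda>x. M x - \<kappa> / c0"])
    show "y absolutely_integrable_on {a..b}" if "0 < a" for a b by (rule y[OF that])
    show "(\<lambda>x. M x - \<kappa> / c0) absolutely_integrable_on {a..b}" if "0 < a" for a b
      by (intro set_integral_diff Mi that) simp
    fix \<phi> \<phi>' :: "real \<Rightarrow> complex"
    assume C: "C1_deriv_on {0<..} \<phi> \<phi>'" and S: "compact_support_in {0<..} \<phi>"
    obtain a b where ab: "0 < a" "a < b" "\<And>x. 0 < x \<Longrightarrow> x \<notin> {a..b} \<Longrightarrow> \<phi> x = 0"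
      using compact_support_interval[OF S] by blast
    have d: "\<And>x. 0 < x \<Longrightarrow> (\<phi> has_vector_derivative \<phi>' x) (at x)" and c': "continuous_on {0<..} \<phi>'"
      using C unfolding C1_deriv_on_open_iff by auto
    have ab': "\<phi>' x = 0" if "0 < x" "x \<notin> {a..b}" for x
      by (rule vanishing_derivative[OF d ab(3) that])
    have cc: "continuous_on {0<..} \<phi>" by (rule has_vector_derivative_imp_continuous_on[OF d])
    define \<alpha> \<beta> where "\<alpha> = min a 1" and "\<beta> = max b 2"
    have \<alpha>\<beta>: "0 < \<alpha>" "\<alpha> \<le> \<beta>" using ab by (auto simp: \<alpha>_def \<beta>_def)
    have out: "x \<notin> {a..b}" "x \<notin> {1..2}" if "x \<notin> {\<alpha>..\<beta>}" for x using that by (auto simp: \<alpha>_def \<beta>_def)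
    have z: "\<phi> x = 0" "\<phi>' x = 0" "\<phi>0 x = 0" "\<phi>0' x = 0" if "0 < x" "x \<notin> {\<alpha>..\<beta>}" for x
      using out[OF that(2)] ab ab' b0 that(1) by blast+
    have cl: "continuous_on {\<alpha>..\<beta>} \<phi>" by (rule continuous_on_subset[OF cc]) (use \<alpha>\<beta> in auto)
    have \<phi>i: "integrable half_line \<phi>" "(LINT x|half_line. \<phi> x) = integral {\<alpha>..\<beta>} \<phi>"
      by (rule integrable_half_line_compact[OF \<alpha>\<beta>(1) absolutely_integrable_continuous_real[OF cl] z(1)]; assumption)+
    have c0i: "c0 = integral {\<alpha>..\<beta>} \<phi>0"
      unfolding c0_def by (rule integrable_half_line_compact(2)[OF \<alpha>\<beta>(1) absolutely_integrable_continuous_real[OF b0c] z(3)])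
    define c where "c = (LINT x|half_line. \<phi> x)"
    define k where "k x = c0 * \<phi> x - c * \<phi>0 x" for x
    define k' where "k' x = c0 * \<phi>' x - c * \<phi>0' x" for x
    define f where "f x = integral {\<alpha>/2..x} k" for x
    have kc: "continuous_on {0<..} k" unfolding k_def by (intro continuous_intros cc b0c)
    have kz: "k x = 0" if "0 < x" "x \<notin> {\<alpha>..\<beta>}" for x using z[OF that] by (simp add: k_def)
    have "integral {\<alpha>..\<beta>} k = c0 * integral {\<alpha>..\<beta>} \<phi> - c * integral {\<alpha>..\<beta>} \<phi>0"
      unfolding k_def using integrable_continuous_real[OF cl] integrable_continuous_real[OF b0c]
      by (subst integral_diff) (simp_all add: integrable_on_mult_right)
    then have ki: "integral {\<alpha>..\<beta>} k = 0" using \<phi>i(2) c0i by (simp add: c_def)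
    note fC = continuous_compact_antiderivative[OF kc \<alpha>\<beta> kz ki, folded f_def]
    have fd: "\<And>x. 0 < x \<Longrightarrow> (f has_vector_derivative k x) (at x)" using fC(1) unfolding C1_deriv_on_open_iff by blast
    have kC: "C1_deriv_on {0<..} k k'"
      unfolding C1_deriv_on_open_iff k_def k'_def
      by (intro conjI allI impI has_vector_derivative_diff has_vector_derivative_mult_right d b0(1) continuous_intros c' b0c')
    obtain p q where pq: "0 < p" "p < q" "\<And>x. 0 < x \<Longrightarrow> x \<notin> {p..q} \<Longrightarrow> f x = 0"
      using compact_support_interval[OF fC(2)] by blast
    have kz': "k x = 0" if "0 < x" "x \<notin> {p..q}" for x
      by (rule vanishing_derivative[OF fd pq(3) that])
    have i1: "integrable half_line (\<lambda>x. M x * k x)"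
      by (rule integrable_mult_compact[OF pq(1) Mi[OF pq(1)] kc kz'])
    have i2: "integrable half_line (\<lambda>x. m x * f x)"
      by (rule integrable_mult_compact[OF pq(1) m[OF pq(1)] has_vector_derivative_imp_continuous_on[OF fd] pq(3)])
    have "(LINT x|half_line. M x * k x + m x * f x) = 0"
      by (rule primitive_compact_support_integral[OF primitive_mult[OF M primitive_of_C1[OF fd kc]] _ pq(1), where b="q + 1"])
        (use pq i1 i2 in auto)
    then have e1: "(LINT x|half_line. m x * f x) = - (LINT x|half_line. M x * k x)"
      using i1 i2 by (simp add: add_eq_0_iff)
    have j: "integrable half_line (\<lambda>x. y x * \<phi>' x)" "integrable half_line (\<lambda>x. y x * \<phi>0' x)"
      "integrable half_line (\<lambda>x. M x * \<phi> x)" "integrable half_line (\<lambda>x. M x * \<phi>0 x)"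
      using integrable_mult_compact[OF \<alpha>\<beta>(1) y[OF \<alpha>\<beta>(1)] c' z(2)]
        integrable_mult_compact[OF \<alpha>\<beta>(1) y[OF \<alpha>\<beta>(1)] b0c' z(4)]
        integrable_mult_compact[OF \<alpha>\<beta>(1) Mi[OF \<alpha>\<beta>(1)] cc z(1)]
        integrable_mult_compact[OF \<alpha>\<beta>(1) Mi[OF \<alpha>\<beta>(1)] b0c z(3)] by simp_all
    have e2: "(LINT x|half_line. y x * k' x) = c0 * (LINT x|half_line. y x * \<phi>' x) - c * (LINT x|half_line. y x * \<phi>0' x)"
    proof -
      have "(\<lambda>x. y x * k' x) = (\<lambda>x. c0 * (y x * \<phi>' x) - c * (y x * \<phi>0' x))" by (auto simp: k'_def algebra_simps)
      then show ?thesis using j by simp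
    qed
    have e3: "(LINT x|half_line. M x * k x) = c0 * (LINT x|half_line. M x * \<phi> x) - c * (LINT x|half_line. M x * \<phi>0 x)"
    proof -
      have "(\<lambda>x. M x * k x) = (\<lambda>x. c0 * (M x * \<phi> x) - c * (M x * \<phi>0 x))" by (auto simp: k_def algebra_simps)
      then show ?thesis using j by simp
    qed
    have "c0 * (LINT x|half_line. y x * \<phi>' x) - c * (LINT x|half_line. y x * \<phi>0' x)
        = - (c0 * (LINT x|half_line. M x * \<phi> x) - c * (LINT x|half_line. M x * \<phi>0 x))"
      using w[OF fC(1) kC fC(2)] e1 e2 e3 by simp
    then have "c0 * (LINT x|half_line. y x * \<phi>' x) = c * \<kappa> - c0 * (LINT x|half_line. M x * \<phi> x)"
      unfolding \<kappa>_def by (simp add: algebra_simps)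
    then have "(LINT x|half_line. y x * \<phi>' x) = (\<kappa> / c0) * c - (LINT x|half_line. M x * \<phi> x)"
      using c0n by (simp add: field_simps)
    moreover have "(LINT x|half_line. (M x - \<kappa> / c0) * \<phi> x) = (LINT x|half_line. M x * \<phi> x) - (\<kappa> / c0) * c"
      using j(3) \<phi>i(1) unfolding c_def by (simp add: left_diff_distrib)
    ultimately show "(LINT x|half_line. y x * \<phi>' x) = - (LINT x|half_line. (M x - \<kappa> / c0) * \<phi> x)"
      by simp
  qed blast
  then obtain Y where Y: "AE x in half_line. y x = Y x" "primitive Y (\<lambda>x. M x - \<kappa> / c0)" by blast
  have P: "primitive (\<lambda>x. M x - \<kappa> / c0) m"
    using primitive_diff[OF M primitive_const[of "\<kappa> / c0"]] by simp
  show thesis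
    by (rule that[OF Y(1) primitive_continuous_derivative[OF Y(2) primitive_continuous_on[OF P]] P])
qed

section \<open>The maximal operator and Green's formula\<close>

lemma bessel_max_iff:
  "(u, v) \<in> bessel_max \<nu> \<longleftrightarrow> (\<exists>f f' g. square_integrable f \<and> square_integrable g \<and>
     u = L2_class f \<and> v = L2_class g \<and> bessel_pair \<nu> f f' g)"
proof
  assume "(u, v) \<in> bessel_max \<nu>"
  then obtain f g where *: "square_integrable f" "square_integrable g" "u = L2_class f" "v = L2_class g" "bessel_expr \<nu> f g"
    unfolding bessel_max_def by blast
  then obtain f' where "bessel_pair \<nu> f f' g" using bessel_expr_iff by blast
  with * show "\<exists>f f' g. square_integrable f \<and> square_integrable g \<and>
     u = L2_class f \<and> v = L2_class g \<and> bessel_pair \<nu> f f' g" by blast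
next
  assume "\<exists>f f' g. square_integrable f \<and> square_integrable g \<and>
     u = L2_class f \<and> v = L2_class g \<and> bessel_pair \<nu> f f' g"
  then obtain f f' g where *: "square_integrable f" "square_integrable g" "u = L2_class f" "v = L2_class g" "bessel_pair \<nu> f f' g"
    by blast
  then have "bessel_expr \<nu> f g" using bessel_expr_iff by blast
  with * show "(u, v) \<in> bessel_max \<nu>" unfolding bessel_max_def by blast
qed

lemma bessel_max_cases:
  assumes "(u, v) \<in> bessel_max \<nu>"
  obtains f f' g where "square_integrable f" "square_integrable g" "u = L2_class f" "v = L2_class g"
    "bessel_pair \<nu> f f' g"
  using assms unfolding bessel_max_iff by blast

lemma bessel_maxI:
  "square_integrable f \<Longrightarrow> square_integrable g \<Longrightarrow> bessel_pair \<nu> f f' g \<Longrightarrow>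
     (L2_class f, L2_class g) \<in> bessel_max \<nu>"
  unfolding bessel_max_iff by blast

lemma bessel_max_add:
  assumes "(u1, v1) \<in> bessel_max \<nu>" "(u2, v2) \<in> bessel_max \<nu>"
  shows "(u1 + u2, v1 + v2) \<in> bessel_max \<nu>"
proof -
  obtain f f' g where 1: "square_integrable f" "square_integrable g" "u1 = L2_class f" "v1 = L2_class g"
    "bessel_pair \<nu> f f' g" using bessel_max_cases[OF assms(1)] by blast
  obtain h h' k where 2: "square_integrable h" "square_integrable k" "u2 = L2_class h" "v2 = L2_class k"
    "bessel_pair \<nu> h h' k" using bessel_max_cases[OF assms(2)] by blast
  show ?thesis
    using bessel_maxI[OF square_integrable_add[OF 1(1) 2(1)] square_integrable_add[OF 1(2) 2(2)] bessel_pair_add[OF 1(5) 2(5)]]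
    by (simp add: 1 2 L2_class_ops)
qed

lemma bessel_max_scale:
  assumes "(u, v) \<in> bessel_max \<nu>" shows "(cscale c u, cscale c v) \<in> bessel_max \<nu>"
proof -
  obtain f f' g where 1: "square_integrable f" "square_integrable g" "u = L2_class f" "v = L2_class g"
    "bessel_pair \<nu> f f' g" using bessel_max_cases[OF assms] by blast
  show ?thesis
    using bessel_maxI[OF square_integrable_scale[OF 1(1)] square_integrable_scale[OF 1(2)] bessel_pair_scale[OF 1(5)]]
    by (simp add: 1 L2_class_ops)
qed

lemma bessel_max_unique:
  assumes "(u, v1) \<in> bessel_max \<nu>" "(u, v2) \<in> bessel_max \<nu>"
  shows "v1 = v2"
proof -
  obtain f f' g where 1: "square_integrable f" "square_integrable g" "u = L2_class f" "v1 = L2_class g"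
    "bessel_pair \<nu> f f' g" using bessel_max_cases[OF assms(1)] by blast
  obtain h h' k where 2: "square_integrable h" "square_integrable k" "u = L2_class h" "v2 = L2_class k"
    "bessel_pair \<nu> h h' k" using bessel_max_cases[OF assms(2)] by blast
  have "AE x in half_line. f x = h x" using 1 2 L2_class_eq_iff by metis
  from bessel_pair_AE_unique(2)[OF 1(5) 2(5) this] show ?thesis
    using 1 2 L2_class_eq_iff by metis
qed

text \<open>The operator whose closure is the minimal operator.\<close>
definition bessel_pre :: "real \<Rightarrow> L2_operator" where
  "bessel_pre \<nu> = {(u, v) \<in> bessel_max \<nu>.
     \<exists>f. square_integrable f \<and> u = L2_class f \<and> compact_support_in {0<..} f}"

lemma bessel_min_eq: "bessel_min \<nu> = closure (bessel_pre \<nu>)"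
  unfolding bessel_min_def bessel_pre_def ..

text \<open>The representative with compact support and the one that satisfies the differential equation may differ on
  a null set; being continuous, the latter has compact support too.\<close>
lemma bessel_pre_cases:
  assumes "(u, v) \<in> bessel_pre \<nu>"
  obtains f f' g a b where "square_integrable f" "square_integrable g" "u = L2_class f" "v = L2_class g"
    "bessel_pair \<nu> f f' g" "0 < a" "a < b" "\<And>x. 0 < x \<Longrightarrow> x \<notin> {a..b} \<Longrightarrow> f x = 0 \<and> f' x = 0"
proof -
  obtain h where h: "square_integrable h" "u = L2_class h" "compact_support_in {0<..} h"
    and m: "(u, v) \<in> bessel_max \<nu>"
    using assms unfolding bessel_pre_def by blast
  obtain f f' g where 1: "square_integrable f" "square_integrable g" "u = L2_class f" "v = L2_class g"
    "bessel_pair \<nu> f f' g" using bessel_max_cases[OF m] by blast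
  obtain a b where ab: "0 < a" "a < b" "\<And>x. 0 < x \<Longrightarrow> x \<notin> {a..b} \<Longrightarrow> h x = 0"
    using compact_support_interval[OF h(3)] by blast
  \<comment> \<open>the distance to \<open>[a, b]\<close>: a continuous factor that makes \<open>f\<close> vanish almost everywhere, hence everywhere\<close>
  define d where "d x = complex_of_real (max 0 (max (a - x) (x - b)))" for x
  have ae: "AE x in half_line. f x = h x" using 1 h L2_class_eq_iff by metis
  have "AE x in half_line. 0 < x" by (rule AE_half_line_I)
  with ae have "AE x in half_line. f x * d x = 0"
  proof eventually_elim
    case (elim x)
    then show ?case using ab(3)[of x] by (cases "x \<in> {a..b}") (auto simp: d_def)
  qed
  then have fd: "f x * d x = 0" if "0 < x" for x
    by (rule AE_half_line_continuous_eq[rotated 2])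
      (auto simp: d_def that intro!: continuous_intros bessel_pair_continuous(1)[OF 1(5)])
  have f0: "f x = 0" if "0 < x" "x \<notin> {a..b}" for x
    using fd[OF that(1)] that(2) by (auto simp: d_def max_def split: if_splits)
  have "f' x = 0" if "0 < x" "x \<notin> {a..b}" for x
    by (rule vanishing_derivative[OF _ f0 that]) (use 1(5) in \<open>auto simp: bessel_pair_def\<close>)
  with f0 show thesis by (intro that[OF 1 ab(1,2)]) auto
qed

lemma bessel_preI:
  assumes "square_integrable f" "square_integrable g" "bessel_pair \<nu> f f' g"
    "0 < a" "\<And>x. 0 < x \<Longrightarrow> x \<notin> {a..b} \<Longrightarrow> f x = 0"
  shows "(L2_class f, L2_class g) \<in> bessel_pre \<nu>"
proof -
  have "compact_support_in {0<..} f"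
    unfolding compact_support_in_def using assms(4,5) by (intro exI[of _ "{a..b}"]) auto
  with bessel_maxI[OF assms(1-3)] assms(1) show ?thesis unfolding bessel_pre_def by blast
qed

text \<open>Lagrange's identity, integrated. The Wronskian has compact support in the open half-line, so there are no
  boundary terms.\<close>
lemma bessel_green:
  assumes "(u, v) \<in> bessel_pre \<nu>" "(h, k) \<in> bessel_max \<nu>"
  shows "cinner v h = cinner u k"
proof -
  obtain f f' g a b where 1: "square_integrable f" "square_integrable g" "u = L2_class f" "v = L2_class g"
    "bessel_pair \<nu> f f' g" and a: "0 < a" "a < b" and ab: "\<And>x. 0 < x \<Longrightarrow> x \<notin> {a..b} \<Longrightarrow> f x = 0 \<and> f' x = 0"
    using bessel_pre_cases[OF assms(1)] by metis
  obtain p p' q where 2: "square_integrable p" "square_integrable q" "h = L2_class p" "k = L2_class q"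
    "bessel_pair \<nu> p p' q" using bessel_max_cases[OF assms(2)] by blast
  have i: "integrable half_line (\<lambda>x. g x * cnj (p x))" "integrable half_line (\<lambda>x. f x * cnj (q x))"
    using 1 2 by (auto intro: integrable_mult_cnj)
  have "(LINT x|half_line. g x * cnj (p x) - f x * cnj (q x)) = 0"
    by (rule primitive_compact_support_integral[OF wronskian_primitive[OF 1(5) bessel_pair_cnj[OF 2(5)]] _ a(1), where b="b + 1"])
      (use i a ab in auto)
  then show ?thesis using i by (simp add: 1 2 L2_class_ops)
qed

section \<open>The adjoint of the minimal operator\<close>

lemma cinner_commute: "cinner u v = cnj (cinner v u)"
  by transfer (simp add: mult.commute flip: Bochner_Integration.integral_cnj)

lemma cinner_add_left: "cinner (u + v) w = cinner u w + cinner v w"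
  by transfer (simp add: L2_eq_def ring_distribs integrable_mult_cnj)

lemma cinner_scale_left: "cinner (cscale c u) v = c * cinner u v"
  by transfer (simp add: mult.assoc)

lemma cinner_scale_right: "cinner u (cscale c v) = cnj c * cinner u v"
  by (subst (1 2) cinner_commute) (simp add: cinner_scale_left)

lemma Re_cinner: "Re (cinner u v) = inner u v"
  by transfer simp

text \<open>Transfers continuity from the real inner product to the complex one.\<close>
lemma cinner_eq_inner: "cinner u v = complex_of_real (inner u v) + \<i> * complex_of_real (inner u (cscale \<i> v))"
  by (rule complex_eqI) (simp_all add: cinner_scale_right flip: Re_cinner)

lemma cinner_self_eq_0: "cinner u u = 0 \<Longrightarrow> u = 0"
  using Re_cinner[of u u] by simp

lemma continuous_on_cinner_left [continuous_intros]:
  "continuous_on S f \<Longrightarrow> continuous_on S (\<lambda>x. cinner (f x) v)"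
  unfolding cinner_eq_inner by (intro continuous_intros)

lemma continuous_on_cinner_right [continuous_intros]:
  "continuous_on S f \<Longrightarrow> continuous_on S (\<lambda>x. cinner v (f x))"
  by (subst cinner_commute) (intro continuous_intros)

lemma adjoint_op_closed: "closed (adjoint_op A)"
proof -
  have "adjoint_op A = (\<Inter>p\<in>A. {q. cinner (snd p) (fst q) = cinner (fst p) (snd q)})"
    unfolding adjoint_op_def by force
  also have "closed \<dots>" by (intro closed_INT ballI closed_Collect_eq continuous_intros)
  finally show ?thesis .
qed

lemma adjoint_op_closure: "adjoint_op (closure A) = adjoint_op A"
proof
  show "adjoint_op (closure A) \<subseteq> adjoint_op A"
    unfolding adjoint_op_def using closure_subset[of A] by blast
  show "adjoint_op A \<subseteq> adjoint_op (closure A)"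
  proof (rule subsetI)
    fix q assume q: "q \<in> adjoint_op A"
    have "closed {p. cinner (snd p) (fst q) = cinner (fst p) (snd q)}"
      by (intro closed_Collect_eq continuous_intros)
    moreover have "A \<subseteq> {p. cinner (snd p) (fst q) = cinner (fst p) (snd q)}"
      using q unfolding adjoint_op_def by auto
    ultimately have "closure A \<subseteq> {p. cinner (snd p) (fst q) = cinner (fst p) (snd q)}"
      by (rule closure_minimal[rotated])
    then show "q \<in> adjoint_op (closure A)" unfolding adjoint_op_def by auto
  qed
qed

lemma continuous_compact_square_integrable:
  fixes f :: "real \<Rightarrow> complex"
  assumes "0 < a" and c: "continuous_on {0<..} f" and z: "\<And>x. 0 < x \<Longrightarrow> x \<notin> {a..b} \<Longrightarrow> f x = 0"
  shows "square_integrable f"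
proof -
  have "continuous_on {a..b} (\<lambda>x. (cmod (f x))\<^sup>2)"
    by (intro continuous_intros continuous_on_subset[OF c]) (use assms(1) in auto)
  then have "integrable half_line (\<lambda>x. (cmod (f x))\<^sup>2)"
  proof (rule integrable_half_line_compact(1)[OF assms(1) absolutely_integrable_continuous_real])
    show "(cmod (f x))\<^sup>2 = 0" if "0 < x" "x \<notin> {a..b}" for x using z[OF that] by simp
  qed
  with continuous_imp_half_line_measurable[OF c] show ?thesis by (simp add: square_integrable_def)
qed

lemma square_integrable_cong_AE:
  assumes f: "square_integrable f" and ae: "AE x in half_line. f x = g x" and g: "g \<in> borel_measurable half_line"
  shows "square_integrable g"
  by (rule square_integrable_bound[OF g f, where C=1]) (use ae in eventually_elim, simp)

lemma square_integrable_locally_integrable: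
  "square_integrable f \<Longrightarrow> 0 < a \<Longrightarrow> f absolutely_integrable_on {a..b}"
  by (rule set_integrable_subset[OF square_integrable_absolutely_integrable[of f b]]) auto

text \<open>Membership of \<open>(v, w)\<close> in the adjoint says that \<open>- v'' + V v = w\<close> holds when
  tested against compactly supported functions of class \<open>C\<^sup>2\<close>; weak solutions are solutions.\<close>
lemma adjoint_bessel_pre_subset_max: "adjoint_op (bessel_pre \<nu>) \<subseteq> bessel_max \<nu>"
proof (rule subsetI, clarify)
  fix v w assume vw: "(v, w) \<in> adjoint_op (bessel_pre \<nu>)"
  let ?V = "\<lambda>x. complex_of_real (bessel_V \<nu> x)"
  define y where "y x = cnj (L2_rep v x)" for x
  define z where "z x = cnj (L2_rep w x)" for x
  have ysq: "square_integrable y" unfolding y_def by (intro square_integrable_cnj square_integrable_L2_rep)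
  have zsq: "square_integrable z" unfolding z_def by (intro square_integrable_cnj square_integrable_L2_rep)
  have yi: "y absolutely_integrable_on {a..b}" if "0 < a" for a b by (rule square_integrable_locally_integrable[OF ysq that])
  have Vy: "(\<lambda>x. ?V x * y x) absolutely_integrable_on {a..b}" if "0 < a" for a b
    by (rule absolutely_integrable_mult_continuous(1)[OF _ yi[OF that]], intro continuous_on_of_real continuous_on_subset[OF continuous_on_bessel_V])
      (use that in auto)
  have mi: "(\<lambda>x. ?V x * y x - z x) absolutely_integrable_on {a..b}" if "0 < a" for a b
    by (intro set_integral_diff Vy square_integrable_locally_integrable[OF zsq] that)
  obtain Y Y' where Y: "AE x in half_line. y x = Y x" "\<And>x. 0 < x \<Longrightarrow> (Y has_vector_derivative Y' x) (at x)"
    "primitive Y' (\<lambda>x. ?V x * y x - z x)"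
  proof (rule weak_second_derivative_imp_primitive[OF yi mi])
    fix f f' f'' :: "real \<Rightarrow> complex"
    assume 1: "C1_deriv_on {0<..} f f'" and 2: "C1_deriv_on {0<..} f' f''" and S: "compact_support_in {0<..} f"
    obtain a b where ab: "0 < a" "a < b" "\<And>x. 0 < x \<Longrightarrow> x \<notin> {a..b} \<Longrightarrow> f x = 0"
      using compact_support_interval[OF S] by blast
    have d: "\<And>x. 0 < x \<Longrightarrow> (f has_vector_derivative f' x) (at x)" "\<And>x. 0 < x \<Longrightarrow> (f' has_vector_derivative f'' x) (at x)"
      and c: "continuous_on {0<..} f''"
      using 1 2 unfolding C1_deriv_on_open_iff by auto
    have c0: "continuous_on {0<..} f" by (rule has_vector_derivative_imp_continuous_on[OF d(1)])
    have z1: "f' x = 0" if "0 < x" "x \<notin> {a..b}" for x by (rule vanishing_derivative[OF d(1) ab(3) that])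
    have z2: "f'' x = 0" if "0 < x" "x \<notin> {a..b}" for x by (rule vanishing_derivative[OF d(2) z1 that])
    define g where "g x = ?V x * f x - f'' x" for x
    have gc: "continuous_on {0<..} g"
      unfolding g_def by (intro continuous_intros continuous_on_bessel_V c c0)
    have gz: "g x = 0" if "0 < x" "x \<notin> {a..b}" for x using ab(3)[OF that] z2[OF that] by (simp add: g_def)
    have fsq: "square_integrable f" by (rule continuous_compact_square_integrable[OF ab(1) c0 ab(3)])
    have gsq: "square_integrable g" by (rule continuous_compact_square_integrable[OF ab(1) gc gz])
    have "bessel_pair \<nu> f f' g"
      unfolding bessel_pair_def g_def using d primitive_of_C1[OF d(2) c] by simp
    from bessel_preI[OF fsq gsq this ab(1,3)]
    have "cinner (L2_class g) v = cinner (L2_class f) w"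
      using vw unfolding adjoint_op_def by blast
    then have "cinner (L2_class g) (L2_class (L2_rep v)) = cinner (L2_class f) (L2_class (L2_rep w))"
      by simp
    then have e: "(LINT x|half_line. g x * y x) = (LINT x|half_line. f x * z x)"
      using fsq gsq by (simp add: L2_class_ops(1) y_def z_def del: L2_class_rep)
    have i1: "integrable half_line (\<lambda>x. y x * f'' x)"
      by (rule integrable_mult_compact[OF ab(1) yi[OF ab(1)] c z2])
    have i2: "integrable half_line (\<lambda>x. (?V x * y x) * f x)"
      by (rule integrable_mult_compact[OF ab(1) Vy[OF ab(1)] c0 ab(3)])
    have i3: "integrable half_line (\<lambda>x. f x * z x)" by (rule integrable_mult_square_integrable[OF fsq zsq])
    have "(\<lambda>x. g x * y x) = (\<lambda>x. (?V x * y x) * f x - y x * f'' x)" by (auto simp: g_def algebra_simps)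
    then have "(LINT x|half_line. (?V x * y x) * f x) - (LINT x|half_line. y x * f'' x) = (LINT x|half_line. f x * z x)"
      using e i1 i2 by simp
    moreover have "(\<lambda>x. (?V x * y x - z x) * f x) = (\<lambda>x. (?V x * y x) * f x - f x * z x)" by (auto simp: algebra_simps)
    then have "(LINT x|half_line. (?V x * y x - z x) * f x) = (LINT x|half_line. (?V x * y x) * f x) - (LINT x|half_line. f x * z x)"
      using i2 i3 by simp
    ultimately show "(LINT x|half_line. y x * f'' x) = (LINT x|half_line. (?V x * y x - z x) * f x)"
      by (simp add: algebra_simps)
  qed (assumption, assumption, blast)
  have "AE x in half_line. ?V x * y x - z x = ?V x * Y x - z x" using Y(1) by eventually_elim simp
  from primitive_cong_AE[OF Y(3) this] have "bessel_pair \<nu> Y Y' z" 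
    using Y(2) unfolding bessel_pair_def by simp
  then have P: "bessel_pair \<nu> (\<lambda>x. cnj (Y x)) (\<lambda>x. cnj (Y' x)) (\<lambda>x. cnj (z x))" by (rule bessel_pair_cnj)
  have "Y \<in> borel_measurable half_line"
    by (rule continuous_imp_half_line_measurable[OF has_vector_derivative_imp_continuous_on[OF Y(2)]])
  then have "square_integrable Y" using square_integrable_cong_AE[OF ysq Y(1)] by blast
  then have Ysq: "square_integrable (\<lambda>x. cnj (Y x))" by (rule square_integrable_cnj)
  have "L2_class (\<lambda>x. cnj (Y x)) = L2_class (L2_rep v)"
    unfolding L2_class_eq_iff[OF Ysq square_integrable_L2_rep]
    using Y(1) by eventually_elim (simp add: y_def, metis complex_cnj_cnj)
  moreover have "(\<lambda>x. cnj (z x)) = L2_rep w" by (simp add: z_def)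
  ultimately show "(v, w) \<in> bessel_max \<nu>"
    using bessel_maxI[OF Ysq square_integrable_cnj[OF zsq] P] by simp
qed

lemma adjoint_bessel_min: "adjoint_op (bessel_min \<nu>) = bessel_max \<nu>"
proof -
  have "bessel_max \<nu> \<subseteq> adjoint_op (bessel_pre \<nu>)"
    unfolding adjoint_op_def using bessel_green by blast
  then show ?thesis
    using adjoint_bessel_pre_subset_max unfolding bessel_min_eq adjoint_op_closure by blast
qed

lemma bessel_min_subset_max: "bessel_min \<nu> \<subseteq> bessel_max \<nu>"
  unfolding bessel_min_eq
proof (rule closure_minimal)
  show "bessel_pre \<nu> \<subseteq> bessel_max \<nu>" unfolding bessel_pre_def by blast
  show "closed (bessel_max \<nu>)" using adjoint_op_closed[of "bessel_min \<nu>"] by (simp add: adjoint_bessel_min)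
qed

lemma bessel_min_green:
  assumes "(u, v) \<in> bessel_min \<nu>" "(h, k) \<in> bessel_max \<nu>"
  shows "cinner v h = cinner u k"
  using assms unfolding adjoint_bessel_min[symmetric] adjoint_op_def by blast

lemma weak_deriv_L2_class:
  assumes F: "primitive f f'" and f: "square_integrable f" and f': "square_integrable f'"
  shows "weak_deriv (L2_class f) (L2_class f')"
  unfolding weak_deriv_def
proof (intro allI impI, elim conjE)
  fix \<phi> \<phi>' :: "real \<Rightarrow> complex"
  assume C: "C1_deriv_on {0<..} \<phi> \<phi>'" and S: "compact_support_in {0<..} \<phi>"
  obtain a b where ab: "0 < a" "a < b" "\<And>x. 0 < x \<Longrightarrow> x \<notin> {a..b} \<Longrightarrow> \<phi> x = 0"
    using compact_support_interval[OF S] by blast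
  have d: "\<And>x. 0 < x \<Longrightarrow> (\<phi> has_vector_derivative \<phi>' x) (at x)" and c': "continuous_on {0<..} \<phi>'"
    using C unfolding C1_deriv_on_open_iff by auto
  have c: "continuous_on {0<..} \<phi>" by (rule has_vector_derivative_imp_continuous_on[OF d])
  have ab': "\<phi>' x = 0" if "0 < x" "x \<notin> {a..b}" for x
    by (rule vanishing_derivative[OF d ab(3) that])
  have i1: "integrable half_line (\<lambda>x. f x * \<phi>' x)"
    by (rule integrable_mult_compact[OF ab(1) square_integrable_locally_integrable[OF f ab(1)] c' ab'])
  have i2: "integrable half_line (\<lambda>x. f' x * \<phi> x)"
    by (rule integrable_mult_compact[OF ab(1) square_integrable_locally_integrable[OF f' ab(1)] c ab(3)])
  have "(LINT x|half_line. f x * \<phi>' x + f' x * \<phi> x) = 0"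
    by (rule primitive_compact_support_integral[OF primitive_mult[OF F primitive_of_C1[OF d c']] _ ab(1), where b="b + 1"])
      (use ab i1 i2 in auto)
  then have e: "(LINT x|half_line. f x * \<phi>' x) = - (LINT x|half_line. f' x * \<phi> x)"
    using i1 i2 by (simp add: add_eq_0_iff2)
  have r: "(LINT x|half_line. L2_rep (L2_class g) x * \<psi> x) = (LINT x|half_line. g x * \<psi> x)"
    if g: "square_integrable g" and \<psi>: "continuous_on {0<..} \<psi>" for g \<psi>
  proof (rule integral_cong_AE)
    have [measurable]: "g \<in> borel_measurable half_line" "L2_rep (L2_class g) \<in> borel_measurable half_line"
      "\<psi> \<in> borel_measurable half_line"
      using g \<psi> square_integrable_L2_rep by (auto simp: square_integrable_measurable continuous_imp_half_line_measurable)
    show "(\<lambda>x. L2_rep (L2_class g) x * \<psi> x) \<in> borel_measurable half_line" by measurable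
    show "(\<lambda>x. g x * \<psi> x) \<in> borel_measurable half_line" by measurable
    show "AE x in half_line. L2_rep (L2_class g) x * \<psi> x = g x * \<psi> x"
      using L2_rep_class[OF g] by eventually_elim simp
  qed
  show "(LINT x|half_line. L2_rep (L2_class f) x * \<phi>' x) = - (LINT x|half_line. L2_rep (L2_class f') x * \<phi> x)"
    unfolding r[OF f c'] r[OF f' c] by (rule e)
qed

lemma weak_deriv_imp_primitive:
  assumes "weak_deriv u v"
  obtains f where "square_integrable f" "u = L2_class f" "primitive f (L2_rep v)"
proof -
  have l: "L2_rep w absolutely_integrable_on {a..b}" if "0 < a" for w a b
    by (rule square_integrable_locally_integrable[OF square_integrable_L2_rep that])
  obtain f where f: "AE x in half_line. L2_rep u x = f x" "primitive f (L2_rep v)"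
    by (rule weak_derivative_imp_primitive[of "L2_rep u" "L2_rep v", OF l l])
      (use assms in \<open>auto simp: weak_deriv_def\<close>)
  have sq: "square_integrable f"
    by (rule square_integrable_cong_AE[OF square_integrable_L2_rep f(1) primitive_measurable[OF f(2)]])
  have "L2_class (L2_rep u) = L2_class f"
    using L2_class_eq_iff[OF square_integrable_L2_rep sq] f(1) by blast
  then show thesis using that sq f(2) by simp
qed

text \<open>Weak derivatives become derivatives of the continuous representative.\<close>
lemma H2_iff:
  "u \<in> H2 \<longleftrightarrow> (\<exists>f f' f''. square_integrable f \<and> square_integrable f' \<and> square_integrable f'' \<and> u = L2_class f \<and>
     (\<forall>x>0. (f has_vector_derivative f' x) (at x)) \<and> primitive f' f'')"
proof
  assume "u \<in> H2"
  then obtain u1 u2 where w: "weak_deriv u u1" "weak_deriv u1 u2" unfolding H2_def by blast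
  obtain f where f: "square_integrable f" "u = L2_class f" "primitive f (L2_rep u1)"
    using weak_deriv_imp_primitive[OF w(1)] by blast
  obtain f' where f': "square_integrable f'" "u1 = L2_class f'" "primitive f' (L2_rep u2)"
    using weak_deriv_imp_primitive[OF w(2)] by blast
  have "AE x in half_line. L2_rep u1 x = f' x" using L2_rep_class[OF f'(1)] f'(2) by simp
  then have "primitive f f'" by (rule primitive_cong_AE[OF f(3)]) simp
  then have "\<forall>x>0. (f has_vector_derivative f' x) (at x)"
    using primitive_continuous_derivative primitive_continuous_on[OF f'(3)] by blast
  with f f' show "\<exists>f f' f''. square_integrable f \<and> square_integrable f' \<and> square_integrable f'' \<and> u = L2_class f \<and>
     (\<forall>x>0. (f has_vector_derivative f' x) (at x)) \<and> primitive f' f''"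
    using square_integrable_L2_rep by blast
next
  assume "\<exists>f f' f''. square_integrable f \<and> square_integrable f' \<and> square_integrable f'' \<and> u = L2_class f \<and>
     (\<forall>x>0. (f has_vector_derivative f' x) (at x)) \<and> primitive f' f''"
  then obtain f f' f'' where *: "square_integrable f" "square_integrable f'" "square_integrable f''" "u = L2_class f"
    "\<And>x. 0 < x \<Longrightarrow> (f has_vector_derivative f' x) (at x)" "primitive f' f''" by blast
  have "primitive f f'" by (rule primitive_of_C1[OF *(5) primitive_continuous_on[OF *(6)]])
  then show "u \<in> H2"
    unfolding H2_def using weak_deriv_L2_class * by blast
qed

section \<open>Cut-off solutions\<close>

text \<open>What matters about \<open>\<xi>\<close>: it is a cut-off function whose second derivative is
  square-integrable. Normalising \<open>\<xi>''\<close> to zero off \<open>[1, B]\<close> changes it on a null set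
  only.\<close>
definition cutoff :: "(real \<Rightarrow> complex) \<Rightarrow> (real \<Rightarrow> complex) \<Rightarrow> (real \<Rightarrow> complex) \<Rightarrow> real \<Rightarrow> bool" where
  "cutoff \<xi> \<xi>' \<xi>'' B \<longleftrightarrow> 1 \<le> B \<and> (\<forall>x>0. (\<xi> has_vector_derivative \<xi>' x) (at x)) \<and> primitive \<xi>' \<xi>'' \<and>
     square_integrable \<xi>'' \<and> (\<forall>x. 0 < x \<longrightarrow> x \<le> 1 \<longrightarrow> \<xi> x = 1) \<and> (\<forall>x>B. \<xi> x = 0) \<and>
     (\<forall>x. x < 1 \<or> B < x \<longrightarrow> \<xi>'' x = 0)"

lemma cutoff_derivative_0:
  assumes "cutoff \<xi> \<xi>' \<xi>'' B" "0 < x" "x < 1 \<or> B < x"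
  shows "\<xi>' x = 0"
proof -
  have d: "(\<xi> has_vector_derivative \<xi>' x) (at x)" using assms unfolding cutoff_def by blast
  from assms(3) show ?thesis
  proof
    assume "x < 1"
    then show ?thesis
      by (intro derivative_of_locally_constant[OF d, of "{0<..<1}" 1]) (use assms in \<open>auto simp: cutoff_def\<close>)
  next
    assume "B < x"
    then show ?thesis
      by (intro derivative_of_locally_constant[OF d, of "{B<..}" 0]) (use assms in \<open>auto simp: cutoff_def\<close>)
  qed
qed

lemma cutoff_exists:
  assumes C: "\<xi> \<in> C01_half_line" and one: "\<forall>x\<in>{0..1}. \<xi> x = 1" and H: "L2_class \<xi> \<in> H2"
  obtains \<xi>' \<xi>'' B where "cutoff \<xi> \<xi>' \<xi>'' B"
proof -
  obtain \<eta>' where C1: "C1_deriv_on {0..} \<xi> \<eta>'" and S: "compact_support_in {0..} \<xi>"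
    using C unfolding C01_half_line_def by blast
  obtain K where K: "compact K" "\<forall>x\<in>{0..} - K. \<xi> x = 0" using S unfolding compact_support_in_def by blast
  obtain B0 where "\<forall>x\<in>K. norm x \<le> B0" using compact_imp_bounded[OF K(1)] bounded_iff by blast
  define B where "B = max 1 B0"
  have B: "1 \<le> B" "\<And>x. B < x \<Longrightarrow> \<xi> x = 0"
  proof -
    show "1 \<le> B" by (simp add: B_def)
    fix x assume x: "B < x"
    then have "x \<in> {0..} - K" using \<open>\<forall>x\<in>K. norm x \<le> B0\<close> by (force simp: B_def)
    then show "\<xi> x = 0" using K by blast
  qed
  have cont: "continuous_on {0..} \<xi>"
    using C1 unfolding C1_deriv_on_def continuous_on_eq_continuous_within
    by (auto dest: has_vector_derivative_continuous)
  then have cont': "continuous_on {0<..} \<xi>" by (rule continuous_on_subset) auto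
  have \<xi>sq: "square_integrable \<xi>"
  proof -
    have "continuous_on {0..B} (\<lambda>x. (cmod (\<xi> x))\<^sup>2)"
      by (intro continuous_intros continuous_on_subset[OF cont]) auto
    from absolutely_integrable_continuous_real[OF this] 
    have "(\<lambda>x. (cmod (\<xi> x))\<^sup>2) absolutely_integrable_on {0<..B}" by (rule set_integrable_subset) auto
    moreover have "(\<lambda>x. indicator {0<..B} x *\<^sub>R (cmod (\<xi> x))\<^sup>2) = (\<lambda>x. indicator {0<..} x *\<^sub>R (cmod (\<xi> x))\<^sup>2)"
      using B(2) by (fastforce simp: indicator_def)
    ultimately have "integrable half_line (\<lambda>x. (cmod (\<xi> x))\<^sup>2)"
      unfolding integrable_half_line_iff set_integrable_def by (simp only:)
    with continuous_imp_half_line_measurable[OF cont'] show ?thesis by (simp add: square_integrable_def)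
  qed
  obtain f f' f'' where f: "square_integrable f" "square_integrable f''" "L2_class \<xi> = L2_class f"
    "\<And>x. 0 < x \<Longrightarrow> (f has_vector_derivative f' x) (at x)" "primitive f' f''"
    using H unfolding H2_iff by blast
  have ae: "AE x in half_line. f x = \<xi> x" using f(3) L2_class_eq_iff[OF f(1) \<xi>sq] L2_class_eq_iff by metis
  have eq: "f x = \<xi> x" if "0 < x" for x
    by (rule AE_half_line_continuous_eq[OF has_vector_derivative_imp_continuous_on[OF f(4)] cont' ae that])
  have d: "(\<xi> has_vector_derivative f' x) (at x)" if "0 < x" for x
    by (rule has_vector_derivative_cong_half_line[OF f(4)[OF that] that eq])
  define g where "g x = (if x < 1 \<or> B < x then 0 else f'' x)" for x
  have f'0: "f' x = 0" if "0 < x" "x < 1 \<or> B < x" for x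
    using that(2)
  proof
    assume "x < 1"
    then show ?thesis
      by (intro derivative_of_locally_constant[OF d[OF that(1)], of "{0<..<1}" 1]) (use that one in auto)
  next
    assume "B < x"
    then show ?thesis
      by (intro derivative_of_locally_constant[OF d[OF that(1)], of "{B<..}" 0]) (use B in auto)
  qed
  have "AE x in half_line. 0 < x \<and> x \<noteq> 1 \<and> x \<noteq> B"
    unfolding AE_half_line_iff by (rule exI[of _ "{1, B}"]) auto
  with primitive_AE_derivative[OF f(5)] have "AE x in half_line. f'' x = g x"
  proof eventually_elim
    case (elim x)
    consider "x < 1" | "B < x" | "1 < x" "x < B" using elim(2) by linarith
    then show ?case
    proof cases
      case 1
      then have "f'' x = 0"
        by (intro derivative_of_locally_constant[OF elim(1), of "{0<..<1}" 0]) (use elim f'0 in auto)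
      then show ?thesis using 1 by (simp add: g_def)
    next
      case 2
      then have "f'' x = 0"
        by (intro derivative_of_locally_constant[OF elim(1), of "{B<..}" 0]) (use f'0 B in auto)
      then show ?thesis using 2 by (simp add: g_def)
    qed (simp add: g_def)
  qed
  from primitive_cong_AE[OF f(5) this] have p: "primitive f' g" by simp
  have "g \<in> borel_measurable half_line"
  proof -
    have [measurable]: "f'' \<in> borel_measurable half_line" by (rule square_integrable_measurable[OF f(2)])
    have [measurable]: "(\<lambda>x. x) \<in> borel_measurable half_line" by (intro continuous_imp_half_line_measurable continuous_intros)
    show ?thesis unfolding g_def by measurable
  qed
  then have "square_integrable g"
    by (rule square_integrable_bound[OF _ f(2), where C=1]) (auto simp: g_def intro!: AE_half_line_I)
  with B d p one have "cutoff \<xi> f' g B" unfolding cutoff_def g_def by auto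
  then show thesis by (rule that)
qed

lemma continuous_on_half_line_bounded:
  fixes f :: "real \<Rightarrow> complex"
  assumes "continuous_on {0<..} f" "0 < a"
  obtains C where "0 \<le> C" "\<And>x. x \<in> {a..b} \<Longrightarrow> cmod (f x) \<le> C"
proof -
  have "continuous_on {a..b} f" by (rule continuous_on_subset[OF assms(1)]) (use assms in auto)
  then obtain C where "0 < C" "\<forall>x\<in>f ` {a..b}. cmod x \<le> C"
    using compact_imp_bounded[OF compact_continuous_image[OF _ compact_Icc]] bounded_pos by blast
  then show thesis by (intro that[of C]) auto
qed

text \<open>For a solution \<open>s\<close> at energy zero only the commutator \<open>- (2 s' \<xi>' + s
  \<xi>'')\<close> survives. It is supported in \<open>[1, B]\<close>, away from the singularity of \<open>s\<close> at
  \<open>0\<close>.\<close>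
lemma cutoff_solution:
  assumes c: "cutoff \<xi> \<xi>' \<xi>'' B" and s: "bessel_pair \<nu> s s' (\<lambda>x. 0)"
    and sL2: "\<And>b. square_integrable (\<lambda>x. if x \<le> b then s x else 0)"
  defines "k \<equiv> \<lambda>x. - (2 * (s' x * \<xi>' x) + s x * \<xi>'' x)"
  shows "bessel_pair \<nu> (\<lambda>x. s x * \<xi> x) (\<lambda>x. s' x * \<xi> x + s x * \<xi>' x) k"
    and "square_integrable (\<lambda>x. s x * \<xi> x)" and "square_integrable k"
proof -
  let ?V = "\<lambda>x. complex_of_real (bessel_V \<nu> x)"
  have d: "\<And>x. 0 < x \<Longrightarrow> (\<xi> has_vector_derivative \<xi>' x) (at x)" and p: "primitive \<xi>' \<xi>''" and B: "1 \<le> B"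
    and sq: "square_integrable \<xi>''" and one: "\<And>x. 0 < x \<Longrightarrow> x \<le> 1 \<Longrightarrow> \<xi> x = 1"
    and z: "\<And>x. B < x \<Longrightarrow> \<xi> x = 0" and z'': "\<And>x. x < 1 \<or> B < x \<Longrightarrow> \<xi>'' x = 0"
    using c unfolding cutoff_def by auto
  have sd: "\<And>x. 0 < x \<Longrightarrow> (s has_vector_derivative s' x) (at x)" and sp: "primitive s' (\<lambda>x. ?V x * s x)"
    using s unfolding bessel_pair_def by auto
  have cont: "continuous_on {0<..} \<xi>" "continuous_on {0<..} \<xi>'" "continuous_on {0<..} s" "continuous_on {0<..} s'"
    using has_vector_derivative_imp_continuous_on[OF d] has_vector_derivative_imp_continuous_on[OF sd]
      primitive_continuous_on[OF p] primitive_continuous_on[OF sp] by auto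
  have p\<xi>: "primitive \<xi> \<xi>'" by (rule primitive_of_C1[OF d cont(2)])
  have ps: "primitive s s'" by (rule primitive_of_C1[OF sd cont(4)])
  have "primitive (\<lambda>x. s' x * \<xi> x + s x * \<xi>' x) (\<lambda>x. (s' x * \<xi>' x + (?V x * s x) * \<xi> x) + (s x * \<xi>'' x + s' x * \<xi>' x))"
    by (intro primitive_add primitive_mult sp p\<xi> ps p)
  moreover have "(\<lambda>x. (s' x * \<xi>' x + (?V x * s x) * \<xi> x) + (s x * \<xi>'' x + s' x * \<xi>' x)) = (\<lambda>x. ?V x * (s x * \<xi> x) - k x)"
    by (auto simp: k_def algebra_simps)
  ultimately have "primitive (\<lambda>x. s' x * \<xi> x + s x * \<xi>' x) (\<lambda>x. ?V x * (s x * \<xi> x) - k x)" by simp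
  moreover have "((\<lambda>x. s x * \<xi> x) has_vector_derivative s' x * \<xi> x + s x * \<xi>' x) (at x)" if "0 < x" for x
    using has_vector_derivative_mult[OF sd[OF that] d[OF that]] by (simp add: add.commute)
  ultimately show "bessel_pair \<nu> (\<lambda>x. s x * \<xi> x) (\<lambda>x. s' x * \<xi> x + s x * \<xi>' x) k"
    unfolding bessel_pair_def by blast
  obtain C where C: "0 \<le> C" "\<And>x. x \<in> {1..B} \<Longrightarrow> cmod (\<xi> x) \<le> C"
    using continuous_on_half_line_bounded[OF cont(1)] zero_less_one by blast
  show "square_integrable (\<lambda>x. s x * \<xi> x)"
  proof (rule square_integrable_bound[OF _ sL2[of B], where C="max C 1"])
    show "(\<lambda>x. s x * \<xi> x) \<in> borel_measurable half_line"
      by (intro continuous_imp_half_line_measurable continuous_intros cont)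
    show "AE x in half_line. cmod (s x * \<xi> x) \<le> max C 1 * cmod (if x \<le> B then s x else 0)"
    proof (rule AE_half_line_I)
      fix x :: real assume x: "0 < x"
      have "cmod (\<xi> x) \<le> max C 1" if "x \<le> B"
        using one[OF x] C(2)[of x] that by (cases "x \<le> 1") auto
      then show "cmod (s x * \<xi> x) \<le> max C 1 * cmod (if x \<le> B then s x else 0)"
        using z[of x] by (auto simp: norm_mult mult.commute intro: mult_right_mono)
    qed
  qed
  obtain D where D: "0 \<le> D" "\<And>x. x \<in> {1..B} \<Longrightarrow> cmod (s x) \<le> D"
    using continuous_on_half_line_bounded[OF cont(3)] zero_less_one by blast
  have "square_integrable (\<lambda>x. s' x * \<xi>' x)"
    by (rule continuous_compact_square_integrable[of 1 _ B])
      (use cont cutoff_derivative_0[OF c] in \<open>auto intro!: continuous_intros\<close>)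
  moreover have "square_integrable (\<lambda>x. s x * \<xi>'' x)"
  proof (rule square_integrable_bound[OF _ sq, where C=D])
    have [measurable]: "s \<in> borel_measurable half_line" "\<xi>'' \<in> borel_measurable half_line"
      using cont(3) sq by (auto simp: square_integrable_measurable continuous_imp_half_line_measurable)
    show "(\<lambda>x. s x * \<xi>'' x) \<in> borel_measurable half_line" by measurable
    show "AE x in half_line. cmod (s x * \<xi>'' x) \<le> D * cmod (\<xi>'' x)"
    proof (rule AE_half_line_I)
      fix x :: real
      show "cmod (s x * \<xi>'' x) \<le> D * cmod (\<xi>'' x)"
        using z''[of x] D(2)[of x] by (cases "x < 1 \<or> B < x") (auto simp: norm_mult intro: mult_right_mono)
    qed
  qed
  ultimately show "square_integrable k" unfolding k_def
    by (intro square_integrable_uminus square_integrable_add square_integrable_scale)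
qed

text \<open>Green's formula for \<open>f\<close> and the cut-off solution \<open>s \<xi>\<close>, whose Wronskian with
  \<open>f\<close> is that of \<open>s\<close> near \<open>0\<close>. It expresses the boundary value \<open>L\<close>
  by inner products, hence as a functional that is continuous in the graph norm.\<close>
lemma boundary_value_formula:
  assumes c: "cutoff \<xi> \<xi>' \<xi>'' B" and s: "bessel_pair \<nu> s s' (\<lambda>x. 0)"
    and sL2: "\<And>b. square_integrable (\<lambda>x. if x \<le> b then s x else 0)"
    and f: "bessel_pair \<nu> f f' g" and fsq: "square_integrable f" and gsq: "square_integrable g"
    and L: "\<And>x. 0 < x \<Longrightarrow> f x * s' x - f' x * s x = L + integral {0..x} (\<lambda>t. g t * s t)"
  defines "k \<equiv> \<lambda>x. - (2 * (s' x * \<xi>' x) + s x * \<xi>'' x)"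
  shows "L = (LINT x|half_line. f x * k x) - (LINT x|half_line. g x * (s x * \<xi> x))"
proof -
  let ?h = "\<lambda>x. s x * \<xi> x" and ?h' = "\<lambda>x. s' x * \<xi> x + s x * \<xi>' x"
  let ?F = "\<lambda>x. f x * ?h' x - f' x * ?h x"
  note cs = cutoff_solution[OF c s sL2, folded k_def]
  have P: "primitive ?F (\<lambda>x. g x * ?h x - f x * k x)" by (rule wronskian_primitive[OF f cs(1)])
  have i: "integrable half_line (\<lambda>x. g x * ?h x)" "integrable half_line (\<lambda>x. f x * k x)"
    by (rule integrable_mult_square_integrable[OF gsq cs(2)], rule integrable_mult_square_integrable[OF fsq cs(3)])
  then have ii: "integrable half_line (\<lambda>x. g x * ?h x - f x * k x)" by simp
  obtain M where M: "\<And>x. 0 < x \<Longrightarrow> ?F x = M + integral {0..x} (\<lambda>x. g x * ?h x - f x * k x)"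
    using primitive_eq_from_0[OF P absolutely_integrable_Icc_0[OF ii]] by blast
  have B: "1 \<le> B" and z: "\<And>x. B < x \<Longrightarrow> \<xi> x = 0" and one: "\<And>x. 0 < x \<Longrightarrow> x \<le> 1 \<Longrightarrow> \<xi> x = 1"
    using c unfolding cutoff_def by auto
  have "?F x = 0" if "B + 1 \<le> x" for x
    using z[of x] cutoff_derivative_0[OF c, of x] B that by simp
  from primitive_boundary_value[OF P ii this M]
  have "(LINT x|half_line. g x * ?h x - f x * k x) = - M" .
  then have "M = (LINT x|half_line. f x * k x) - (LINT x|half_line. g x * ?h x)"
    unfolding Bochner_Integration.integral_diff[OF i] by (simp add: eq_neg_iff_add_eq_0 algebra_simps)
  moreover have "M = L"
  proof (rule primitive_boundary_limit[OF M absolutely_integrable_Icc_0[OF ii]])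
    have "((\<lambda>x. L + integral {0..x} (\<lambda>t. g t * s t)) \<longlongrightarrow> L + 0) (at_right 0)"
      by (intro tendsto_add tendsto_const integral_from_0_tendsto_0 absolutely_integrable_mult_L2_near_0[OF gsq sL2])
    moreover have "\<forall>\<^sub>F x in at_right 0. L + integral {0..x} (\<lambda>t. g t * s t) = ?F x"
      using eventually_at_right_real[OF zero_less_one]
    proof eventually_elim
      case (elim x)
      then show ?case using one[of x] cutoff_derivative_0[OF c, of x] L[of x] by simp
    qed
    ultimately show "(?F \<longlongrightarrow> L) (at_right 0)" by (simp add: tendsto_cong)
  qed
  ultimately show ?thesis by simp
qed

section \<open>Vanishing boundary values\<close>

lemma at_within_atLeast_0: "at (0::real) within {0..} = at_right 0"
proof -
  have "{0..} - {0::real} = {0<..} - {0}" by auto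
  then show ?thesis by (simp add: at_within_def)
qed

lemma norm_L2_class: "square_integrable f \<Longrightarrow> norm (L2_class f) = sqrt (LINT x|half_line. (cmod (f x))\<^sup>2)"
proof -
  assume f: "square_integrable f"
  have "cinner (L2_class f) (L2_class f) = (LINT x|half_line. complex_of_real ((cmod (f x))\<^sup>2))"
    using f by (simp add: L2_class_ops complex_norm_square del: of_real_power)
  also have "\<dots> = complex_of_real (LINT x|half_line. (cmod (f x))\<^sup>2)" by (rule integral_complex_of_real)
  finally have "inner (L2_class f) (L2_class f) = (LINT x|half_line. (cmod (f x))\<^sup>2)"
    by (simp add: Re_cinner[symmetric])
  then show ?thesis by (simp add: norm_half_line_L2_def)
qed

lemma L2_dominated_convergence:
  assumes fn: "\<And>n. square_integrable (fn n)" and f: "square_integrable f" and w: "square_integrable w"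
    and le: "\<And>n x. 0 < x \<Longrightarrow> cmod (fn n x - f x) \<le> cmod (w x)"
    and lim: "\<And>x. 0 < x \<Longrightarrow> (\<lambda>n. fn n x) \<longlonglongrightarrow> f x"
  shows "(\<lambda>n. L2_class (fn n)) \<longlonglongrightarrow> L2_class f"
proof -
  have d: "square_integrable (\<lambda>x. fn n x - f x)" for n by (rule square_integrable_diff[OF fn f])
  have "(\<lambda>n. LINT x|half_line. (cmod (fn n x - f x))\<^sup>2) \<longlonglongrightarrow> (LINT x|half_line. 0)"
  proof (rule integral_dominated_convergence[where w="\<lambda>x. (cmod (w x))\<^sup>2"])
    show "(\<lambda>x. (cmod (fn n x - f x))\<^sup>2) \<in> borel_measurable half_line" for n
      using square_integrable_measurable[OF d[of n]] by measurable
    show "integrable half_line (\<lambda>x. (cmod (w x))\<^sup>2)" using w by (simp add: square_integrable_def)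
    show "AE x in half_line. norm ((cmod (fn n x - f x))\<^sup>2) \<le> (cmod (w x))\<^sup>2" for n
      by (rule AE_half_line_I) (use le in \<open>auto intro: power_mono\<close>)
    show "AE x in half_line. (\<lambda>n. (cmod (fn n x - f x))\<^sup>2) \<longlonglongrightarrow> 0"
    proof (rule AE_half_line_I)
      fix x :: real assume "0 < x"
      from tendsto_power[OF tendsto_norm[OF tendsto_diff[OF lim[OF this] tendsto_const[of "f x"]]], of 2]
      show "(\<lambda>n. (cmod (fn n x - f x))\<^sup>2) \<longlonglongrightarrow> 0" by simp
    qed
  qed simp
  then have "(\<lambda>n. sqrt (LINT x|half_line. (cmod (fn n x - f x))\<^sup>2)) \<longlonglongrightarrow> sqrt 0"
    by (intro tendsto_real_sqrt) simp
  moreover have "norm (L2_class (fn n) - L2_class f) = sqrt (LINT x|half_line. (cmod (fn n x - f x))\<^sup>2)" for n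
    by (simp add: L2_class_diff[OF fn f] norm_L2_class[OF d])
  ultimately have "(\<lambda>n. norm (L2_class (fn n) - L2_class f)) \<longlonglongrightarrow> 0" by simp
  then show ?thesis by (simp add: tendsto_norm_zero_iff LIM_zero_iff)
qed

lemma Re_mult_cnj: "Re (z * cnj z) = (cmod z)\<^sup>2"
  by (simp add: complex_mult_cnj cmod_power2)

text \<open>The function \<open>E = f' \<cdot> cnj f\<close> has the derivative \<open>|f'|\<^sup>2 + f'' \<cdot> cnj
  f\<close>, whose second summand is integrable. If the integrals of \<open>|f'|\<^sup>2\<close> were not bounded,
  \<open>Re E\<close> would eventually be at least \<open>1\<close>; as \<open>2 Re E\<close> is the derivative of
  \<open>|f|\<^sup>2\<close>, this contradicts the square-integrability of \<open>f\<close>.\<close>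
lemma square_integrable_derivative_interpolation:
  assumes f: "square_integrable f" and f'': "square_integrable f''"
    and p: "primitive f f'" and p': "primitive f' f''"
    and lim: "((\<lambda>x. f' x * cnj (f x)) \<longlongrightarrow> 0) (at_right 0)"
  shows "square_integrable f'"
proof -
  define E where "E x = f' x * cnj (f x)" for x
  define N where "N = (LINT x|half_line. cmod (f'' x * cnj (f x)))"
  define G where "G = (LINT x|half_line. (cmod (f x))\<^sup>2)"
  have c: "continuous_on {0<..} f'" "continuous_on {0<..} f" using primitive_continuous_on p p' by auto
  have pc: "primitive (\<lambda>x. cnj (f x)) (\<lambda>x. cnj (f' x))" by (rule primitive_linear[OF p bounded_linear_cnj])
  have PE: "primitive E (\<lambda>x. f' x * cnj (f' x) + f'' x * cnj (f x))"
    unfolding E_def by (rule primitive_mult[OF p' pc])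
  have int: "(\<lambda>x. (cmod (f' x))\<^sup>2) integrable_on {a..b}" if "0 < a" for a b
    by (rule integrable_continuous_real, intro continuous_intros continuous_on_subset[OF c(1)]) (use that in auto)
  have ii: "integrable half_line (\<lambda>x. f'' x * cnj (f x))" by (rule integrable_mult_cnj[OF f'' f])
  have ReE: "Re (E b) - Re (E a) = integral {a..b} (\<lambda>x. (cmod (f' x))\<^sup>2) + Re (integral {a..b} (\<lambda>x. f'' x * cnj (f x)))"
    "\<bar>Re (integral {a..b} (\<lambda>x. f'' x * cnj (f x)))\<bar> \<le> N" if ab: "0 < a" "a \<le> b" for a b
  proof -
    have i2: "(\<lambda>x. f'' x * cnj (f x)) absolutely_integrable_on {a..b}"
      by (rule set_integrable_subset[OF absolutely_integrable_Icc_0[OF ii, of b]]) (use ab in auto)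
    have i2': "(\<lambda>x. f'' x * cnj (f x)) integrable_on {a..b}" using i2 set_lebesgue_integral_eq_integral(1) by blast
    have "((\<lambda>x. Re (f' x * cnj (f' x) + f'' x * cnj (f x))) has_integral Re (E b - E a)) {a..b}"
      using has_integral_linear[OF primitive_has_integral[OF PE ab] bounded_linear_Re] by (simp add: o_def)
    moreover have "((\<lambda>x. (cmod (f' x))\<^sup>2 + Re (f'' x * cnj (f x))) has_integral
       integral {a..b} (\<lambda>x. (cmod (f' x))\<^sup>2) + Re (integral {a..b} (\<lambda>x. f'' x * cnj (f x)))) {a..b}"
      using has_integral_add[OF integrable_integral[OF int[OF ab(1)]] has_integral_linear[OF integrable_integral[OF i2'] bounded_linear_Re]]
      by (simp add: o_def)
    moreover have "Re (f' x * cnj (f' x) + f'' x * cnj (f x)) = (cmod (f' x))\<^sup>2 + Re (f'' x * cnj (f x))" for x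
      by (simp only: plus_complex.sel Re_mult_cnj)
    ultimately show "Re (E b) - Re (E a) = integral {a..b} (\<lambda>x. (cmod (f' x))\<^sup>2) + Re (integral {a..b} (\<lambda>x. f'' x * cnj (f x)))"
      using has_integral_unique by (metis (no_types, lifting) minus_complex.sel(1) has_integral_cong)
    have nn: "integrable half_line (\<lambda>x. cmod (f'' x * cnj (f x)))" using ii by (rule integrable_norm)
    have na: "(\<lambda>x. cmod (f'' x * cnj (f x))) absolutely_integrable_on {0<..}"
      using nn by (simp add: integrable_half_line_iff)
    have "\<bar>Re (integral {a..b} (\<lambda>x. f'' x * cnj (f x)))\<bar> \<le> cmod (integral {a..b} (\<lambda>x. f'' x * cnj (f x)))"
      by (rule abs_Re_le_cmod)
    also have "\<dots> \<le> integral {a..b} (\<lambda>x. cmod (f'' x * cnj (f x)))"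
      by (rule integral_norm_bound_integral[OF i2'])
        (use absolutely_integrable_norm[OF i2] set_lebesgue_integral_eq_integral(1) in \<open>auto simp: o_def\<close>)
    also have "\<dots> \<le> integral {0<..} (\<lambda>x. cmod (f'' x * cnj (f x)))"
      by (rule integral_subset_le)
        (use ab absolutely_integrable_norm[OF i2] na set_lebesgue_integral_eq_integral(1) in \<open>auto simp: o_def\<close>)
    also have "\<dots> = N" unfolding N_def using lebesgue_integral_eq_integral[OF nn] by simp
    finally show "\<bar>Re (integral {a..b} (\<lambda>x. f'' x * cnj (f x)))\<bar> \<le> N" .
  qed
  have "\<forall>\<^sub>F x in at_right 0. cmod (E x) < 1"
    using tendsto_norm[OF lim] unfolding E_def by (intro order_tendstoD(2)[where y="cmod 0"]) auto
  then obtain \<delta> where \<delta>: "0 < \<delta>" "\<And>x. 0 < x \<Longrightarrow> x < \<delta> \<Longrightarrow> cmod (E x) < 1"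
    unfolding eventually_at_right_field by blast
  have "integrable half_line (\<lambda>x. (cmod (f' x))\<^sup>2)"
  proof (rule integrable_half_line_bounded_integrals[where B="N + 2"])
    fix a0 b0 :: real assume ab0: "0 < a0" "a0 \<le> b0"
    show "(\<lambda>x. (cmod (f' x))\<^sup>2) integrable_on {a0..b0}" by (rule int[OF ab0(1)])
    show "integral {a0..b0} (\<lambda>x. (cmod (f' x))\<^sup>2) \<le> N + 2"
    proof (rule ccontr)
      assume "\<not> ?thesis"
      then have big: "N + 2 < integral {a0..b0} (\<lambda>x. (cmod (f' x))\<^sup>2)" by simp
      \<comment> \<open>the interval is extended to the left until \<open>E\<close> is small at its left end\<close>
      define a where "a = min a0 (\<delta> / 2)"
      have a: "0 < a" "a \<le> a0" "a < \<delta>" using ab0 \<delta> by (auto simp: a_def)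
      have E1: "1 \<le> Re (E x)" if "b0 \<le> x" for x
      proof -
        have "integral {a0..b0} (\<lambda>x. (cmod (f' x))\<^sup>2) \<le> integral {a..x} (\<lambda>x. (cmod (f' x))\<^sup>2)"
          by (rule integral_subset_le) (use a ab0 that int in auto)
        moreover have "\<bar>Re (E a)\<bar> < 1" using \<delta>(2)[OF a(1,3)] abs_Re_le_cmod[of "E a"] by linarith
        ultimately show ?thesis using ReE[of a x] a ab0 that big by linarith
      qed
      define S where "S x = (cmod (f x))\<^sup>2" for x
      have PS: "primitive S (\<lambda>x. 2 * Re (E x))"
      proof -
        have "primitive (\<lambda>x. Re (f x * cnj (f x))) (\<lambda>x. Re (f x * cnj (f' x) + f' x * cnj (f x)))"
          by (rule primitive_linear[OF primitive_mult[OF p pc] bounded_linear_Re])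
        moreover have "(\<lambda>x. Re (f x * cnj (f x))) = S" 
          by (rule ext) (simp only: S_def Re_mult_cnj)
        moreover have "(\<lambda>x. Re (f x * cnj (f' x) + f' x * cnj (f x))) = (\<lambda>x. 2 * Re (E x))"
          by (auto simp: E_def)
        ultimately show ?thesis by simp
      qed
      have b0: "0 < b0" using ab0 by linarith
      have S2: "2 \<le> S x" if "b0 + 1 \<le> x" for x
      proof -
        have "integral {b0..x} (\<lambda>x. 2) \<le> integral {b0..x} (\<lambda>x. 2 * Re (E x))"
          by (rule integral_le) (use E1 primitive_has_integral[OF PS b0, of x] that in auto)
        also have "\<dots> = S x - S b0" by (rule integral_unique[OF primitive_has_integral[OF PS b0]]) (use that in simp)
        finally have "2 * (x - b0) \<le> S x - S b0" using that by (simp add: mult.commute)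
        moreover have "0 \<le> S b0" by (simp add: S_def)
        moreover have "2 \<le> 2 * (x - b0)" using that by simp
        ultimately show ?thesis by linarith
      qed
      have "G \<ge> 0" by (simp add: G_def)
      have "S = (\<lambda>x. (cmod (f x))\<^sup>2)" by (rule ext) (simp add: S_def)
      then have Si: "S integrable_on {b0+1..b0+1+(G+1)}"
        using square_integrable_norm_integrable(1)[OF f, of "b0 + 1"] b0 by simp
      \<comment> \<open>the interval is long enough for the integral of \<open>|f|\<^sup>2\<close> over it to exceed the total integral \<open>G\<close>\<close>
      have "integral {b0+1..b0+1+(G+1)} (\<lambda>x. 2) \<le> integral {b0+1..b0+1+(G+1)} S"
        by (rule integral_le) (use S2 Si in auto)
      also have "\<dots> \<le> G" unfolding S_def G_def by (rule square_integrable_norm_integrable(2)[OF f]) (use b0 in simp)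
      finally show False using \<open>G \<ge> 0\<close> by simp
    qed
  qed simp
  then show ?thesis using primitive_measurable[OF p'] by (simp add: square_integrable_def)
qed

lemma weighted_integral_tendsto_0:
  assumes "square_integrable g" "\<mu> < 1"
  shows "(weighted_integral \<mu> g \<longlongrightarrow> 0) (at_right 0)"
  unfolding weighted_integral_def
  by (rule integral_from_0_tendsto_0[OF weighted_absolutely_integrable[OF assms]])

text \<open>By \<open>zero_boundary_bounds\<close> and Hardy's inequality, \<open>V f\<close> and with it \<open>f'' =
  V f - g\<close> are square-integrable; the same bounds give \<open>f(0) = f'(0) = 0\<close>.\<close>
lemma zero_boundary_imp_H02:
  assumes \<nu>: "0 \<le> \<nu>" "\<nu> < 1" and P: "bessel_pair \<nu> f f' g"
    and f: "square_integrable f" and g: "square_integrable g" 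
    and Wp: "\<And>x. 0 < x \<Longrightarrow> f x * complex_of_real (sol_pos' \<nu> x) - f' x * complex_of_real (sol_pos \<nu> x)
       = integral {0..x} (\<lambda>t. g t * complex_of_real (sol_pos \<nu> t))"
    and Wn: "\<And>x. 0 < x \<Longrightarrow> f x * complex_of_real (sol_neg' \<nu> x) - f' x * complex_of_real (sol_neg \<nu> x)
       = integral {0..x} (\<lambda>t. g t * complex_of_real (sol_neg \<nu> t))"
  shows "L2_class f \<in> H02"
proof -
  define \<mu> where "\<mu> = max \<nu> (1/2)"
  have \<mu>: "\<nu> \<le> \<mu>" "1/2 \<le> \<mu>" "\<mu> < 1" using \<nu> by (auto simp: \<mu>_def)
  define C where "C = 2 / \<bar>sol_wronskian \<nu>\<bar>"
  have C: "0 \<le> C" by (simp add: C_def)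
  define H where "H = weighted_integral \<mu> g"
  have H0: "0 \<le> H x" for x unfolding H_def by (rule weighted_integral_nonneg[OF g \<mu>(3)])
  have fb: "cmod (f x) \<le> C * (x powr (1/2 + \<mu>) * H x)" and fb': "cmod (f' x) \<le> C * (x powr (\<mu> - 1/2) * H x)"
    if "0 < x" for x
    using zero_boundary_bounds[OF \<nu> \<mu> g Wp Wn that] unfolding C_def H_def by auto
  have small: "cmod (f x) \<le> C * H x * x" "cmod (f' x) \<le> C * H x" if x: "0 < x" "x \<le> 1" for x
  proof -
    have p: "x powr (\<mu> - 1/2) \<le> 1" using powr_mono2[of "\<mu> - 1/2" x 1] x \<mu> by simp
    have "cmod (f' x) \<le> C * (x powr (\<mu> - 1/2) * H x)" by (rule fb'[OF x(1)])
    also have "\<dots> \<le> C * (1 * H x)" by (intro mult_left_mono mult_right_mono p H0 C)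
    finally show "cmod (f' x) \<le> C * H x" by simp
    have e: "x powr (1/2 + \<mu>) = x powr (\<mu> - 1/2) * x"
      using x powr_add[of x "\<mu> - 1/2" 1] by (simp add: add.commute)
    have "cmod (f x) \<le> C * (x powr (1/2 + \<mu>) * H x)" by (rule fb[OF x(1)])
    also have "\<dots> \<le> C * ((1 * x) * H x)" unfolding e using x by (intro mult_left_mono mult_right_mono p H0 C) auto
    finally show "cmod (f x) \<le> C * H x * x" by (simp add: mult_ac)
  qed
  have CH: "((\<lambda>x. C * H x) \<longlongrightarrow> 0) (at_right 0)"
    using tendsto_mult[OF tendsto_const[of C] weighted_integral_tendsto_0[OF g \<mu>(3)]] by (simp add: H_def)
  have ev: "\<forall>\<^sub>F x in at_right (0::real). 0 < x \<and> x \<le> 1"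
    using eventually_at_right_real[OF zero_less_one] by eventually_elim auto
  have lf': "(f' \<longlongrightarrow> 0) (at_right 0)"
    by (rule Lim_null_comparison[OF _ CH]) (use ev small(2) in \<open>auto elim: eventually_mono\<close>)
  have lq: "((\<lambda>x. f x / complex_of_real x) \<longlongrightarrow> 0) (at_right 0)"
  proof (rule Lim_null_comparison[OF _ CH])
    show "\<forall>\<^sub>F x in at_right 0. cmod (f x / complex_of_real x) \<le> C * H x"
      using ev
    proof eventually_elim
      case (elim x) with small(1)[of x] show ?case by (simp add: norm_divide pos_divide_le_eq)
    qed
  qed
  have lf: "(f \<longlongrightarrow> 0) (at_right 0)"
  proof -
    have "((\<lambda>x. f x / complex_of_real x * complex_of_real x) \<longlongrightarrow> 0 * complex_of_real 0) (at_right 0)"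
      by (intro tendsto_mult lq tendsto_of_real tendsto_ident_at)
    moreover have "\<forall>\<^sub>F x in at_right 0. f x / complex_of_real x * complex_of_real x = f x"
      using ev by eventually_elim auto
    ultimately show ?thesis by (simp add: tendsto_cong)
  qed
  let ?V = "\<lambda>x. complex_of_real (bessel_V \<nu> x)"
  define f'' where "f'' x = ?V x * f x - g x" for x
  have d: "\<And>x. 0 < x \<Longrightarrow> (f has_vector_derivative f' x) (at x)" and p': "primitive f' f''"
    using P unfolding bessel_pair_def f''_def by auto
  have p: "primitive f f'" by (rule bessel_pair_primitive[OF P])
  have fc: "continuous_on {0<..} f" "continuous_on {0<..} f'" using bessel_pair_continuous[OF P] by auto
  have "square_integrable (\<lambda>x. ?V x * f x)"
  proof (rule square_integrable_bound[OF _ hardy_inequality[OF g \<mu>(3)], where C="\<bar>\<nu>\<^sup>2 - 1/4\<bar> * C"])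
    show "(\<lambda>x. ?V x * f x) \<in> borel_measurable half_line"
      by (intro continuous_imp_half_line_measurable continuous_intros continuous_on_bessel_V fc)
    show "AE x in half_line. cmod (?V x * f x)
       \<le> \<bar>\<nu>\<^sup>2 - 1/4\<bar> * C * cmod (complex_of_real (x powr (\<mu> - 3/2) * weighted_integral \<mu> g x))"
    proof (rule AE_half_line_I)
      fix x :: real assume x: "0 < x"
      have e: "x powr (1/2 + \<mu>) / x\<^sup>2 = x powr (\<mu> - 3/2)"
        using x powr_diff[of x "1/2 + \<mu>" 2] by (simp add: powr_numeral)
      have "cmod (?V x * f x) = \<bar>\<nu>\<^sup>2 - 1/4\<bar> / x\<^sup>2 * cmod (f x)"
        by (simp only: norm_mult norm_of_real bessel_V_def abs_divide abs_power2)
      also have "\<dots> \<le> \<bar>\<nu>\<^sup>2 - 1/4\<bar> / x\<^sup>2 * (C * (x powr (1/2 + \<mu>) * H x))"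
        by (intro mult_left_mono fb x) simp
      also have "\<dots> = \<bar>\<nu>\<^sup>2 - 1/4\<bar> * C * (x powr (1/2 + \<mu>) / x\<^sup>2 * H x)" by simp
      also have "\<dots> = \<bar>\<nu>\<^sup>2 - 1/4\<bar> * C * \<bar>x powr (\<mu> - 3/2) * H x\<bar>"
        unfolding e using H0[of x] by simp
      finally show "cmod (?V x * f x) \<le> \<bar>\<nu>\<^sup>2 - 1/4\<bar> * C * cmod (complex_of_real (x powr (\<mu> - 3/2) * weighted_integral \<mu> g x))"
        unfolding norm_of_real H_def .
    qed
  qed
  then have f''sq: "square_integrable f''" unfolding f''_def by (intro square_integrable_diff g)
  have "((\<lambda>x. f' x * cnj (f x)) \<longlongrightarrow> 0 * cnj 0) (at_right 0)" by (intro tendsto_intros lf lf')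
  then have f'sq: "square_integrable f'"
    by (intro square_integrable_derivative_interpolation[OF f f''sq p p']) simp
  have H2: "L2_class f \<in> H2" unfolding H2_iff using f f'sq f''sq d p' by blast
  define F where "F x = (if 0 < x then f x else 0)" for x
  define F' where "F' x = (if 0 < x then f' x else 0)" for x
  have ae: "AE x in half_line. f x = F x" by (rule AE_half_line_I) (simp add: F_def)
  have Fm: "F \<in> borel_measurable half_line"
    by (rule continuous_imp_half_line_measurable, rule continuous_on_eq[OF fc(1)]) (simp add: F_def)
  have Fsq: "square_integrable F" by (rule square_integrable_cong_AE[OF f ae Fm])
  have Fcl: "L2_class f = L2_class F" using L2_class_eq_iff[OF f Fsq] ae by blast
  have "C1_deriv_on {0..} F F'"
    unfolding C1_deriv_on_def
  proof (intro conjI ballI)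
    fix x :: real assume x: "x \<in> {0..}"
    show "(F has_vector_derivative F' x) (at x within {0..})"
    proof (cases "x = 0")
      case True
      have "\<forall>\<^sub>F x in at_right 0. f x / complex_of_real x = (F x - F 0) /\<^sub>R (x - 0)"
        using ev by eventually_elim (simp add: F_def scaleR_conv_of_real divide_inverse mult.commute)
      then have "((\<lambda>x. (F x - F 0) /\<^sub>R (x - 0)) \<longlongrightarrow> 0) (at_right 0)"
        using lq by (simp add: tendsto_cong)
      then have "((\<lambda>x. (F x - F 0) /\<^sub>R norm (x - 0)) \<longlongrightarrow> 0) (at_right 0)"
        by (rule Lim_transform_eventually) (use ev in \<open>auto elim: eventually_mono\<close>)
      then show ?thesis
        using True unfolding has_vector_derivative_def has_derivative_within
        by (simp add: at_within_atLeast_0 F'_def divide_inverse)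
    next
      case False
      then have "0 < x" using x by simp
      then have "(F has_vector_derivative F' x) (at x)"
        using has_vector_derivative_cong_half_line[OF d[of x], of F] by (simp add: F_def F'_def)
      then show ?thesis by (rule has_vector_derivative_at_within)
    qed
  next
    show "continuous_on {0..} F'"
      unfolding continuous_on_def
    proof (rule ballI)
      fix x :: real assume x: "x \<in> {0..}"
      show "(F' \<longlongrightarrow> F' x) (at x within {0..})"
      proof (cases "x = 0")
        case True
        have "\<forall>\<^sub>F x in at_right 0. f' x = F' x" using ev by eventually_elim (simp add: F'_def)
        with lf' have "(F' \<longlongrightarrow> 0) (at_right 0)" by (simp add: tendsto_cong)
        with True show ?thesis by (simp add: at_within_atLeast_0 F'_def)
      next
        case False
        then have x: "0 < x" using x by simp
        have "continuous_on {0<..} F'" by (rule continuous_on_eq[OF fc(2)]) (simp add: F'_def)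
        then have "isCont F' x" using x by (simp add: continuous_on_eq_continuous_at)
        then show ?thesis unfolding isCont_def by (rule tendsto_within_subset) simp
      qed
    qed
  qed
  moreover have "F 0 = 0" "F' 0 = 0" by (simp_all add: F_def F'_def)
  ultimately show ?thesis unfolding H02_def using H2 Fsq Fcl by blast
qed

section \<open>Approximation by functions with compact support\<close>

text \<open>Integrating \<open>f''\<close> twice from \<open>0\<close>, where \<open>f\<close> and \<open>f'\<close>
  vanish, bounds both by the Hardy operator with \<open>\<mu> = 1/2\<close>.\<close>
lemma H02_cases:
  assumes "u \<in> H02"
  obtains f f' f'' where "square_integrable f" "square_integrable f''" "u = L2_class f"
    "\<And>x. 0 < x \<Longrightarrow> (f has_vector_derivative f' x) (at x)" "primitive f' f''"
    "\<And>x. 0 < x \<Longrightarrow> cmod (f' x) \<le> weighted_integral (1/2) f'' x"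
    "\<And>x. 0 < x \<Longrightarrow> cmod (f x) \<le> x * weighted_integral (1/2) f'' x"
proof -
  obtain h h' where h: "square_integrable h" "u = L2_class h" "C1_deriv_on {0..} h h'" "h 0 = 0" "h' 0 = 0" and uH: "u \<in> H2"
    using assms unfolding H02_def by blast
  obtain f f' f'' where f: "square_integrable f" "square_integrable f'" "square_integrable f''" "u = L2_class f"
    "\<And>x. 0 < x \<Longrightarrow> (f has_vector_derivative f' x) (at x)" "primitive f' f''"
    using uH unfolding H2_iff by blast
  have hd: "(h has_vector_derivative h' x) (at x)" if "0 < x" for x
  proof -
    have "(h has_vector_derivative h' x) (at x within {0..})" using h(3) that unfolding C1_deriv_on_def by auto
    then have "(h has_vector_derivative h' x) (at x within {0<..})" by (rule has_vector_derivative_within_subset) auto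
    then show ?thesis using that by (simp add: at_within_open[OF _ open_greaterThan])
  qed
  have fc: "continuous_on {0<..} f" by (rule has_vector_derivative_imp_continuous_on[OF f(5)])
  have ae: "AE x in half_line. f x = h x" using L2_class_eq_iff[OF f(1) h(1)] f(4) h(2) by simp
  have eq: "f x = h x" if "0 < x" for x
    by (rule AE_half_line_continuous_eq[OF fc has_vector_derivative_imp_continuous_on[OF hd] ae that])
  have eq': "f' x = h' x" if "0 < x" for x
    using has_vector_derivative_cong_half_line[OF f(5)[OF that] that eq] hd[OF that] by (rule vector_derivative_unique_at)
  have "((\<lambda>x. h x) \<longlongrightarrow> h 0) (at 0 within {0..})"
    using h(3) unfolding C1_deriv_on_def
    by (auto dest!: has_vector_derivative_continuous simp: continuous_within)
  then have lf: "(f \<longlongrightarrow> 0) (at_right 0)"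
    unfolding at_within_atLeast_0 h(4)
    by (rule Lim_transform_eventually) (use eq in \<open>auto simp: eventually_at_filter\<close>)
  have "((\<lambda>x. h' x) \<longlongrightarrow> h' 0) (at 0 within {0..})"
    using h(3) unfolding C1_deriv_on_def continuous_on_def by auto
  then have lf': "(f' \<longlongrightarrow> 0) (at_right 0)"
    unfolding at_within_atLeast_0 h(5)
    by (rule Lim_transform_eventually) (use eq' in \<open>auto simp: eventually_at_filter\<close>)
  have ai: "f absolutely_integrable_on {0..b}" "f' absolutely_integrable_on {0..b}" "f'' absolutely_integrable_on {0..b}" for b
    by (rule square_integrable_absolutely_integrable[OF f(1)], rule square_integrable_absolutely_integrable[OF f(2)],
        rule square_integrable_absolutely_integrable[OF f(3)])
  have pf: "primitive f f'" by (rule primitive_of_C1[OF f(5) primitive_continuous_on[OF f(6)]])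
  have f'_eq: "f' x = integral {0..x} f''" if "0 < x" for x
  proof -
    obtain L where L: "\<And>x. 0 < x \<Longrightarrow> f' x = L + integral {0..x} f''" using primitive_eq_from_0[OF f(6) ai(3)] by blast
    from primitive_boundary_limit[OF L ai(3) lf'] L[OF that] show ?thesis by simp
  qed
  have f_eq: "f x = integral {0..x} f'" if "0 < x" for x
  proof -
    obtain L where L: "\<And>x. 0 < x \<Longrightarrow> f x = L + integral {0..x} f'" using primitive_eq_from_0[OF pf ai(2)] by blast
    from primitive_boundary_limit[OF L ai(2) lf] L[OF that] show ?thesis by simp
  qed
  define H where "H = weighted_integral (1/2) f''"
  have H: "H x = integral {0..x} (\<lambda>s. cmod (f'' s))" for x
    unfolding H_def weighted_integral_def by (rule integral_spike[of "{0}"]) auto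
  have ni: "(\<lambda>s. cmod (f'' s)) integrable_on {0..x}" for x
    using absolutely_integrable_norm[OF ai(3)] set_lebesgue_integral_eq_integral(1) by (auto simp: o_def)
  have f'b: "cmod (f' x) \<le> H x" if "0 < x" for x
    unfolding f'_eq[OF that] H
    by (rule integral_norm_bound_integral) (use ni set_lebesgue_integral_eq_integral(1)[OF ai(3)] in auto)
  have Hmono: "H x \<le> H y" if "x \<le> y" for x y
    unfolding H by (rule integral_subset_le) (use that ni in auto)
  have H0: "0 \<le> H x" for x unfolding H by (rule integral_nonneg[OF ni]) simp
  have fb: "cmod (f x) \<le> x * H x" if x: "0 < x" for x
  proof -
    have "cmod (f x) \<le> integral {0..x} (\<lambda>s. if s = 0 then cmod (f' 0) else H x)"
      unfolding f_eq[OF x]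
    proof (rule integral_norm_bound_integral)
      show "f' integrable_on {0..x}" using ai(2) set_lebesgue_integral_eq_integral(1) by blast
      show "(\<lambda>s. if s = 0 then cmod (f' 0) else H x) integrable_on {0..x}"
        by (rule integrable_spike[of "\<lambda>s. H x" _ "{0}"]) auto
      show "cmod (f' s) \<le> (if s = 0 then cmod (f' 0) else H x)" if "s \<in> {0..x}" for s
        using f'b[of s] Hmono[of s x] that by auto
    qed
    also have "\<dots> = integral {0..x} (\<lambda>s. H x)" by (rule integral_spike[of "{0}"]) auto
    also have "\<dots> = x * H x" using x by simp
    finally show ?thesis .
  qed
  show thesis
    by (rule that[OF f(1,3,4,5,6)]) (use f'b fb in \<open>auto simp: H_def\<close>)
qed

definition cube :: "real \<Rightarrow> real" where "cube t = (max 0 t) ^ 3"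
definition cube' :: "real \<Rightarrow> real" where "cube' t = 3 * (max 0 t)\<^sup>2"
definition cube'' :: "real \<Rightarrow> real" where "cube'' t = 6 * max 0 t"

text \<open>A step from \<open>0\<close> to \<open>1\<close> on \<open>[0, 1]\<close>, of class
  \<open>C\<^sup>2\<close> because the cube of the positive part is.\<close>
definition smooth_step :: "real \<Rightarrow> real" where "smooth_step t = 1 - cube (1 - cube t)"
definition smooth_step' :: "real \<Rightarrow> real" where "smooth_step' t = cube' (1 - cube t) * cube' t"
definition smooth_step'' :: "real \<Rightarrow> real" where
  "smooth_step'' t = - (cube'' (1 - cube t) * cube' t) * cube' t + cube' (1 - cube t) * cube'' t"

lemma cube_deriv: "(cube has_real_derivative cube' t) (at t)" "(cube' has_real_derivative cube'' t) (at t)"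
proof -
  show "(cube has_real_derivative cube' t) (at t)"
    using deriv_max_power[of 1 t] unfolding cube_def cube'_def by (simp add: numeral_eq_Suc)
  show "(cube' has_real_derivative cube'' t) (at t)"
    using DERIV_cmult[OF deriv_max_power[of 0 t], of 3] unfolding cube'_def cube''_def by (simp add: numeral_2_eq_2)
qed

lemma smooth_step_deriv:
  "(smooth_step has_real_derivative smooth_step' t) (at t)"
  "(smooth_step' has_real_derivative smooth_step'' t) (at t)"
proof -
  have 1: "((\<lambda>t. 1 - cube t) has_real_derivative - cube' t) (at t)"
    using DERIV_diff[OF DERIV_const cube_deriv(1)] by simp
  have 2: "((\<lambda>t. cube (1 - cube t)) has_real_derivative cube' (1 - cube t) * - cube' t) (at t)"
    by (rule DERIV_chain2[OF cube_deriv(1) 1])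
  have 3: "((\<lambda>t. cube' (1 - cube t)) has_real_derivative cube'' (1 - cube t) * - cube' t) (at t)"
    by (rule DERIV_chain2[OF cube_deriv(2) 1])
  show "(smooth_step has_real_derivative smooth_step' t) (at t)"
    using DERIV_diff[OF DERIV_const 2] unfolding smooth_step_def smooth_step'_def by simp
  show "(smooth_step' has_real_derivative smooth_step'' t) (at t)"
    using DERIV_mult[OF 3 cube_deriv(2)] unfolding smooth_step'_def smooth_step''_def by (simp add: algebra_simps)
qed

lemma cube_unit: "0 \<le> t \<Longrightarrow> t \<le> 1 \<Longrightarrow> 0 \<le> cube t \<and> cube t \<le> 1"
  by (simp add: cube_def power_le_one)

lemma cube'_unit: "t \<le> 1 \<Longrightarrow> 0 \<le> cube' t \<and> cube' t \<le> 3"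
  by (simp add: cube'_def power_le_one)

lemma cube''_unit: "t \<le> 1 \<Longrightarrow> 0 \<le> cube'' t \<and> cube'' t \<le> 6"
  by (simp add: cube''_def)

lemma smooth_step_left: "t \<le> 0 \<Longrightarrow> smooth_step t = 0 \<and> smooth_step' t = 0 \<and> smooth_step'' t = 0"
  by (simp add: smooth_step_def smooth_step'_def smooth_step''_def cube_def cube'_def cube''_def max_def)

lemma smooth_step_right: "1 \<le> t \<Longrightarrow> smooth_step t = 1 \<and> smooth_step' t = 0 \<and> smooth_step'' t = 0"
proof -
  assume t: "1 \<le> t"
  then have "1 \<le> cube t" by (simp add: cube_def one_le_power)
  then have "max 0 (1 - cube t) = 0" by simp
  then show ?thesis
    by (simp add: smooth_step_def smooth_step'_def smooth_step''_def cube_def[of "1 - cube t"] cube'_def[of "1 - cube t"] cube''_def[of "1 - cube t"])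
qed

lemma smooth_step_bounds: "0 \<le> smooth_step t" "smooth_step t \<le> 1" "\<bar>smooth_step' t\<bar> \<le> 9" "\<bar>smooth_step'' t\<bar> \<le> 72"
proof -
  consider "t \<le> 0" | "1 \<le> t" | "0 \<le> t" "t \<le> 1" by linarith
  then have "0 \<le> smooth_step t \<and> smooth_step t \<le> 1 \<and> \<bar>smooth_step' t\<bar> \<le> 9 \<and> \<bar>smooth_step'' t\<bar> \<le> 72"
  proof cases
    case 3
    define w where "w = 1 - cube t"
    have w: "0 \<le> w" "w \<le> 1" using cube_unit[OF 3] by (auto simp: w_def)
    have a: "0 \<le> cube' w" "cube' w \<le> 3" "0 \<le> cube' t" "cube' t \<le> 3" "0 \<le> cube'' w" "cube'' w \<le> 6" "0 \<le> cube'' t" "cube'' t \<le> 6"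
      using cube'_unit[OF w(2)] cube'_unit[OF 3(2)] cube''_unit[OF w(2)] cube''_unit[OF 3(2)] by auto
    have b1: "cube' w * cube' t \<le> 3 * 3"
      by (intro mult_mono) (use a in auto)
    have c1: "cube'' w * cube' t * cube' t \<le> 6 * 3 * 3"
      by (intro mult_mono mult_nonneg_nonneg) (use a in auto)
    have d1: "cube' w * cube'' t \<le> 3 * 6"
      by (intro mult_mono) (use a in auto)
    have b: "0 \<le> cube' w * cube' t" "0 \<le> cube'' w * cube' t * cube' t" "0 \<le> cube' w * cube'' t"
      using a by auto
    show ?thesis
      using cube_unit[OF w] b b1 c1 d1 unfolding smooth_step_def smooth_step'_def smooth_step''_def w_def[symmetric]
      by (auto simp: abs_le_iff)
  qed (use smooth_step_left smooth_step_right in auto)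
  then show "0 \<le> smooth_step t" "smooth_step t \<le> 1" "\<bar>smooth_step' t\<bar> \<le> 9" "\<bar>smooth_step'' t\<bar> \<le> 72" by auto
qed

text \<open>The derivatives live where \<open>1 \<le> c x \<le> 2\<close>, and there \<open>c \<le> 2 / x\<close>. So
  the bounds do not depend on \<open>c\<close>.\<close>
lemma smooth_step_scaled_bounds:
  assumes c: "0 < c" and x: "0 < x"
  shows "\<bar>c * smooth_step' (c * x - 1)\<bar> \<le> 18 / x" "\<bar>c\<^sup>2 * smooth_step'' (c * x - 1)\<bar> \<le> 288 / x\<^sup>2"
proof -
  have "\<bar>c * smooth_step' (c * x - 1)\<bar> \<le> 18 / x \<and> \<bar>c\<^sup>2 * smooth_step'' (c * x - 1)\<bar> \<le> 288 / x\<^sup>2"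
  proof (cases "c * x \<le> 2")
    case True
    then have cx: "c \<le> 2 / x" using x by (simp add: field_simps)
    have "\<bar>c * smooth_step' (c * x - 1)\<bar> \<le> 2 / x * 9"
      unfolding abs_mult using c x cx smooth_step_bounds by (intro mult_mono) auto
    moreover have "\<bar>c\<^sup>2 * smooth_step'' (c * x - 1)\<bar> \<le> (2 / x)\<^sup>2 * 72"
      unfolding abs_mult using c x cx smooth_step_bounds by (intro mult_mono) (auto intro: power_mono)
    ultimately show ?thesis by (simp add: power_divide)
  next
    case False
    then show ?thesis using smooth_step_right[of "c * x - 1"] x by simp
  qed
  then show "\<bar>c * smooth_step' (c * x - 1)\<bar> \<le> 18 / x" "\<bar>c\<^sup>2 * smooth_step'' (c * x - 1)\<bar> \<le> 288 / x\<^sup>2" by auto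
qed

text \<open>For \<open>c \<ge> 2\<close> this is \<open>1\<close> on \<open>[2 / c, c]\<close> and vanishes off
  \<open>[1 / c, 2 c]\<close>.\<close>
definition window :: "real \<Rightarrow> real \<Rightarrow> real" where
  "window c x = smooth_step (c * x - 1) * (1 - smooth_step (1 / c * x - 1))"
definition window' :: "real \<Rightarrow> real \<Rightarrow> real" where
  "window' c x = c * smooth_step' (c * x - 1) * (1 - smooth_step (1 / c * x - 1))
     - smooth_step (c * x - 1) * (1 / c * smooth_step' (1 / c * x - 1))"
definition window'' :: "real \<Rightarrow> real \<Rightarrow> real" where
  "window'' c x = c\<^sup>2 * smooth_step'' (c * x - 1) * (1 - smooth_step (1 / c * x - 1))
     - 2 * (c * smooth_step' (c * x - 1)) * (1 / c * smooth_step' (1 / c * x - 1))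
     - smooth_step (c * x - 1) * ((1 / c)\<^sup>2 * smooth_step'' (1 / c * x - 1))"

lemma window_deriv:
  "(window c has_real_derivative window' c x) (at x)"
  "(window' c has_real_derivative window'' c x) (at x)"
proof -
  have A: "((\<lambda>x. smooth_step (k * x - 1)) has_real_derivative k * smooth_step' (k * x - 1)) (at x)" for k
    by (rule DERIV_cong[OF DERIV_chain2[OF smooth_step_deriv(1)]]) (auto intro!: derivative_eq_intros)
  have A': "((\<lambda>x. k * smooth_step' (k * x - 1)) has_real_derivative k\<^sup>2 * smooth_step'' (k * x - 1)) (at x)" for k
    by (rule DERIV_cong[OF DERIV_cmult[OF DERIV_chain2[OF smooth_step_deriv(2)]]]) (auto intro!: derivative_eq_intros simp: power2_eq_square)
  have B: "((\<lambda>x. 1 - smooth_step (1 / c * x - 1)) has_real_derivative - (1 / c * smooth_step' (1 / c * x - 1))) (at x)"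
    using DERIV_diff[OF DERIV_const A[of "1 / c"]] by simp
  show "(window c has_real_derivative window' c x) (at x)"
    unfolding window_def window'_def
    by (rule DERIV_cong[OF DERIV_mult[OF A B]]) (simp add: algebra_simps)
  show "(window' c has_real_derivative window'' c x) (at x)"
    unfolding window'_def window''_def
    by (rule DERIV_cong[OF DERIV_diff[OF DERIV_mult[OF A' B] DERIV_mult[OF A A'[of "1 / c"]]]]) (simp add: algebra_simps)
qed

lemma window_bounds:
  assumes c: "0 < c" and x: "0 < x"
  shows "0 \<le> window c x" "window c x \<le> 1" "\<bar>window' c x\<bar> \<le> 36 / x" "\<bar>window'' c x\<bar> \<le> 1224 / x\<^sup>2"
proof -
  define S1 where "S1 = smooth_step (c * x - 1)"
  define S2 where "S2 = 1 - smooth_step (1 / c * x - 1)"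
  define p where "p = c * smooth_step' (c * x - 1)"
  define q where "q = 1 / c * smooth_step' (1 / c * x - 1)"
  define r where "r = c\<^sup>2 * smooth_step'' (c * x - 1)"
  define t where "t = (1 / c)\<^sup>2 * smooth_step'' (1 / c * x - 1)"
  have S: "0 \<le> S1" "S1 \<le> 1" "0 \<le> S2" "S2 \<le> 1" using smooth_step_bounds by (auto simp: S1_def S2_def)
  have b: "\<bar>p\<bar> \<le> 18 / x" "\<bar>q\<bar> \<le> 18 / x" "\<bar>r\<bar> \<le> 288 / x\<^sup>2" "\<bar>t\<bar> \<le> 288 / x\<^sup>2"
  proof -
    have c': "0 < 1 / c" using c by simp
    show "\<bar>p\<bar> \<le> 18 / x" "\<bar>r\<bar> \<le> 288 / x\<^sup>2"
      unfolding p_def r_def by (rule smooth_step_scaled_bounds[OF c x])+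
    show "\<bar>q\<bar> \<le> 18 / x" "\<bar>t\<bar> \<le> 288 / x\<^sup>2"
      unfolding q_def t_def by (rule smooth_step_scaled_bounds[OF c' x])+
  qed
  show "0 \<le> window c x" "window c x \<le> 1"
    unfolding window_def S1_def[symmetric] S2_def[symmetric] using S by (auto intro: mult_le_one)
  have m: "\<bar>y * z\<bar> \<le> \<bar>y\<bar>" if "0 \<le> z" "z \<le> 1" for y z :: real
    using that by (simp add: abs_mult mult_left_le)
  have "\<bar>window' c x\<bar> = \<bar>p * S2 - q * S1\<bar>" unfolding window'_def S1_def S2_def p_def q_def by (simp add: mult.commute)
  also have "\<dots> \<le> \<bar>p\<bar> + \<bar>q\<bar>" using abs_triangle_ineq4[of "p * S2" "q * S1"] m[OF S(3,4), of p] m[OF S(1,2), of q] by linarith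
  also have "\<dots> \<le> 18 / x + 18 / x" using b by (intro add_mono)
  finally show "\<bar>window' c x\<bar> \<le> 36 / x" by simp
  have "\<bar>window'' c x\<bar> = \<bar>r * S2 - 2 * (p * q) - t * S1\<bar>"
    unfolding window''_def S1_def S2_def p_def q_def r_def t_def by (simp add: mult.commute mult.left_commute)
  also have "\<dots> \<le> \<bar>r\<bar> + 2 * \<bar>p * q\<bar> + \<bar>t\<bar>"
    using m[OF S(3,4), of r] m[OF S(1,2), of t] by linarith
  also have "\<bar>p * q\<bar> \<le> (18 / x) * (18 / x)" unfolding abs_mult using b x by (intro mult_mono) auto
  also have "(18 / x) * (18 / x) = 324 / x\<^sup>2" by (simp add: power2_eq_square)
  finally have "\<bar>window'' c x\<bar> \<le> 288 / x\<^sup>2 + 2 * (324 / x\<^sup>2) + 288 / x\<^sup>2" using b by linarith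
  then show "\<bar>window'' c x\<bar> \<le> 1224 / x\<^sup>2" by (simp add: add_divide_distrib[symmetric])
qed

lemma window_outside: "0 < c \<Longrightarrow> x \<notin> {1 / c..2 * c} \<Longrightarrow> window c x = 0"
proof -
  assume c: "0 < c" and x: "x \<notin> {1 / c..2 * c}"
  then consider "c * x - 1 \<le> 0" | "1 \<le> 1 / c * x - 1" by (fastforce simp: field_simps)
  then show ?thesis unfolding window_def using smooth_step_left[of "c * x - 1"] smooth_step_right[of "1 / c * x - 1"] by cases auto
qed

lemma window_eventually:
  assumes x: "0 < x"
  shows "\<forall>\<^sub>F n in sequentially. window (real (Suc n)) x = 1 \<and> window' (real (Suc n)) x = 0 \<and> window'' (real (Suc n)) x = 0"
proof -
  obtain n1 :: nat where n1: "2 / x < real n1" using reals_Archimedean2 by blast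
  obtain n2 :: nat where n2: "x < real n2" using reals_Archimedean2 by blast
  show ?thesis
  proof (rule eventually_sequentiallyI[of "n1 + n2"])
    fix n assume n: "n1 + n2 \<le> n"
    define c where "c = real (Suc n)"
    have c: "0 < c" "2 / x < c" "x < c" using n n1 n2 by (auto simp: c_def)
    have 1: "1 \<le> c * x - 1" using c x by (simp add: field_simps)
    have 2: "1 / c * x - 1 \<le> 0" using c x by (simp add: field_simps)
    show "window (real (Suc n)) x = 1 \<and> window' (real (Suc n)) x = 0 \<and> window'' (real (Suc n)) x = 0"
      unfolding window_def window'_def window''_def c_def[symmetric]
      using smooth_step_right[OF 1] smooth_step_left[OF 2] by simp
  qed
qed

text \<open>The product of \<open>f\<close> with windows \<open>q n\<close> that exhaust the half-line has compact
  support. The commutator terms \<open>2 f' (q n)' + f (q n)''\<close> tend to zero pointwise and are bounded by a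
  multiple of \<open>|f'| / x + |f| / x\<^sup>2\<close>, uniformly in \<open>n\<close>; this bound is square-integrable
  by Hardy's inequality, so the convergence is dominated.\<close>
lemma H02_subset_bessel_min:
  assumes u: "u \<in> H02"
  shows "\<exists>v. (u, v) \<in> bessel_min \<nu>"
proof -
  obtain f f' f'' where f: "square_integrable f" "square_integrable f''" "u = L2_class f"
    "\<And>x. 0 < x \<Longrightarrow> (f has_vector_derivative f' x) (at x)" "primitive f' f''"
    and f'b: "\<And>x. 0 < x \<Longrightarrow> cmod (f' x) \<le> weighted_integral (1/2) f'' x"
    and fb: "\<And>x. 0 < x \<Longrightarrow> cmod (f x) \<le> x * weighted_integral (1/2) f'' x"
    by (rule H02_cases[OF u]) (rule that; assumption)
  let ?V = "\<lambda>x. complex_of_real (bessel_V \<nu> x)"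
  define P where "P x = weighted_integral (1/2) f'' x / x" for x
  have Psq: "square_integrable (\<lambda>x. complex_of_real (P x))"
  proof (rule square_integrable_cong_AE[OF hardy_inequality[OF f(2), of "1/2"]])
    show "AE x in half_line. complex_of_real (x powr (1/2 - 3/2) * weighted_integral (1/2) f'' x) = complex_of_real (P x)"
    proof (rule AE_half_line_I)
      fix x :: real assume x: "0 < x"
      have "x powr (1/2 - 3/2) = 1 / x" using x by (simp add: powr_minus_divide)
      then show "complex_of_real (x powr (1/2 - 3/2) * weighted_integral (1/2) f'' x) = complex_of_real (P x)"
        by (simp only: P_def times_divide_eq_left mult_1_left)
    qed
    have "primitive (weighted_integral (1/2) f'') (\<lambda>s. s powr (1/2 - 1/2) * cmod (f'' s))"
      by (rule primitive_weighted_integral[OF f(2)]) simp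
    then show "(\<lambda>x. complex_of_real (P x)) \<in> borel_measurable half_line"
      unfolding P_def
      by (intro continuous_imp_half_line_measurable continuous_intros primitive_continuous_on[of "weighted_integral (1/2) f''"]) auto
  qed simp
  have P0: "0 \<le> P x" if "0 < x" for x
    using weighted_integral_nonneg[OF f(2), of "1/2" x] that by (simp add: P_def)
  have bf: "cmod (f x) / x\<^sup>2 \<le> P x" and bf': "cmod (f' x) / x \<le> P x" if "0 < x" for x
    using fb[OF that] f'b[OF that] that unfolding P_def by (simp_all add: field_simps power2_eq_square)
  have fc: "continuous_on {0<..} f" "continuous_on {0<..} f'"
    using has_vector_derivative_imp_continuous_on[OF f(4)] primitive_continuous_on[OF f(5)] by auto
  define g where "g x = ?V x * f x - f'' x" for x
  have "square_integrable (\<lambda>x. ?V x * f x)"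
  proof (rule square_integrable_bound[OF _ Psq, where C="\<bar>\<nu>\<^sup>2 - 1/4\<bar>"])
    show "(\<lambda>x. ?V x * f x) \<in> borel_measurable half_line"
      by (intro continuous_imp_half_line_measurable continuous_intros continuous_on_bessel_V fc)
    show "AE x in half_line. cmod (?V x * f x) \<le> \<bar>\<nu>\<^sup>2 - 1/4\<bar> * cmod (complex_of_real (P x))"
    proof (rule AE_half_line_I)
      fix x :: real assume x: "0 < x"
      have "cmod (?V x * f x) = \<bar>\<nu>\<^sup>2 - 1/4\<bar> * (cmod (f x) / x\<^sup>2)"
        by (simp only: norm_mult norm_of_real bessel_V_def abs_divide abs_power2 times_divide_eq_left times_divide_eq_right)
      also have "\<dots> \<le> \<bar>\<nu>\<^sup>2 - 1/4\<bar> * P x" by (intro mult_left_mono bf x) simp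
      finally show "cmod (?V x * f x) \<le> \<bar>\<nu>\<^sup>2 - 1/4\<bar> * cmod (complex_of_real (P x))"
        using P0[OF x] by simp
    qed
  qed
  then have gsq: "square_integrable g" unfolding g_def by (intro square_integrable_diff f)
  define q where "q n = window (real (Suc n))" for n
  define q' where "q' n = window' (real (Suc n))" for n
  define q'' where "q'' n = window'' (real (Suc n))" for n
  have qd: "(q n has_real_derivative q' n x) (at x)" "(q' n has_real_derivative q'' n x) (at x)" for n x
    unfolding q_def q'_def q''_def by (rule window_deriv)+
  have cq: "continuous_on S (q n)" "continuous_on S (q' n)" for S n
    using qd DERIV_isCont by (blast intro: continuous_at_imp_continuous_on)+
  have cq'': "continuous_on S (q'' n)" for S n
  proof -
    have cc: "continuous_on UNIV smooth_step" "continuous_on UNIV smooth_step'"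
      using smooth_step_deriv DERIV_isCont by (blast intro: continuous_at_imp_continuous_on)+
    have "continuous_on UNIV smooth_step''"
      unfolding smooth_step''_def cube_def cube'_def cube''_def by (intro continuous_intros)
    note c3 = continuous_on_compose2[OF cc(1)] continuous_on_compose2[OF cc(2)] continuous_on_compose2[OF this]
    show ?thesis unfolding q''_def window''_def by (intro continuous_intros c3) auto
  qed
  have qb: "0 \<le> q n x" "q n x \<le> 1" "\<bar>q' n x\<bar> \<le> 36 / x" "\<bar>q'' n x\<bar> \<le> 1224 / x\<^sup>2" if "0 < x" for n x
    unfolding q_def q'_def q''_def using window_bounds[of "real (Suc n)" x] that by auto
  define fn where "fn n x = f x * complex_of_real (q n x)" for n x
  define fn' where "fn' n x = f x * complex_of_real (q' n x) + f' x * complex_of_real (q n x)" for n x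
  define gn where "gn n x = g x * complex_of_real (q n x) - (2 * (f' x * complex_of_real (q' n x)) + f x * complex_of_real (q'' n x))" for n x
  have vd: "((\<lambda>x. complex_of_real (q n x)) has_vector_derivative complex_of_real (q' n x)) (at x)"
    "((\<lambda>x. complex_of_real (q' n x)) has_vector_derivative complex_of_real (q'' n x)) (at x)" for n x
    using qd[of n x] unfolding has_real_derivative_iff_has_vector_derivative
    by (auto intro!: bounded_linear.has_vector_derivative[OF bounded_linear_of_real])
  have pq: "primitive (\<lambda>x. complex_of_real (q n x)) (\<lambda>x. complex_of_real (q' n x))"
    "primitive (\<lambda>x. complex_of_real (q' n x)) (\<lambda>x. complex_of_real (q'' n x))" for n
    by (rule primitive_of_C1[OF vd(1)], intro continuous_intros cq, rule primitive_of_C1[OF vd(2)], intro continuous_intros cq'')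
  have pf: "primitive f f'" by (rule primitive_of_C1[OF f(4) fc(2)])
  have pair: "bessel_pair \<nu> (fn n) (fn' n) (gn n)" for n
    unfolding bessel_pair_def
  proof (intro conjI allI impI)
    show "(fn n has_vector_derivative fn' n x) (at x)" if "0 < x" for x
      unfolding fn_def fn'_def by (rule has_vector_derivative_mult[OF f(4)[OF that] vd(1)])
    have "primitive (fn' n) (\<lambda>x. (f x * complex_of_real (q'' n x) + f' x * complex_of_real (q' n x))
        + (f' x * complex_of_real (q' n x) + f'' x * complex_of_real (q n x)))"
      unfolding fn'_def by (intro primitive_add primitive_mult pf pq f(5))
    moreover have "(\<lambda>x. (f x * complex_of_real (q'' n x) + f' x * complex_of_real (q' n x))
        + (f' x * complex_of_real (q' n x) + f'' x * complex_of_real (q n x))) = (\<lambda>x. ?V x * fn n x - gn n x)"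
      by (auto simp: fn_def gn_def g_def algebra_simps)
    ultimately show "primitive (fn' n) (\<lambda>x. ?V x * fn n x - gn n x)" by simp
  qed
  have [measurable]: "f \<in> borel_measurable half_line" "f' \<in> borel_measurable half_line" "g \<in> borel_measurable half_line"
    "(\<lambda>x. complex_of_real (q n x)) \<in> borel_measurable half_line" "(\<lambda>x. complex_of_real (q' n x)) \<in> borel_measurable half_line"
    "(\<lambda>x. complex_of_real (q'' n x)) \<in> borel_measurable half_line" for n
    using fc gsq by (auto simp: square_integrable_measurable intro!: continuous_imp_half_line_measurable continuous_intros cq cq'')
  have fnsq: "square_integrable (fn n)" for n
  proof (rule square_integrable_bound[OF _ f(1), where C=1])
    show "fn n \<in> borel_measurable half_line" unfolding fn_def by measurable
    show "AE x in half_line. cmod (fn n x) \<le> 1 * cmod (f x)"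
      by (rule AE_half_line_I) (use qb in \<open>simp add: fn_def norm_mult mult_left_le\<close>)
  qed
  \<comment> \<open>the commutator of the differential expression with the window\<close>
  define R where "R n x = 2 * (f' x * complex_of_real (q' n x)) + f x * complex_of_real (q'' n x)" for n x
  have Rb: "cmod (R n x) \<le> 1296 * P x" if x: "0 < x" for n x
  proof -
    have "cmod (R n x) \<le> 2 * (cmod (f' x) * \<bar>q' n x\<bar>) + cmod (f x) * \<bar>q'' n x\<bar>"
      unfolding R_def by (rule order_trans[OF norm_triangle_ineq]) (simp add: norm_mult)
    also have "\<dots> \<le> 2 * (cmod (f' x) * (36 / x)) + cmod (f x) * (1224 / x\<^sup>2)"
      by (intro add_mono mult_left_mono qb x) auto
    also have "\<dots> = 72 * (cmod (f' x) / x) + 1224 * (cmod (f x) / x\<^sup>2)" by simp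
    also have "\<dots> \<le> 72 * P x + 1224 * P x" by (intro add_mono mult_left_mono bf bf' x) auto
    finally show ?thesis by simp
  qed
  have gn: "gn n x = g x * complex_of_real (q n x) - R n x" for n x by (simp add: gn_def R_def)
  have gnsq: "square_integrable (gn n)" for n
  proof -
    have "square_integrable (R n)"
    proof (rule square_integrable_bound[OF _ Psq, where C=1296])
      show "R n \<in> borel_measurable half_line" unfolding R_def by measurable
      show "AE x in half_line. cmod (R n x) \<le> 1296 * cmod (complex_of_real (P x))"
        by (rule AE_half_line_I) (use Rb P0 in simp)
    qed
    moreover have "square_integrable (\<lambda>x. g x * complex_of_real (q n x))"
    proof (rule square_integrable_bound[OF _ gsq, where C=1])
      show "(\<lambda>x. g x * complex_of_real (q n x)) \<in> borel_measurable half_line" by measurable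
      show "AE x in half_line. cmod (g x * complex_of_real (q n x)) \<le> 1 * cmod (g x)"
        by (rule AE_half_line_I) (use qb in \<open>simp add: norm_mult mult_left_le\<close>)
    qed
    ultimately show ?thesis unfolding gn by (intro square_integrable_diff)
  qed
  have pre: "(L2_class (fn n), L2_class (gn n)) \<in> bessel_pre \<nu>" for n
  proof (rule bessel_preI[OF fnsq gnsq pair])
    show "0 < 1 / real (Suc n)" by simp
    show "fn n x = 0" if "0 < x" "x \<notin> {1 / real (Suc n)..2 * real (Suc n)}" for x
      unfolding fn_def q_def using window_outside[OF _ that(2)] by simp
  qed
  have qev: "\<forall>\<^sub>F n in sequentially. q n x = 1 \<and> q' n x = 0 \<and> q'' n x = 0" if "0 < x" for x
    unfolding q_def q'_def q''_def by (rule window_eventually[OF that])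
  have q1: "cmod (h * complex_of_real (q n x) - h) \<le> cmod h" if "0 < x" for h n x
  proof -
    have "h * complex_of_real (q n x) - h = h * complex_of_real (q n x - 1)" by (simp add: algebra_simps)
    then have "cmod (h * complex_of_real (q n x) - h) = cmod h * \<bar>q n x - 1\<bar>" by (simp only: norm_mult norm_of_real)
    also have "\<dots> \<le> cmod h * 1" using qb[OF that, of n] by (intro mult_left_mono) auto
    finally show ?thesis by simp
  qed
  have lim1: "(\<lambda>n. L2_class (fn n)) \<longlonglongrightarrow> L2_class f"
  proof (rule L2_dominated_convergence[OF fnsq f(1) f(1)])
    show "cmod (fn n x - f x) \<le> cmod (f x)" if "0 < x" for n x unfolding fn_def by (rule q1[OF that])
    show "(\<lambda>n. fn n x) \<longlonglongrightarrow> f x" if "0 < x" for x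
      by (rule tendsto_eventually) (use qev[OF that] in eventually_elim, simp add: fn_def)
  qed
  define w where "w x = complex_of_real (cmod (g x)) + 1296 * complex_of_real (P x)" for x
  have wsq: "square_integrable w"
  proof -
    have "square_integrable (\<lambda>x. complex_of_real (cmod (g x)))"
      by (rule square_integrable_bound[OF _ gsq, where C=1]) (auto intro!: AE_half_line_I)
    then show ?thesis unfolding w_def by (intro square_integrable_add square_integrable_scale Psq)
  qed
  have lim2: "(\<lambda>n. L2_class (gn n)) \<longlonglongrightarrow> L2_class g"
  proof (rule L2_dominated_convergence[OF gnsq gsq wsq])
    show "cmod (gn n x - g x) \<le> cmod (w x)" if x: "0 < x" for n x
    proof -
      have "cmod (gn n x - g x) = cmod ((g x * complex_of_real (q n x) - g x) - R n x)" by (simp add: gn algebra_simps)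
      also have "\<dots> \<le> cmod (g x) + 1296 * P x"
        by (rule order_trans[OF norm_triangle_ineq4 add_mono]) (rule q1[OF x], rule Rb[OF x])
      also have "\<dots> = cmod (w x)"
      proof -
        have "w x = complex_of_real (cmod (g x) + 1296 * P x)" by (simp add: w_def)
        then show ?thesis using P0[OF x] by (simp only: norm_of_real) simp
      qed
      finally show ?thesis .
    qed
    show "(\<lambda>n. gn n x) \<longlonglongrightarrow> g x" if "0 < x" for x
      by (rule tendsto_eventually) (use qev[OF that] in eventually_elim, simp add: gn_def)
  qed
  have "(L2_class f, L2_class g) \<in> closure (bessel_pre \<nu>)"
    unfolding closure_sequential
    by (rule exI[of _ "\<lambda>n. (L2_class (fn n), L2_class (gn n))"]) (use pre lim1 lim2 in \<open>auto intro: tendsto_Pair\<close>)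
  then show ?thesis unfolding f(3) bessel_min_eq by blast
qed

section \<open>Solutions at nonreal energies\<close>

lemma integrable_exp_decay:
  assumes c: "0 < (c::real)" shows "integrable half_line (\<lambda>t. exp (- (c * t)))"
proof (rule integrable_half_line_bounded_integrals[where B="1 / c"])
  fix a b :: real assume ab: "0 < a" "a \<le> b"
  have "((\<lambda>t. exp (- (c * t))) has_integral (- exp (- (c * b)) / c - - exp (- (c * a)) / c)) {a..b}"
    by (rule fundamental_theorem_of_calculus[OF ab(2)])
      (use c in \<open>auto intro!: derivative_eq_intros simp flip: has_real_derivative_iff_has_vector_derivative\<close>)
  moreover have "- exp (- (c * b)) / c - - exp (- (c * a)) / c \<le> 1 / c"
  proof -
    have "exp (- (c * a)) \<le> 1" "0 \<le> exp (- (c * b))" using c ab by auto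
    then have "exp (- (c * a)) - exp (- (c * b)) \<le> 1" by linarith
    then have "(exp (- (c * a)) - exp (- (c * b))) / c \<le> 1 / c" using c by (intro divide_right_mono) auto
    then show ?thesis by (simp add: diff_divide_distrib)
  qed
  ultimately show "(\<lambda>t. exp (- (c * t))) integrable_on {a..b}" "integral {a..b} (\<lambda>t. exp (- (c * t))) \<le> 1 / c"
    by (auto simp: integral_unique)
qed simp

lemma power_le_fact_exp: "0 \<le> (x::real) \<Longrightarrow> x ^ n \<le> fact n * exp x"
proof -
  assume x: "0 \<le> x"
  have "(\<Sum>k\<in>{n}. x ^ k /\<^sub>R fact k) \<le> (\<Sum>k. x ^ k /\<^sub>R fact k)"
    by (rule sum_le_suminf) (use x summable_exp_generic[of x] in auto)
  then have "x ^ n / fact n \<le> exp x" by (simp add: exp_def divide_inverse mult.commute)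
  then show ?thesis by (simp add: divide_le_eq mult.commute)
qed

lemma cosh_power_exp_decay:
  fixes a :: real
  assumes a: "0 < a"
  obtains C where "0 \<le> C" "\<And>t. 0 < t \<Longrightarrow> cosh t ^ m * exp (- (a * cosh t)) \<le> C * exp (- t)"
proof
  define C where "C = 2 * (fact (Suc m) / a ^ Suc m)"
  show "0 \<le> C" using a by (simp add: C_def)
  fix t :: real assume t: "0 < t"
  have ch: "exp t / 2 \<le> cosh t" by (simp add: cosh_def)
  have ch0: "0 < cosh t" using ch exp_gt_zero[of t] by linarith
  have "(a * cosh t) ^ Suc m \<le> fact (Suc m) * exp (a * cosh t)"
    using a ch0 by (intro power_le_fact_exp) auto
  then have "a ^ Suc m * (cosh t ^ m * cosh t) \<le> fact (Suc m) * exp (a * cosh t)"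
    by (simp add: power_mult_distrib mult_ac)
  then have "(cosh t ^ m * exp (- (a * cosh t))) * (a ^ Suc m * cosh t) \<le> fact (Suc m) * (exp (a * cosh t) * exp (- (a * cosh t)))"
    using mult_right_mono[of "a ^ Suc m * (cosh t ^ m * cosh t)" "fact (Suc m) * exp (a * cosh t)" "exp (- (a * cosh t))"]
    by (simp add: mult_ac)
  then have "(cosh t ^ m * exp (- (a * cosh t))) * (a ^ Suc m * cosh t) \<le> fact (Suc m)"
    by (simp flip: exp_add)
  then have "cosh t ^ m * exp (- (a * cosh t)) \<le> fact (Suc m) / (a ^ Suc m * cosh t)"
    using a ch0 by (subst pos_le_divide_eq) auto
  also have "\<dots> = fact (Suc m) / a ^ Suc m * (1 / cosh t)" by simp
  also have "\<dots> \<le> fact (Suc m) / a ^ Suc m * (2 * exp (- t))"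
  proof (rule mult_left_mono)
    have "1 / cosh t \<le> 1 / (exp t / 2)" using ch by (intro divide_left_mono) (auto simp: ch0)
    also have "1 / (exp t / 2) = 2 * exp (- t)" by (simp add: exp_minus inverse_eq_divide)
    finally show "1 / cosh t \<le> 2 * exp (- t)" .
  qed (use a in simp)
  finally show "cosh t ^ m * exp (- (a * cosh t)) \<le> C * exp (- t)" by (simp only: C_def mult_ac)
qed

text \<open>The integral of the case \<open>n = 0\<close> is Macdonald's function \<open>K\<^sub>\<nu>(z)\<close>;
  each derivative in \<open>z\<close> contributes a factor \<open>- cosh t\<close>.\<close>
definition macdonald_integrand :: "real \<Rightarrow> nat \<Rightarrow> complex \<Rightarrow> real \<Rightarrow> complex" where
  "macdonald_integrand \<nu> n z t = complex_of_real (cosh t ^ n * cosh (\<nu> * t)) * exp (- (z * complex_of_real (cosh t)))"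

definition macdonald_moment :: "real \<Rightarrow> nat \<Rightarrow> complex \<Rightarrow> complex" where
  "macdonald_moment \<nu> n z = (LINT t|half_line. macdonald_integrand \<nu> n z t)"

lemma cosh_mono_nonneg: "0 \<le> (s::real) \<Longrightarrow> s \<le> t \<Longrightarrow> cosh s \<le> cosh t"
  using cosh_real_nonneg_le_iff[of s t] by simp

lemma macdonald_integrand_bound:
  assumes \<nu>: "0 \<le> \<nu>" "\<nu> \<le> 1" and z: "a \<le> Re z" and t: "0 < t"
  shows "cmod (macdonald_integrand \<nu> n z t) \<le> cosh t ^ Suc n * exp (- (a * cosh t))"
proof -
  have c: "0 < cosh t" by (rule cosh_real_pos)
  have "cosh (\<nu> * t) \<le> cosh t" using \<nu> t by (intro cosh_mono_nonneg) (auto simp: mult_left_le_one_le)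
  moreover have "0 < cosh (\<nu> * t)" by (rule cosh_real_pos)
  moreover have "cmod (macdonald_integrand \<nu> n z t) = cosh t ^ n * cosh (\<nu> * t) * exp (- (Re z * cosh t))"
    unfolding macdonald_integrand_def norm_mult norm_of_real norm_exp_eq_Re
    using c \<open>0 < cosh (\<nu> * t)\<close> by (simp add: abs_mult)
  moreover have "exp (- (Re z * cosh t)) \<le> exp (- (a * cosh t))" using z c by simp
  ultimately have "cmod (macdonald_integrand \<nu> n z t) \<le> cosh t ^ n * cosh t * exp (- (a * cosh t))"
    using c by (auto intro!: mult_mono)
  then show ?thesis by (simp add: mult.commute)
qed

lemma continuous_macdonald_integrand: "continuous_on S (macdonald_integrand \<nu> n z)"
  unfolding macdonald_integrand_def by (intro continuous_intros)

lemma macdonald_integrand_measurable: "macdonald_integrand \<nu> n z \<in> borel_measurable half_line"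
  by (rule continuous_imp_half_line_measurable[OF continuous_macdonald_integrand])

lemma integrable_cosh_power_exp:
  assumes "0 < a" shows "integrable half_line (\<lambda>t. cosh t ^ m * exp (- (a * cosh t)) :: real)"
proof -
  obtain C where C: "0 \<le> C" "\<And>t. 0 < t \<Longrightarrow> cosh t ^ m * exp (- (a * cosh t)) \<le> C * exp (- t)"
    using cosh_power_exp_decay[OF assms] by blast
  have "integrable half_line (\<lambda>t. C * exp (- (1 * t)))" using integrable_exp_decay[of 1] by simp
  then show ?thesis
  proof (rule Bochner_Integration.integrable_bound)
    show "(\<lambda>t. cosh t ^ m * exp (- (a * cosh t))) \<in> borel_measurable half_line"
      by (intro continuous_imp_half_line_measurable continuous_intros)
    show "AE t in half_line. norm (cosh t ^ m * exp (- (a * cosh t))) \<le> norm (C * exp (- (1 * t)))"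
      by (rule AE_half_line_I) (use C in simp)
  qed
qed

lemma integrable_macdonald_integrand:
  assumes "0 \<le> \<nu>" "\<nu> \<le> 1" "0 < Re z" shows "integrable half_line (macdonald_integrand \<nu> n z)"
  by (rule Bochner_Integration.integrable_bound[OF integrable_cosh_power_exp[OF assms(3), of "Suc n"] macdonald_integrand_measurable])
    (rule AE_half_line_I, use macdonald_integrand_bound[OF assms(1,2) order_refl] in force)

lemma macdonald_integrand_deriv:
  "((\<lambda>z. macdonald_integrand \<nu> n z t) has_field_derivative - macdonald_integrand \<nu> (Suc n) z t) (at z within S)"
  unfolding macdonald_integrand_def by (auto intro!: derivative_eq_intros)

text \<open>Differentiation under the integral sign: on the half-plane \<open>Re w > Re z / 2\<close> all difference
  quotients are dominated by a single integrable function.\<close>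
lemma macdonald_moment_deriv:
  assumes \<nu>: "0 \<le> \<nu>" "\<nu> \<le> 1" and z: "0 < Re z"
  shows "(macdonald_moment \<nu> n has_field_derivative - macdonald_moment \<nu> (Suc n) z) (at z)"
proof -
  define a where "a = Re z / 2"
  define S where "S = {w. a < Re w}"
  have a: "0 < a" "a < Re z" using z by (auto simp: a_def)
  have zS: "z \<in> S" using a by (simp add: S_def)
  have oS: "open S" "convex S" unfolding S_def by (rule open_halfspace_Re_gt, rule convex_halfspace_Re_gt)
  have ReS: "0 < Re w" if "w \<in> S" for w using that a by (simp add: S_def)
  have "((\<lambda>w. (macdonald_moment \<nu> n w - macdonald_moment \<nu> n z) / (w - z)) \<longlongrightarrow> - macdonald_moment \<nu> (Suc n) z) (at z within S)"
    unfolding tendsto_at_iff_sequentially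
  proof (intro allI impI)
    fix X assume X: "\<forall>i. X i \<in> S - {z}" and lim: "X \<longlonglongrightarrow> z"
    let ?q = "\<lambda>i t. (macdonald_integrand \<nu> n (X i) t - macdonald_integrand \<nu> n z t) / (X i - z)"
    have "(\<lambda>i. LINT t|half_line. ?q i t) \<longlonglongrightarrow> (LINT t|half_line. - macdonald_integrand \<nu> (Suc n) z t)"
    proof (rule integral_dominated_convergence)
      show "(\<lambda>t. - macdonald_integrand \<nu> (Suc n) z t) \<in> borel_measurable half_line"
        using macdonald_integrand_measurable by measurable
      have [measurable]: "macdonald_integrand \<nu> n w \<in> borel_measurable half_line" for w by (rule macdonald_integrand_measurable)
      show "?q i \<in> borel_measurable half_line" for i by measurable
      show "integrable half_line (\<lambda>t. cosh t ^ Suc (Suc n) * exp (- (a * cosh t)))" by (rule integrable_cosh_power_exp[OF a(1)])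
      show "AE t in half_line. (\<lambda>i. ?q i t) \<longlonglongrightarrow> - macdonald_integrand \<nu> (Suc n) z t"
      proof (rule AE_half_line_I)
        fix t :: real
        have "((\<lambda>w. (macdonald_integrand \<nu> n w t - macdonald_integrand \<nu> n z t) / (w - z)) \<longlongrightarrow> - macdonald_integrand \<nu> (Suc n) z t) (at z within S)"
          using macdonald_integrand_deriv[of \<nu> n t z S] by (simp add: has_field_derivative_iff)
        then show "(\<lambda>i. ?q i t) \<longlonglongrightarrow> - macdonald_integrand \<nu> (Suc n) z t"
          unfolding tendsto_at_iff_sequentially using X lim by (auto simp: o_def)
      qed
      show "AE t in half_line. norm (?q i t) \<le> cosh t ^ Suc (Suc n) * exp (- (a * cosh t))" for i
      proof (rule AE_half_line_I)
        fix t :: real assume t: "0 < t"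
        have "cmod (macdonald_integrand \<nu> n (X i) t - macdonald_integrand \<nu> n z t)
            \<le> (cosh t ^ Suc (Suc n) * exp (- (a * cosh t))) * cmod (X i - z)"
        proof (rule field_differentiable_bound[OF oS(2) macdonald_integrand_deriv])
          show "cmod (- macdonald_integrand \<nu> (Suc n) w t) \<le> cosh t ^ Suc (Suc n) * exp (- (a * cosh t))" if "w \<in> S" for w
            using macdonald_integrand_bound[OF \<nu> _ t, of a w "Suc n"] that by (simp add: S_def)
        qed (use X zS in auto)
        moreover have "0 < cmod (X i - z)" using X by auto
        ultimately show "norm (?q i t) \<le> cosh t ^ Suc (Suc n) * exp (- (a * cosh t))"
          unfolding norm_divide by (subst pos_divide_le_eq) auto
      qed
    qed
    moreover have "(LINT t|half_line. ?q i t) = (macdonald_moment \<nu> n (X i) - macdonald_moment \<nu> n z) / (X i - z)" for i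
    proof -
      have "X i \<in> S" using X by blast
      then show ?thesis
        using integrable_macdonald_integrand[OF \<nu> ReS[of "X i"], of n] integrable_macdonald_integrand[OF \<nu> z, of n]
        by (simp add: macdonald_moment_def)
    qed
    moreover have "(LINT t|half_line. - macdonald_integrand \<nu> (Suc n) z t) = - macdonald_moment \<nu> (Suc n) z"
      by (simp add: macdonald_moment_def)
    ultimately show "((\<lambda>w. (macdonald_moment \<nu> n w - macdonald_moment \<nu> n z) / (w - z)) \<circ> X) \<longlonglongrightarrow> - macdonald_moment \<nu> (Suc n) z"
      by (simp only: o_def)
  qed
  then show ?thesis using at_within_open[OF zS oS(1)] by (simp add: has_field_derivative_iff)
qed

text \<open>The modified Bessel equation. The corresponding combination of integrands is the derivative of
  \<open>G\<close>, which vanishes at zero and at infinity.\<close>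
lemma macdonald_equation:
  assumes \<nu>: "0 \<le> \<nu>" "\<nu> \<le> 1" and z: "0 < Re z"
  shows "z\<^sup>2 * macdonald_moment \<nu> 2 z - z * macdonald_moment \<nu> 1 z = (z\<^sup>2 + (complex_of_real \<nu>)\<^sup>2) * macdonald_moment \<nu> 0 z"
proof -
  define e where "e t = exp (- (z * complex_of_real (cosh t)))" for t
  define G where "G t = (- z * complex_of_real (sinh t * cosh (\<nu> * t)) - complex_of_real (\<nu> * sinh (\<nu> * t))) * e t" for t
  define g where "g t = z\<^sup>2 * macdonald_integrand \<nu> 2 z t - z * macdonald_integrand \<nu> 1 z t - (z\<^sup>2 + (complex_of_real \<nu>)\<^sup>2) * macdonald_integrand \<nu> 0 z t" for t
  have gi: "integrable half_line g"
    unfolding g_def using integrable_macdonald_integrand[OF assms] by simp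
  have ed: "(e has_vector_derivative - z * complex_of_real (sinh t) * e t) (at t)" for t
  proof -
    have "((\<lambda>t. complex_of_real (cosh t)) has_vector_derivative complex_of_real (sinh t)) (at t)"
      by (intro bounded_linear.has_vector_derivative[OF bounded_linear_of_real])
        (auto intro!: derivative_eq_intros simp flip: has_real_derivative_iff_has_vector_derivative)
    moreover have "((\<lambda>w. exp (- (z * w))) has_field_derivative - z * exp (- (z * complex_of_real (cosh t)))) (at (complex_of_real (cosh t)))"
      by (auto intro!: derivative_eq_intros)
    ultimately have "((\<lambda>w. exp (- (z * w))) \<circ> (\<lambda>t. complex_of_real (cosh t)) has_vector_derivative
        complex_of_real (sinh t) * (- z * exp (- (z * complex_of_real (cosh t))))) (at t)"
      by (rule field_vector_diff_chain_at)
    then show ?thesis unfolding e_def o_def by (simp add: mult_ac)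
  qed
  have rd: "((\<lambda>t. - z * complex_of_real (sinh t * cosh (\<nu> * t)) - complex_of_real (\<nu> * sinh (\<nu> * t))) has_vector_derivative
     (- z * complex_of_real (cosh t * cosh (\<nu> * t) + sinh t * (\<nu> * sinh (\<nu> * t))) - complex_of_real (\<nu> * (\<nu> * cosh (\<nu> * t))))) (at t)" for t
  proof -
    have 1: "((\<lambda>t. sinh t * cosh (\<nu> * t)) has_vector_derivative cosh t * cosh (\<nu> * t) + sinh t * (\<nu> * sinh (\<nu> * t))) (at t)"
      by (auto intro!: derivative_eq_intros simp flip: has_real_derivative_iff_has_vector_derivative simp: algebra_simps)
    have 2: "((\<lambda>t. \<nu> * sinh (\<nu> * t)) has_vector_derivative \<nu> * (\<nu> * cosh (\<nu> * t))) (at t)"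
      by (auto intro!: derivative_eq_intros simp flip: has_real_derivative_iff_has_vector_derivative simp: algebra_simps)
    show ?thesis
      by (intro has_vector_derivative_diff has_vector_derivative_mult_right
         bounded_linear.has_vector_derivative[OF bounded_linear_of_real] 1 2)
  qed
  have Gd: "(G has_vector_derivative g t) (at t)" for t
  proof -
    have "(G has_vector_derivative
       (- z * complex_of_real (sinh t * cosh (\<nu> * t)) - complex_of_real (\<nu> * sinh (\<nu> * t))) * (- z * complex_of_real (sinh t) * e t)
       + (- z * complex_of_real (cosh t * cosh (\<nu> * t) + sinh t * (\<nu> * sinh (\<nu> * t))) - complex_of_real (\<nu> * (\<nu> * cosh (\<nu> * t)))) * e t) (at t)"
      unfolding G_def by (rule has_vector_derivative_mult[OF rd ed])
    moreover have "(- z * complex_of_real (sinh t * cosh (\<nu> * t)) - complex_of_real (\<nu> * sinh (\<nu> * t))) * (- z * complex_of_real (sinh t) * e t)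
       + (- z * complex_of_real (cosh t * cosh (\<nu> * t) + sinh t * (\<nu> * sinh (\<nu> * t))) - complex_of_real (\<nu> * (\<nu> * cosh (\<nu> * t)))) * e t
      = z\<^sup>2 * complex_of_real ((sinh t)\<^sup>2 * cosh (\<nu> * t)) * e t - z * complex_of_real (cosh t * cosh (\<nu> * t)) * e t - complex_of_real (\<nu>\<^sup>2 * cosh (\<nu> * t)) * e t"
      by (simp add: algebra_simps power2_eq_square)
    moreover have "\<dots> = g t"
      unfolding g_def macdonald_integrand_def e_def[symmetric]
      by (simp add: sinh_square_eq algebra_simps)
    ultimately show ?thesis by simp
  qed
  have "continuous_on {0<..} g" unfolding g_def by (intro continuous_intros continuous_macdonald_integrand)
  then have PG: "primitive G g" using Gd by (intro primitive_of_C1)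
  obtain L where L: "\<And>x. 0 < x \<Longrightarrow> G x = L + integral {0..x} g"
    using primitive_eq_from_0[OF PG absolutely_integrable_Icc_0[OF gi]] by blast
  have "isCont G 0" using Gd has_vector_derivative_continuous by blast
  then have "(G \<longlongrightarrow> G 0) (at_right 0)" unfolding isCont_def by (rule tendsto_within_subset) simp
  then have "(G \<longlongrightarrow> 0) (at_right 0)" by (simp add: G_def)
  then have L0: "L = 0" using primitive_boundary_limit[OF L absolutely_integrable_Icc_0[OF gi]] by blast
  obtain C where C: "0 \<le> C" "\<And>t. 0 < t \<Longrightarrow> cosh t ^ 2 * exp (- (Re z * cosh t)) \<le> C * exp (- t)"
    using cosh_power_exp_decay[OF z] by blast
  have Gb: "cmod (G t) \<le> (cmod z + 1) * (C * exp (- t))" if t: "0 < t" for t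
  proof -
    have c: "1 \<le> cosh t" by (rule cosh_real_ge_1)
    have s: "0 \<le> sinh t" "sinh t \<le> cosh t" using t sinh_less_cosh_real[of t] by (auto intro: less_imp_le)
    have \<nu>t: "0 \<le> \<nu> * t" "\<nu> * t \<le> t" using \<nu> t by (auto simp: mult_left_le_one_le)
    have c2: "cosh (\<nu> * t) \<le> cosh t" by (rule cosh_mono_nonneg[OF \<nu>t])
    have s2: "0 \<le> sinh (\<nu> * t)" "sinh (\<nu> * t) \<le> cosh t"
      using \<nu>t sinh_less_cosh_real[of "\<nu> * t"] c2 by auto
    have c3: "0 < cosh (\<nu> * t)" by (rule cosh_real_pos)
    have A: "sinh t * cosh (\<nu> * t) \<le> cosh t ^ 2"
      unfolding power2_eq_square using s c2 c c3 by (intro mult_mono) auto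
    have "\<nu> * sinh (\<nu> * t) \<le> 1 * cosh t" using \<nu> s2 by (intro mult_mono) auto
    also have "\<dots> \<le> cosh t ^ 2" using c unfolding power2_eq_square by simp
    finally have B: "\<nu> * sinh (\<nu> * t) \<le> cosh t ^ 2" .
    have "cmod (- z * complex_of_real (sinh t * cosh (\<nu> * t)) - complex_of_real (\<nu> * sinh (\<nu> * t)))
       \<le> cmod z * (sinh t * cosh (\<nu> * t)) + \<nu> * sinh (\<nu> * t)"
      by (rule order_trans[OF norm_triangle_ineq4]) (use s s2 \<nu> c3 in \<open>simp add: norm_mult abs_mult\<close>)
    also have "\<dots> \<le> cmod z * cosh t ^ 2 + cosh t ^ 2" by (intro add_mono mult_left_mono A B) simp
    finally have D: "cmod (- z * complex_of_real (sinh t * cosh (\<nu> * t)) - complex_of_real (\<nu> * sinh (\<nu> * t))) \<le> (cmod z + 1) * cosh t ^ 2"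
      by (simp add: algebra_simps)
    have "cmod (e t) = exp (- (Re z * cosh t))" unfolding e_def norm_exp_eq_Re by simp
    then have "cmod (G t) \<le> ((cmod z + 1) * cosh t ^ 2) * exp (- (Re z * cosh t))"
      unfolding G_def norm_mult using D by (simp add: mult_right_mono norm_mult)
    also have "\<dots> = (cmod z + 1) * (cosh t ^ 2 * exp (- (Re z * cosh t)))" by (simp only: mult.assoc)
    also have "\<dots> \<le> (cmod z + 1) * (C * exp (- t))" by (intro mult_left_mono C t) simp
    finally show ?thesis .
  qed
  have "(\<lambda>n. integral {0..real n} g) \<longlonglongrightarrow> 0"
  proof (rule Lim_null_comparison)
    show "\<forall>\<^sub>F n in sequentially. cmod (integral {0..real n} g) \<le> (cmod z + 1) * (C * exp (- real n))"
    proof (rule eventually_sequentiallyI[of 1])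
      fix n :: nat assume "1 \<le> n"
      then have n: "0 < real n" by simp
      show "cmod (integral {0..real n} g) \<le> (cmod z + 1) * (C * exp (- real n))"
        using L[OF n] L0 Gb[OF n] by simp
    qed
    have "(\<lambda>n. exp (- real n)) \<longlonglongrightarrow> 0"
      by (rule filterlim_compose[OF exp_at_bot]) (rule filterlim_compose[OF filterlim_uminus_at_bot_at_top filterlim_real_sequentially])
    from tendsto_mult[OF tendsto_const[of "(cmod z + 1) * C"] this]
    show "(\<lambda>n. (cmod z + 1) * (C * exp (- real n))) \<longlonglongrightarrow> 0" by (simp add: mult.assoc)
  qed
  from LIMSEQ_unique[OF integral_to_infinity[OF gi] this] have "(LINT t|half_line. g t) = 0" .
  then have "z\<^sup>2 * macdonald_moment \<nu> 2 z - z * macdonald_moment \<nu> 1 z - (z\<^sup>2 + (complex_of_real \<nu>)\<^sup>2) * macdonald_moment \<nu> 0 z = 0"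
    unfolding g_def macdonald_moment_def using integrable_macdonald_integrand[OF assms] by simp
  then show ?thesis by simp
qed


lemma exp_minus_le_powr:
  fixes y m :: real
  assumes "0 < y" "0 < m" "m \<le> 2"
  shows "exp (- y) \<le> 2 * y powr (- m)"
proof -
  have "y powr m \<le> 1 + y\<^sup>2"
  proof (cases "y \<le> 1")
    case True
    then have "y powr m \<le> 1" using assms by (simp add: powr_le1)
    then show ?thesis by (simp add: add_increasing2)
  next
    case False
    then have "y powr m \<le> y powr 2" using assms by (intro powr_mono) auto
    then show ?thesis using assms by (simp add: powr_numeral)
  qed
  also have "\<dots> \<le> 2 * exp y" using exp_lower_Taylor_quadratic[of y] assms by simp
  finally have "y powr m * exp (- y) \<le> 2 * exp y * exp (- y)" by (rule mult_right_mono) simp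
  also have "2 * exp y * exp (- y) = 2" by (simp add: exp_minus)
  finally have "y powr m * exp (- y) \<le> 2" .
  then have "exp (- y) \<le> 2 / y powr m" using assms by (simp add: pos_le_divide_eq mult.commute)
  then show ?thesis by (simp add: powr_minus divide_inverse)
qed

text \<open>To be used with \<open>m\<close> slightly larger than \<open>\<nu>\<close> near zero and with \<open>m =
  2\<close> at infinity. It follows from \<open>exp (- y) \<le> 2 y powr (- m)\<close> for \<open>y = x Re k cosh
  t\<close>, as \<open>cosh t \<ge> exp t / 2\<close>.\<close>
lemma macdonald_bound:
  assumes \<nu>: "0 \<le> \<nu>" and m: "\<nu> < m" "m \<le> 2" and k: "0 < Re k"
  obtains C where "0 \<le> C" "\<And>x. 0 < x \<Longrightarrow> cmod (macdonald_moment \<nu> 0 (complex_of_real x * k)) \<le> C * x powr (- m)"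
proof
  define D where "D x = 2 * (Re k / 2 * x) powr (- m)" for x
  define J where "J = (LINT t|half_line. exp (- ((m - \<nu>) * t)))"
  have Ji: "integrable half_line (\<lambda>t. exp (- ((m - \<nu>) * t)))" by (rule integrable_exp_decay) (use m in simp)
  have J0: "0 \<le> J" unfolding J_def by simp
  show "0 \<le> 2 * (Re k / 2) powr (- m) * J" using J0 by simp
  fix x :: real assume x: "0 < x"
  have b: "cmod (macdonald_integrand \<nu> 0 (complex_of_real x * k) t) \<le> D x * exp (- ((m - \<nu>) * t))" if t: "0 < t" for t
  proof -
    have y: "0 < x * Re k * (exp t / 2)" using x k by simp
    have ch: "exp t / 2 \<le> cosh t" by (simp add: cosh_def)
    have n: "cmod (macdonald_integrand \<nu> 0 (complex_of_real x * k) t) = cosh (\<nu> * t) * exp (- (x * Re k * cosh t))"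
      unfolding macdonald_integrand_def norm_mult norm_of_real norm_exp_eq_Re by (simp add: mult_ac)
    have "exp (- (x * Re k * cosh t)) \<le> exp (- (x * Re k * (exp t / 2)))"
      using mult_left_mono[OF ch, of "x * Re k"] x k by simp
    also have "\<dots> \<le> 2 * (x * Re k * (exp t / 2)) powr (- m)"
      by (rule exp_minus_le_powr[OF y]) (use m \<nu> in auto)
    also have "(x * Re k * (exp t / 2)) powr (- m) = ((Re k / 2 * x) * exp t) powr (- m)" by (simp add: mult_ac)
    also have "\<dots> = (Re k / 2 * x) powr (- m) * exp (- (m * t))"
      using x k powr_mult[of "Re k / 2 * x" "exp t" "- m"] exp_powr_real[of t "- m"] by (simp add: mult.commute)
    finally have 1: "exp (- (x * Re k * cosh t)) \<le> D x * exp (- (m * t))" by (simp add: D_def)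
    have 2: "cosh (\<nu> * t) \<le> exp (\<nu> * t)"
    proof -
      have "exp (- (\<nu> * t)) \<le> exp (\<nu> * t)" using \<nu> t by simp
      then show ?thesis by (simp add: cosh_def)
    qed
    have "cosh (\<nu> * t) * exp (- (x * Re k * cosh t)) \<le> exp (\<nu> * t) * (D x * exp (- (m * t)))"
      by (rule mult_mono[OF 2 1]) auto
    also have "\<dots> = D x * exp (- ((m - \<nu>) * t))" by (simp add: algebra_simps flip: exp_add)
    finally show ?thesis unfolding n .
  qed
  have "cmod (macdonald_moment \<nu> 0 (complex_of_real x * k)) \<le> (LINT t|half_line. D x * exp (- ((m - \<nu>) * t)))"
    unfolding macdonald_moment_def
  proof (rule order_trans[OF integral_norm_bound], rule integral_mono_AE')
    show "integrable half_line (\<lambda>t. D x * exp (- ((m - \<nu>) * t)))" using Ji by simp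
    show "AE t in half_line. cmod (macdonald_integrand \<nu> 0 (complex_of_real x * k) t) \<le> D x * exp (- ((m - \<nu>) * t))"
      by (rule AE_half_line_I) (rule b)
  qed (auto simp: D_def)
  also have "\<dots> = D x * J" by (simp add: J_def)
  also have "D x = 2 * ((Re k / 2) powr (- m) * x powr (- m))"
    unfolding D_def using powr_mult[of "Re k / 2" x "- m"] x k by simp
  finally show "cmod (macdonald_moment \<nu> 0 (complex_of_real x * k)) \<le> 2 * (Re k / 2) powr (- m) * J * x powr (- m)"
    by (simp only: mult_ac)
qed

lemma square_integrable_powr_at_top:
  assumes a: "a < - 1 / 2"
  shows "square_integrable (\<lambda>x. complex_of_real (if x \<le> 1 then 0 else x powr a))"
proof -
  have "((\<lambda>x::real. x powr (2 * a)) has_integral - (1 powr (2 * a + 1)) / (2 * a + 1)) {1..}"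
    by (rule has_integral_powr_to_inf) (use a in auto)
  then have "(\<lambda>x::real. x powr (2 * a)) absolutely_integrable_on {1..}"
    by (intro nonnegative_absolutely_integrable_1) auto
  then have "(\<lambda>x::real. x powr (2 * a)) absolutely_integrable_on {1<..}"
    by (rule set_integrable_subset) auto
  moreover have "(\<lambda>x. indicator {1<..} x *\<^sub>R x powr (2 * a))
      = (\<lambda>x. indicator {0<..} x *\<^sub>R (cmod (complex_of_real (if x \<le> 1 then 0 else x powr a)))\<^sup>2)"
    by (rule ext) (auto simp: indicator_def power2_eq_square simp flip: powr_add)
  ultimately have 1: "integrable half_line (\<lambda>x. (cmod (complex_of_real (if x \<le> 1 then 0 else x powr a)))\<^sup>2)"
    unfolding integrable_half_line_iff set_integrable_def by (simp only:)
  have "(\<lambda>x::real. if x \<le> 1 then 0 else x powr a) \<in> borel_measurable borel" by measurable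
  then have "(\<lambda>x::real. if x \<le> 1 then 0 else x powr a) \<in> borel_measurable half_line"
    by (intro measurable_restrict_space1) (simp add: measurable_completion)
  then have "(\<lambda>x. complex_of_real (if x \<le> 1 then 0 else x powr a)) \<in> borel_measurable half_line"
    by measurable
  with 1 show ?thesis by (simp add: square_integrable_def)
qed

text \<open>Macdonald's function is holomorphic in the right half-plane and positive at \<open>1\<close>, so it cannot
  vanish on a whole ray.\<close>
lemma macdonald_nonzero:
  assumes \<nu>: "0 \<le> \<nu>" "\<nu> \<le> 1" and k: "0 < Re k"
  obtains x where "0 < x" "macdonald_moment \<nu> 0 (complex_of_real x * k) \<noteq> 0"
proof (rule ccontr)
  assume "\<not> thesis"
  with that have z: "macdonald_moment \<nu> 0 (complex_of_real x * k) = 0" if "0 < x" for x using that by blast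
  let ?S = "{w. 0 < Re w}"
  have hol: "macdonald_moment \<nu> 0 holomorphic_on ?S"
    by (rule holomorphic_onI) (use macdonald_moment_deriv[OF \<nu>] in \<open>auto simp: field_differentiable_def intro: DERIV_subset\<close>)
  have "macdonald_moment \<nu> 0 1 = 0"
  proof (rule analytic_continuation[OF hol, where U="(\<lambda>x. complex_of_real x * k) ` {0<..}" and \<xi>=k])
    show "open ?S" by (rule open_halfspace_Re_gt)
    show "connected ?S" by (rule convex_connected[OF convex_halfspace_Re_gt])
    show "(\<lambda>x. complex_of_real x * k) ` {0<..} \<subseteq> ?S" using k by auto
    show "k islimpt (\<lambda>x. complex_of_real x * k) ` {0<..}"
      unfolding islimpt_approachable
    proof (intro allI impI)
      fix e :: real assume e: "0 < e"
      have k0: "k \<noteq> 0" using k by auto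
      define d where "d = e / (2 * cmod k)"
      have d: "0 < d" using e k0 by (simp add: d_def)
      have "complex_of_real (1 + d) * k - k = complex_of_real d * k" by (simp add: algebra_simps)
      then have "dist (complex_of_real (1 + d) * k) k = d * cmod k" using d by (simp add: dist_norm norm_mult)
      also have "\<dots> < e" using e k0 by (simp add: d_def)
      finally have "dist (complex_of_real (1 + d) * k) k < e" .
      moreover have "complex_of_real (1 + d) * k \<noteq> k" using d k0 by (simp add: algebra_simps)
      ultimately have calculation: "complex_of_real (1 + d) * k \<noteq> k \<and> dist (complex_of_real (1 + d) * k) k < e" by blast
      show "\<exists>x'\<in>(\<lambda>x. complex_of_real x * k) ` {0<..}. x' \<noteq> k \<and> dist x' k < e"
      proof -
        have "complex_of_real (1 + d) * k \<in> (\<lambda>x. complex_of_real x * k) ` {0<..}"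
          by (rule image_eqI[of _ _ "1 + d"]) (use d in auto)
        then show ?thesis using calculation by blast
      qed
    qed
  qed (use z k in auto)
  define h where "h t = cosh (\<nu> * t) * exp (- cosh t)" for t :: real
  have hk: "macdonald_integrand \<nu> 0 1 = (\<lambda>t. complex_of_real (h t))"
    by (rule ext) (simp add: macdonald_integrand_def h_def exp_of_real flip: of_real_minus)
  have "integrable half_line (\<lambda>t. complex_of_real (h t))"
    using integrable_macdonald_integrand[OF \<nu>, of 1 0] by (simp add: hk)
  then have hi: "integrable half_line h" using integrable_Re by fastforce
  have "complex_of_real (LINT t|half_line. h t) = macdonald_moment \<nu> 0 1"
    unfolding macdonald_moment_def hk by (rule integral_complex_of_real[symmetric])
  then have "(LINT t|half_line. h t) = 0" using \<open>macdonald_moment \<nu> 0 1 = 0\<close> by simp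
  moreover have "0 < h t" for t unfolding h_def by (simp add: cosh_real_pos)
  ultimately have "AE t in half_line. h t = 0"
    using integral_nonneg_eq_0_iff_AE[OF hi] by (simp add: less_imp_le)
  then obtain N where N: "negligible N" "\<forall>t>0. t \<notin> N \<longrightarrow> h t = 0" unfolding AE_half_line_iff by blast
  then have "{0<..} \<subseteq> N" using \<open>\<And>t. 0 < h t\<close> by (metis greaterThan_iff less_irrefl subsetI)
  then have "negligible ({0<..} :: real set)" using N negligible_subset by blast
  moreover have "\<not> negligible ({0<..} :: real set)"
    by (rule open_not_negligible) (auto intro!: exI[of _ 1])
  ultimately show False by blast
qed

text \<open>The modified Bessel equation for \<open>K\<^sub>\<nu>\<close> says that \<open>f =
  x\<^sup>1\<^sup>/\<^sup>2 K\<^sub>\<nu>(k x)\<close> satisfies \<open>f'' = V f + k\<^sup>2 f\<close>.\<close>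
lemma deficiency_element:
  assumes \<nu>: "0 \<le> \<nu>" "\<nu> < 1" and k: "0 < Re k"
  obtains u where "u \<noteq> 0" "(u, cscale (- (k\<^sup>2)) u) \<in> bessel_max \<nu>"
proof -
  have \<nu>1: "\<nu> \<le> 1" using \<nu> by simp
  let ?K = "\<lambda>n x. macdonald_moment \<nu> n (complex_of_real x * k)"
  define f where "f x = complex_of_real (x powr (1/2)) * ?K 0 x" for x
  define f' where "f' x = complex_of_real (1/2 * x powr (- 1/2)) * ?K 0 x - complex_of_real (x powr (1/2)) * (k * ?K 1 x)" for x
  have pd: "((\<lambda>x. complex_of_real (x powr a)) has_vector_derivative complex_of_real (a * x powr (a - 1))) (at x)" if "0 < x" for a x
    by (rule bounded_linear.has_vector_derivative[OF bounded_linear_of_real])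
      (use has_real_derivative_powr[OF that] in \<open>simp add: has_real_derivative_iff_has_vector_derivative\<close>)
  have Kd: "((\<lambda>x. ?K n x) has_vector_derivative - (k * ?K (Suc n) x)) (at x)" if "0 < x" for n x
  proof -
    have A: "((\<lambda>x. complex_of_real x * k) has_vector_derivative k) (at x)"
    proof -
      have "((\<lambda>x. complex_of_real x) has_vector_derivative complex_of_real 1) (at x)"
        by (rule bounded_linear.has_vector_derivative[OF bounded_linear_of_real]) (rule has_vector_derivative_id)
      from has_vector_derivative_mult_left[OF this, of k] show ?thesis by simp
    qed
    have "0 < Re (complex_of_real x * k)" using that k by simp
    from macdonald_moment_deriv[OF \<nu>(1) \<nu>1 this]
    have "(macdonald_moment \<nu> n has_field_derivative - ?K (Suc n) x) (at (complex_of_real x * k))" .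
    from field_vector_diff_chain_at[OF A this] show ?thesis by (simp add: o_def)
  qed
  have fd: "(f has_vector_derivative f' x) (at x)" if x: "0 < x" for x
    using has_vector_derivative_mult[OF pd[OF x, of "1/2"] Kd[OF x, of 0]] unfolding f_def f'_def by (simp add: algebra_simps)
  define f'' where "f'' x = (complex_of_real (1/2 * x powr (- 1/2)) * (- (k * ?K 1 x)) + complex_of_real (1/2 * (- 1/2 * x powr (- 1/2 - 1))) * ?K 0 x)
     - (complex_of_real (x powr (1/2)) * (k * - (k * ?K 2 x)) + complex_of_real (1/2 * x powr (1/2 - 1)) * (k * ?K 1 x))" for x
  have f'd: "(f' has_vector_derivative f'' x) (at x)" if x: "0 < x" for x
  proof -
    have "((\<lambda>x. complex_of_real (1/2) * complex_of_real (x powr (- 1/2))) has_vector_derivative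
       complex_of_real (1/2) * complex_of_real (- 1/2 * x powr (- 1/2 - 1))) (at x)"
      by (rule has_vector_derivative_mult_right[OF pd[OF x]])
    then have 1: "((\<lambda>x. complex_of_real (1/2 * x powr (- 1/2))) has_vector_derivative
       complex_of_real (1/2 * (- 1/2 * x powr (- 1/2 - 1)))) (at x)" by (simp only: of_real_mult)
    have 2: "((\<lambda>x. k * ?K 1 x) has_vector_derivative k * - (k * ?K 2 x)) (at x)"
      using has_vector_derivative_mult_right[OF Kd[OF x, of 1], of k] by (simp add: numeral_2_eq_2)
    show ?thesis unfolding f'_def f''_def
      using has_vector_derivative_diff[OF has_vector_derivative_mult[OF 1 Kd[OF x, of 0]] has_vector_derivative_mult[OF pd[OF x, of "1/2"] 2]]
      by simp
  qed
  have eq: "f'' x = complex_of_real (bessel_V \<nu> x) * f x + k\<^sup>2 * f x" if x: "0 < x" for x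
  proof -
    define X where "X = complex_of_real (x powr (- 3/2))"
    define Y where "Y = complex_of_real x"
    have Y0: "Y \<noteq> 0" using x by (simp add: Y_def)
    have p: "x powr (- 1/2) = x powr (- 3/2) * x" "x powr (1/2) = x powr (- 3/2) * x\<^sup>2" "x powr (1/2 - 1) = x powr (- 3/2) * x"
      "x powr (- 1/2 - 1) = x powr (- 3/2)"
      using x powr_add[of x "- 3/2" 1] powr_add[of x "- 3/2" 2] by (simp_all add: powr_numeral)
    have Ke: "(Y * k)\<^sup>2 * ?K 2 x = Y * k * ?K 1 x + ((Y * k)\<^sup>2 + (complex_of_real \<nu>)\<^sup>2) * ?K 0 x"
      using macdonald_equation[OF \<nu>(1) \<nu>1, of "complex_of_real x * k"] x k unfolding Y_def by (simp add: algebra_simps)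
    have "f'' x = X * ((Y * k)\<^sup>2 * ?K 2 x - Y * k * ?K 1 x - ?K 0 x / 4)"
      unfolding f''_def p X_def Y_def by (simp add: algebra_simps power2_eq_square)
    also have "\<dots> = X * (((Y * k)\<^sup>2 + (complex_of_real \<nu>)\<^sup>2) * ?K 0 x - ?K 0 x / 4)"
      unfolding Ke by (simp add: algebra_simps)
    also have "\<dots> = complex_of_real (bessel_V \<nu> x) * (X * Y\<^sup>2 * ?K 0 x) + k\<^sup>2 * (X * Y\<^sup>2 * ?K 0 x)"
      using Y0 unfolding bessel_V_def by (simp add: Y_def[symmetric] field_simps power2_eq_square)
    also have "X * Y\<^sup>2 * ?K 0 x = f x" unfolding f_def p X_def Y_def by simp
    finally show ?thesis .
  qed
  have fc: "continuous_on {0<..} f" by (rule has_vector_derivative_imp_continuous_on[OF fd])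
  have "continuous_on {0<..} f''"
    by (rule continuous_on_eq[where f="\<lambda>x. complex_of_real (bessel_V \<nu> x) * f x + k\<^sup>2 * f x"])
      (intro continuous_intros continuous_on_bessel_V fc, simp add: eq)
  then have "primitive f' f''" using f'd by (intro primitive_of_C1)
  then have "primitive f' (\<lambda>x. complex_of_real (bessel_V \<nu> x) * f x - (- (k\<^sup>2) * f x))"
    by (rule primitive_cong_AE) (auto intro!: AE_half_line_I simp: eq)
  then have pair: "bessel_pair \<nu> f f' (\<lambda>x. - (k\<^sup>2) * f x)" unfolding bessel_pair_def using fd by blast
  \<comment> \<open>strictly between \<open>\<nu>\<close>, where the bound on \<open>K\<^sub>\<nu>\<close> breaks down, and \<open>1\<close>, where \<open>f\<close> stops being square-integrable\<close>
  define m where "m = (1 + \<nu>) / 2"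
  have m: "\<nu> < m" "m < 1" using \<nu> by (auto simp: m_def)
  obtain C1 where C1: "0 \<le> C1" "\<And>x. 0 < x \<Longrightarrow> cmod (?K 0 x) \<le> C1 * x powr (- m)"
  proof (rule macdonald_bound[OF \<nu>(1) m(1) _ k])
    show "m \<le> 2" using m by simp
  qed (rule that; assumption)
  obtain C2 where C2: "0 \<le> C2" "\<And>x. 0 < x \<Longrightarrow> cmod (?K 0 x) \<le> C2 * x powr (- 2)"
  proof (rule macdonald_bound[OF \<nu>(1) _ _ k, of 2])
    show "\<nu> < 2" using \<nu> by simp
    show "(2::real) \<le> 2" by simp
  qed (rule that; assumption)
  define w where "w x = complex_of_real C1 * complex_of_real (if x \<le> 1 then x powr (1/2 - m) else 0)
     + complex_of_real C2 * complex_of_real (if x \<le> 1 then 0 else x powr (- 3/2))" for x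
  have wsq: "square_integrable w" unfolding w_def
    by (intro square_integrable_add square_integrable_scale square_integrable_powr_near_0 square_integrable_powr_at_top)
      (use m in auto)
  have fsq: "square_integrable f"
  proof (rule square_integrable_bound[OF continuous_imp_half_line_measurable[OF fc] wsq, where C=1], rule AE_half_line_I)
    fix x :: real assume x: "0 < x"
    have n: "cmod (f x) = x powr (1/2) * cmod (?K 0 x)" by (simp add: f_def norm_mult)
    have p: "x powr (1/2) * x powr (- m) = x powr (1/2 - m)" "x powr (1/2) * x powr (- 2) = x powr (- 3/2)"
      using x by (simp_all flip: powr_add)
    show "cmod (f x) \<le> 1 * cmod (w x)"
    proof (cases "x \<le> 1")
      case True
      have "cmod (f x) \<le> x powr (1/2) * (C1 * x powr (- m))" unfolding n by (intro mult_left_mono C1 x) simp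
      also have "\<dots> = C1 * x powr (1/2 - m)" unfolding p[symmetric] by simp
      also have "\<dots> = cmod (w x)" using True C1 by (simp add: w_def norm_mult)
      finally show ?thesis by simp
    next
      case False
      have "cmod (f x) \<le> x powr (1/2) * (C2 * x powr (- 2))" unfolding n by (intro mult_left_mono C2 x) simp
      also have "\<dots> = C2 * x powr (- 3/2)" unfolding p[symmetric] by simp
      also have "\<dots> = cmod (w x)" using False C2 by (simp add: w_def norm_mult)
      finally show ?thesis by simp
    qed
  qed
  show thesis
  proof
    show "(L2_class f, cscale (- (k\<^sup>2)) (L2_class f)) \<in> bessel_max \<nu>"
      unfolding L2_class_ops(3)[OF fsq] by (rule bessel_maxI[OF fsq square_integrable_scale[OF fsq] pair])
    show "L2_class f \<noteq> 0"
    proof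
      assume "L2_class f = 0"
      then have ae: "AE x in half_line. f x = 0"
        using L2_class_eq_iff[OF fsq square_integrable_zero] by (simp add: L2_class_ops)
      obtain x where x: "0 < x" "?K 0 x \<noteq> 0" using macdonald_nonzero[OF \<nu>(1) \<nu>1 k] by blast
      have "f x = 0" by (rule AE_half_line_continuous_eq[OF fc continuous_on_const ae x(1)])
      with x show False by (simp add: f_def)
    qed
  qed
qed

section \<open>Domains and deficiency indices\<close>

text \<open>The form that measures by how much two elements of the maximal operator fail to be symmetric.\<close>
definition boundary_form :: "half_line_L2 \<times> half_line_L2 \<Rightarrow> half_line_L2 \<times> half_line_L2 \<Rightarrow> complex" where
  "boundary_form p q = cinner (fst p) (snd q) - cinner (snd p) (fst q)"

lemma cutoff_cnj:
  assumes "cutoff \<xi> \<xi>' \<xi>'' B"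
  shows "cutoff (\<lambda>x. cnj (\<xi> x)) (\<lambda>x. cnj (\<xi>' x)) (\<lambda>x. cnj (\<xi>'' x)) B"
  using assms unfolding cutoff_def
  by (auto intro!: bounded_linear.has_vector_derivative[OF bounded_linear_cnj] square_integrable_cnj
      primitive_linear[OF _ bounded_linear_cnj])

lemma boundary_form_value:
  assumes c: "cutoff \<xi> \<xi>' \<xi>'' B" and s: "bessel_pair \<nu> (\<lambda>x. complex_of_real (s x)) s' (\<lambda>x. 0)"
    and s': "\<And>x. cnj (s' x) = s' x"
    and sL2: "\<And>b. square_integrable (\<lambda>x. if x \<le> b then complex_of_real (s x) else 0)"
  defines "h \<equiv> \<lambda>x. complex_of_real (s x) * \<xi> x"
    and "k \<equiv> \<lambda>x. - (2 * (s' x * \<xi>' x) + complex_of_real (s x) * \<xi>'' x)"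
  assumes f: "bessel_pair \<nu> f f' g" and fsq: "square_integrable f" and gsq: "square_integrable g"
    and L: "\<And>x. 0 < x \<Longrightarrow> f x * s' x - f' x * complex_of_real (s x) = L + integral {0..x} (\<lambda>t. g t * complex_of_real (s t))"
  shows "boundary_form (L2_class f, L2_class g) (L2_class h, L2_class k) = L"
proof -
  note cs = cutoff_solution[OF c s sL2]
  have hk: "square_integrable h" "square_integrable k" unfolding h_def k_def using cs by auto
  have "L = (LINT x|half_line. f x * (- (2 * (s' x * cnj (\<xi>' x)) + complex_of_real (s x) * cnj (\<xi>'' x))))
      - (LINT x|half_line. g x * (complex_of_real (s x) * cnj (\<xi> x)))"
    by (rule boundary_value_formula[OF cutoff_cnj[OF c] s sL2 f fsq gsq L])
  also have "(\<lambda>x. f x * (- (2 * (s' x * cnj (\<xi>' x)) + complex_of_real (s x) * cnj (\<xi>'' x)))) = (\<lambda>x. f x * cnj (k x))"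
    by (simp add: k_def s')
  also have "(\<lambda>x. g x * (complex_of_real (s x) * cnj (\<xi> x))) = (\<lambda>x. g x * cnj (h x))"
    by (simp add: h_def)
  finally show ?thesis by (simp add: boundary_form_def L2_class_ops fsq gsq hk)
qed

text \<open>The forms with the two cut-off solutions are the two boundary values at zero. They detect
  \<open>H02\<close>, and their matrix on the cut-off solutions themselves is invertible: its entries are the Wronskians
  of the two solutions with one another.\<close>
lemma boundary_forms_at_zero:
  assumes \<nu>: "0 \<le> \<nu>" "\<nu> < 1" and c: "cutoff \<xi> \<xi>' \<xi>'' B"
  obtains K1 K2 where
    "(L2_class (\<lambda>x. complex_of_real (sol_pos \<nu> x) * \<xi> x), K1) \<in> bessel_max \<nu>"
    "(L2_class (\<lambda>x. complex_of_real (sol_neg \<nu> x) * \<xi> x), K2) \<in> bessel_max \<nu>"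
    "\<And>p. p \<in> bessel_max \<nu> \<Longrightarrow>
       boundary_form p (L2_class (\<lambda>x. complex_of_real (sol_pos \<nu> x) * \<xi> x), K1) = 0 \<Longrightarrow>
       boundary_form p (L2_class (\<lambda>x. complex_of_real (sol_neg \<nu> x) * \<xi> x), K2) = 0 \<Longrightarrow> fst p \<in> H02"
    "boundary_form (L2_class (\<lambda>x. complex_of_real (sol_pos \<nu> x) * \<xi> x), K1) (L2_class (\<lambda>x. complex_of_real (sol_pos \<nu> x) * \<xi> x), K1) = 0"
    "boundary_form (L2_class (\<lambda>x. complex_of_real (sol_neg \<nu> x) * \<xi> x), K2) (L2_class (\<lambda>x. complex_of_real (sol_pos \<nu> x) * \<xi> x), K1) \<noteq> 0"
    "boundary_form (L2_class (\<lambda>x. complex_of_real (sol_pos \<nu> x) * \<xi> x), K1) (L2_class (\<lambda>x. complex_of_real (sol_neg \<nu> x) * \<xi> x), K2) \<noteq> 0"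
    "boundary_form (L2_class (\<lambda>x. complex_of_real (sol_neg \<nu> x) * \<xi> x), K2) (L2_class (\<lambda>x. complex_of_real (sol_neg \<nu> x) * \<xi> x), K2) = 0"
proof -
  let ?p = "\<lambda>x. complex_of_real (sol_pos \<nu> x)" and ?p' = "\<lambda>x. complex_of_real (sol_pos' \<nu> x)"
  let ?n = "\<lambda>x. complex_of_real (sol_neg \<nu> x)" and ?n' = "\<lambda>x. complex_of_real (sol_neg' \<nu> x)"
  define k1 where "k1 x = - (2 * (?p' x * \<xi>' x) + ?p x * \<xi>'' x)" for x
  define k2 where "k2 x = - (2 * (?n' x * \<xi>' x) + ?n x * \<xi>'' x)" for x
  note p = bessel_pair_sol_pos[of \<nu>] sol_pos_L2_near_0[OF \<nu>(1)]
  note n = bessel_pair_sol_neg[of \<nu>] sol_neg_L2_near_0[OF \<nu>]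
  note cp = cutoff_solution[OF c p, folded k1_def]
  note cn = cutoff_solution[OF c n, folded k2_def]
  have one: "\<And>x. 0 < x \<Longrightarrow> x \<le> 1 \<Longrightarrow> \<xi> x = 1" using c unfolding cutoff_def by auto
  let ?P = "(L2_class (\<lambda>x. ?p x * \<xi> x), L2_class k1)" and ?N = "(L2_class (\<lambda>x. ?n x * \<xi> x), L2_class k2)"
  have vp: "boundary_form (L2_class f, L2_class g) ?P = L"
    if "bessel_pair \<nu> f f' g" "square_integrable f" "square_integrable g"
      "\<And>x. 0 < x \<Longrightarrow> f x * ?p' x - f' x * ?p x = L + integral {0..x} (\<lambda>t. g t * ?p t)" for f f' g L
    using boundary_form_value[OF c p(1) _ p(2) that] unfolding k1_def by simp
  have vn: "boundary_form (L2_class f, L2_class g) ?N = L"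
    if "bessel_pair \<nu> f f' g" "square_integrable f" "square_integrable g"
      "\<And>x. 0 < x \<Longrightarrow> f x * ?n' x - f' x * ?n x = L + integral {0..x} (\<lambda>t. g t * ?n t)" for f f' g L
    using boundary_form_value[OF c n(1) _ n(2) that] unfolding k2_def by simp
  have m: "?P \<in> bessel_max \<nu>" "?N \<in> bessel_max \<nu>"
    by (rule bessel_maxI[OF cp(2,3,1)], rule bessel_maxI[OF cn(2,3,1)])
  have z: "fst q \<in> H02" if q: "q \<in> bessel_max \<nu>" "boundary_form q ?P = 0" "boundary_form q ?N = 0" for q
  proof -
    obtain f f' g where f: "square_integrable f" "square_integrable g" "fst q = L2_class f" "snd q = L2_class g"
      "bessel_pair \<nu> f f' g"
    proof -
      have "(fst q, snd q) \<in> bessel_max \<nu>" using q(1) by simp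
      then show thesis by (rule bessel_max_cases) (rule that; assumption)
    qed
    have q_eq: "q = (L2_class f, L2_class g)" using f by (metis prod.collapse)
    obtain L1 where L1: "\<And>x. 0 < x \<Longrightarrow> f x * ?p' x - f' x * ?p x = L1 + integral {0..x} (\<lambda>t. g t * ?p t)"
      using wronskian_boundary[OF f(5,2) p] by blast
    obtain L2 where L2: "\<And>x. 0 < x \<Longrightarrow> f x * ?n' x - f' x * ?n x = L2 + integral {0..x} (\<lambda>t. g t * ?n t)"
      using wronskian_boundary[OF f(5,2) n] by blast
    have "L1 = 0" "L2 = 0" using vp[OF f(5,1,2) L1] vn[OF f(5,1,2) L2] q(2,3) q_eq by auto
    then show ?thesis
      using zero_boundary_imp_H02[OF \<nu> f(5,1,2)] L1 L2 f(3) by simp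
  qed
  \<comment> \<open>near zero the cut-off solutions coincide with the solutions, so the Wronskian is the constant one\<close>
  have val: "boundary_form (L2_class (\<lambda>x. s x * \<xi> x), L2_class k) Q = W"
    if sk: "bessel_pair \<nu> (\<lambda>x. s x * \<xi> x) (\<lambda>x. s' x * \<xi> x + s x * \<xi>' x) k"
      and sq: "square_integrable (\<lambda>x. s x * \<xi> x)" "square_integrable k"
      and r: "bessel_pair \<nu> r r' (\<lambda>x. 0)" "\<And>b. square_integrable (\<lambda>x. if x \<le> b then r x else 0)"
      and Q: "\<And>L. (\<And>x. 0 < x \<Longrightarrow> (s x * \<xi> x) * r' x - (s' x * \<xi> x + s x * \<xi>' x) * r x = L + integral {0..x} (\<lambda>t. k t * r t)) \<Longrightarrow>
        boundary_form (L2_class (\<lambda>x. s x * \<xi> x), L2_class k) Q = L"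
      and W: "\<And>x. 0 < x \<Longrightarrow> s x * r' x - s' x * r x = W" for s s' k r r' Q W
  proof -
    obtain L where L: "\<And>x. 0 < x \<Longrightarrow> (s x * \<xi> x) * r' x - (s' x * \<xi> x + s x * \<xi>' x) * r x = L + integral {0..x} (\<lambda>t. k t * r t)"
      using wronskian_boundary[OF sk sq(2) r] by blast
    have "L = W"
    proof (rule primitive_boundary_limit[OF L absolutely_integrable_mult_L2_near_0[OF sq(2) r(2)]])
      have "\<forall>\<^sub>F x in at_right 0. W = (s x * \<xi> x) * r' x - (s' x * \<xi> x + s x * \<xi>' x) * r x"
        using eventually_at_right_real[OF zero_less_one]
      proof eventually_elim
        case (elim x)
        then show ?case using one[of x] cutoff_derivative_0[OF c, of x] W[of x] by simp
      qed
      then show "((\<lambda>x. (s x * \<xi> x) * r' x - (s' x * \<xi> x + s x * \<xi>' x) * r x) \<longlongrightarrow> W) (at_right 0)"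
        by (rule tendsto_eventually[OF eventually_mono]) simp
    qed
    with Q[OF L] show ?thesis by simp
  qed
  have w: "?p x * ?n' x - ?p' x * ?n x = complex_of_real (sol_wronskian \<nu>)" if "0 < x" for x
    using arg_cong[OF wronskian_sol_pos_sol_neg[OF that, of \<nu>], of complex_of_real] by simp
  then have w': "?n x * ?p' x - ?n' x * ?p x = - complex_of_real (sol_wronskian \<nu>)" if "0 < x" for x
    using w[OF that] by (simp add: algebra_simps eq_neg_iff_add_eq_0)
  have e1: "boundary_form ?P ?P = 0"
    by (rule val[OF cp(1,2,3) p vp[OF cp(1,2,3)]]) simp_all
  have e2: "boundary_form ?N ?P = - complex_of_real (sol_wronskian \<nu>)"
    by (rule val[OF cn(1,2,3) p vp[OF cn(1,2,3)]]) (simp_all add: w' del: of_real_mult)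
  have e3: "boundary_form ?P ?N = complex_of_real (sol_wronskian \<nu>)"
    by (rule val[OF cp(1,2,3) n vn[OF cp(1,2,3)]]) (simp_all add: w del: of_real_mult)
  have e4: "boundary_form ?N ?N = 0"
    by (rule val[OF cn(1,2,3) n vn[OF cn(1,2,3)]]) simp_all
  show thesis
    by (rule that[OF m z e1 _ _ e4]) (use e2 e3 sol_wronskian_nonzero[of \<nu>] in simp_all)
qed

text \<open>By Green's formula both boundary values vanish on the minimal operator, which gives one inclusion; the
  other one is \<open>H02_subset_bessel_min\<close>.\<close>
lemma Domain_bessel_min:
  assumes \<nu>: "0 \<le> \<nu>" "\<nu> < 1" and c: "cutoff \<xi> \<xi>' \<xi>'' B"
  shows "Domain (bessel_min \<nu>) = H02"
proof
  show "H02 \<subseteq> Domain (bessel_min \<nu>)" using H02_subset_bessel_min by blast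
  show "Domain (bessel_min \<nu>) \<subseteq> H02"
  proof
    fix u assume "u \<in> Domain (bessel_min \<nu>)"
    then obtain v where uv: "(u, v) \<in> bessel_min \<nu>" by blast
    show "u \<in> H02"
    proof (rule boundary_forms_at_zero[OF \<nu> c])
      fix K1 K2 :: half_line_L2
      let ?P = "(L2_class (\<lambda>x. complex_of_real (sol_pos \<nu> x) * \<xi> x), K1)"
      let ?N = "(L2_class (\<lambda>x. complex_of_real (sol_neg \<nu> x) * \<xi> x), K2)"
      assume P: "?P \<in> bessel_max \<nu>" and N: "?N \<in> bessel_max \<nu>"
        and Z: "\<And>p. p \<in> bessel_max \<nu> \<Longrightarrow> boundary_form p ?P = 0 \<Longrightarrow> boundary_form p ?N = 0 \<Longrightarrow> fst p \<in> H02"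
      have "boundary_form (u, v) ?P = 0" "boundary_form (u, v) ?N = 0"
        using bessel_min_green[OF uv P] bessel_min_green[OF uv N] by (simp_all add: boundary_form_def)
      with Z[of "(u, v)"] uv bessel_min_subset_max show "u \<in> H02" by auto
    qed
  qed
qed

lemma cscale_0: "cscale 0 u = 0" "cscale c 0 = 0"
  by (rule L2.scale_zero_left, rule L2.scale_zero_right)

lemma cscale_eq_0: "cscale c u = 0 \<longleftrightarrow> c = 0 \<or> u = 0"
  by (rule L2.scale_eq_0_iff)

lemma H02_boundary_0:
  assumes \<nu>: "0 \<le> \<nu>" "\<nu> < 1" and c: "cutoff \<xi> \<xi>' \<xi>'' B"
    and m: "(u, v) \<in> bessel_max \<nu>" and u: "u \<in> H02" and q: "q \<in> bessel_max \<nu>"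
  shows "boundary_form (u, v) q = 0"
proof -
  obtain v' where v': "(u, v') \<in> bessel_min \<nu>" using u Domain_bessel_min[OF \<nu> c] by blast
  then have "v = v'" using bessel_max_unique[OF m] bessel_min_subset_max by blast
  with bessel_min_green[OF v', of "fst q" "snd q"] q show ?thesis by (simp add: boundary_form_def)
qed

text \<open>The two boundary values of \<open>u\<close> determine the combination of cut-off solutions to
  subtract.\<close>
lemma max_domain_direct_sum:
  assumes \<nu>: "0 \<le> \<nu>" "\<nu> < 1" and c: "cutoff \<xi> \<xi>' \<xi>'' B"
  shows "is_direct_sum (Domain (bessel_max \<nu>)) H02
    (L2.span {L2_class (\<lambda>x. complex_of_real (sol_pos \<nu> x) * \<xi> x), L2_class (\<lambda>x. complex_of_real (sol_neg \<nu> x) * \<xi> x)})"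
proof (rule boundary_forms_at_zero[OF \<nu> c])
  fix K1 K2 :: half_line_L2
  let ?p = "L2_class (\<lambda>x. complex_of_real (sol_pos \<nu> x) * \<xi> x)"
  let ?n = "L2_class (\<lambda>x. complex_of_real (sol_neg \<nu> x) * \<xi> x)"
  let ?P = "(?p, K1)" and ?N = "(?n, K2)"
  assume P: "?P \<in> bessel_max \<nu>" and N: "?N \<in> bessel_max \<nu>"
    and Z: "\<And>p. p \<in> bessel_max \<nu> \<Longrightarrow> boundary_form p ?P = 0 \<Longrightarrow> boundary_form p ?N = 0 \<Longrightarrow> fst p \<in> H02"
    and PP: "boundary_form ?P ?P = 0" and NP: "boundary_form ?N ?P \<noteq> 0"
    and PN: "boundary_form ?P ?N \<noteq> 0" and NN: "boundary_form ?N ?N = 0"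
  have span: "w \<in> L2.span {?p, ?n} \<longleftrightarrow> (\<exists>a b. w = cscale a ?p + cscale b ?n)" for w
    by (auto simp: L2.span_insert L2.span_empty algebra_simps)
  have comb: "(cscale a ?p + cscale b ?n, cscale a K1 + cscale b K2) \<in> bessel_max \<nu>" for a b
    by (intro bessel_max_add bessel_max_scale P N)
  have bf: "boundary_form (u + (cscale a ?p + cscale b ?n), v + (cscale a K1 + cscale b K2)) q
     = boundary_form (u, v) q + a * boundary_form ?P q + b * boundary_form ?N q" for u v a b q
    by (simp add: boundary_form_def cinner_add_left cinner_scale_left algebra_simps)
  show ?thesis
    unfolding is_direct_sum_def
  proof (intro conjI set_eqI iffI)
    fix u assume "u \<in> Domain (bessel_max \<nu>)"
    then obtain v where uv: "(u, v) \<in> bessel_max \<nu>" by blast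
    define a where "a = - boundary_form (u, v) ?N / boundary_form ?P ?N"
    define b where "b = - boundary_form (u, v) ?P / boundary_form ?N ?P"
    define y where "y = u + (cscale a ?p + cscale b ?n)"
    have "(y, v + (cscale a K1 + cscale b K2)) \<in> bessel_max \<nu>"
      unfolding y_def by (intro bessel_max_add[OF uv] comb)
    moreover have "boundary_form (y, v + (cscale a K1 + cscale b K2)) ?P = 0" "boundary_form (y, v + (cscale a K1 + cscale b K2)) ?N = 0"
      unfolding y_def bf using PP NP PN NN by (simp_all add: a_def b_def)
    ultimately have "y \<in> H02" using Z by fastforce
    moreover have "u = y + (cscale (- a) ?p + cscale (- b) ?n)"
      by (simp add: y_def L2.scale_minus_left)
    ultimately show "u \<in> {u + w |u w. u \<in> H02 \<and> w \<in> L2.span {?p, ?n}}" using span by blast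
  next
    fix u assume "u \<in> {u + w |u w. u \<in> H02 \<and> w \<in> L2.span {?p, ?n}}"
    then obtain y w where y: "u = y + w" "y \<in> H02" "w \<in> L2.span {?p, ?n}" by blast
    obtain v where "(y, v) \<in> bessel_max \<nu>" using H02_subset_bessel_min[OF y(2)] bessel_min_subset_max by blast
    moreover obtain a b where "w = cscale a ?p + cscale b ?n" using y(3) span by blast
    ultimately show "u \<in> Domain (bessel_max \<nu>)" using bessel_max_add[OF _ comb] y(1) by blast
  next
    fix w assume "w \<in> H02 \<inter> L2.span {?p, ?n}"
    then obtain a b where w: "w \<in> H02" "w = cscale a ?p + cscale b ?n" using span by blast
    have m: "(w, cscale a K1 + cscale b K2) \<in> bessel_max \<nu>" unfolding w(2) by (rule comb)
    have bf0: "boundary_form (w, cscale a K1 + cscale b K2) q = a * boundary_form ?P q + b * boundary_form ?N q" for q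
      using bf[of 0 a b 0 q] w(2) by (simp add: boundary_form_def cinner_eq_inner)
    have "a = 0" using H02_boundary_0[OF \<nu> c m w(1) N] PN NN by (simp add: bf0)
    moreover have "b = 0" using H02_boundary_0[OF \<nu> c m w(1) P] PP NP by (simp add: bf0)
    ultimately show "w \<in> {0}" using w(2) by (simp add: cscale_0)
  next
    fix w :: half_line_L2 assume "w \<in> {0}"
    moreover have "(0, 0) \<in> bessel_max \<nu>" using bessel_max_scale[OF P, of 0] by (simp add: cscale_0)
    then have "0 \<in> H02" using Z[of "(0, 0)"] by (simp add: boundary_form_def cinner_eq_inner)
    ultimately show "w \<in> H02 \<inter> L2.span {?p, ?n}" by (simp add: L2.span_zero)
  qed
qed

text \<open>Three vectors in a plane are dependent: the coefficients are the coordinates of the cross product of the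
  rows, unless that vanishes.\<close>
lemma linear_dependence_C2:
  fixes x1 x2 x3 y1 y2 y3 :: complex
  obtains a b c where "(a, b, c) \<noteq> (0, 0, 0)" "a * x1 + b * x2 + c * x3 = 0" "a * y1 + b * y2 + c * y3 = 0"
proof (cases "x2 * y3 - x3 * y2 = 0 \<and> x3 * y1 - x1 * y3 = 0 \<and> x1 * y2 - x2 * y1 = 0")
  case False
  then show thesis
    by (intro that[of "x2 * y3 - x3 * y2" "x3 * y1 - x1 * y3" "x1 * y2 - x2 * y1"])
      (blast, simp_all add: algebra_simps)
next
  case True
  then have T: "x2 * y3 = x3 * y2" "x3 * y1 = x1 * y3" "x1 * y2 = x2 * y1" by auto
  show thesis
  proof (cases "x1 = 0 \<and> x2 = 0")
    case True
    show thesis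
    proof (cases "y1 = 0 \<and> y2 = 0")
      case True then show thesis using \<open>x1 = 0 \<and> x2 = 0\<close> by (intro that[of 1 0 0]) auto
    next
      case False then show thesis using \<open>x1 = 0 \<and> x2 = 0\<close> by (intro that[of y2 "- y1" 0]) auto
    qed
  next
    case False
    then show thesis using T by (intro that[of x2 "- x1" 0]) (auto simp: algebra_simps)
  qed
qed

text \<open>Existence is \<open>deficiency_element\<close> with \<open>k\<^sup>2 = z\<close>. For uniqueness let
  \<open>w\<close> span the opposite deficiency space. The three pairs of boundary values of \<open>u0\<close>,
  \<open>u\<close> and \<open>w\<close> are dependent, which yields a combination \<open>U = y + d w\<close> in
  \<open>H02\<close>, where \<open>y\<close> combines \<open>u0\<close> and \<open>u\<close>. Pairing \<open>U\<close>
  with \<open>y\<close> and with \<open>w\<close>, as in von Neumann's decomposition, gives \<open>y = 0\<close> and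
  \<open>d = 0\<close>.\<close>
lemma dim_deficiency_space:
  assumes \<nu>: "0 \<le> \<nu>" "\<nu> < 1" and c: "cutoff \<xi> \<xi>' \<xi>'' B" and z: "z = \<i> \<or> z = - \<i>"
  shows "L2.dim (ker_shift (bessel_max \<nu>) z) = 1"
proof -
  have ex: "\<exists>u. u \<noteq> 0 \<and> (u, cscale (- w) u) \<in> bessel_max \<nu>" if w: "w = \<i> \<or> w = - \<i>" for w
  proof -
    have "0 < Re (csqrt w)"
    proof -
      have "Re (csqrt w) \<noteq> 0"
      proof
        assume "Re (csqrt w) = 0"
        then have "Im ((csqrt w)\<^sup>2) = 0" by (simp add: power2_eq_square)
        then show False using w by auto
      qed
      then show ?thesis using csqrt_principal[of w] by blast
    qed
    then obtain u where u: "u \<noteq> 0" "(u, cscale (- ((csqrt w)\<^sup>2)) u) \<in> bessel_max \<nu>"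
      by (rule deficiency_element[OF \<nu>])
    from u(2) have "(u, cscale (- w) u) \<in> bessel_max \<nu>" by (simp only: power2_csqrt)
    with u(1) show ?thesis by (intro exI[of _ u] conjI)
  qed
  from ex[OF z] obtain u0 where u0: "u0 \<noteq> 0" "(u0, cscale (- z) u0) \<in> bessel_max \<nu>"
    by (elim exE conjE)
  have "- z = \<i> \<or> - z = - \<i>" using z by auto
  from ex[OF this] obtain w where w: "w \<noteq> 0" "(w, cscale z w) \<in> bessel_max \<nu>" by auto
  have zc: "cnj z = - z" "z \<noteq> 0" using z by auto
  have mem: "u \<in> ker_shift (bessel_max \<nu>) z \<longleftrightarrow> (u, cscale (- z) u) \<in> bessel_max \<nu>" for u
    unfolding ker_shift_def by (auto simp: add_eq_0_iff2 L2.scale_minus_left)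
  have "ker_shift (bessel_max \<nu>) z \<subseteq> L2.span {u0}"
  proof
    fix u assume "u \<in> ker_shift (bessel_max \<nu>) z"
    then have u: "(u, cscale (- z) u) \<in> bessel_max \<nu>" by (simp add: mem)
    show "u \<in> L2.span {u0}"
    proof (rule boundary_forms_at_zero[OF \<nu> c])
      fix K1 K2 :: half_line_L2
      let ?P = "(L2_class (\<lambda>x. complex_of_real (sol_pos \<nu> x) * \<xi> x), K1)"
      let ?N = "(L2_class (\<lambda>x. complex_of_real (sol_neg \<nu> x) * \<xi> x), K2)"
      assume Z: "\<And>p. p \<in> bessel_max \<nu> \<Longrightarrow> boundary_form p ?P = 0 \<Longrightarrow> boundary_form p ?N = 0 \<Longrightarrow> fst p \<in> H02"
      obtain a b d where abd: "(a, b, d) \<noteq> (0, 0, 0)"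
        "a * boundary_form (u0, cscale (- z) u0) ?P + b * boundary_form (u, cscale (- z) u) ?P + d * boundary_form (w, cscale z w) ?P = 0"
        "a * boundary_form (u0, cscale (- z) u0) ?N + b * boundary_form (u, cscale (- z) u) ?N + d * boundary_form (w, cscale z w) ?N = 0"
        by (rule linear_dependence_C2)
      define y where "y = cscale a u0 + cscale b u"
      have ym: "(y, cscale (- z) y) \<in> bessel_max \<nu>"
      proof -
        have "(y, cscale a (cscale (- z) u0) + cscale b (cscale (- z) u)) \<in> bessel_max \<nu>"
          unfolding y_def by (intro bessel_max_add bessel_max_scale u0 u)
        moreover have "cscale a (cscale (- z) u0) + cscale b (cscale (- z) u) = cscale (- z) y"
          unfolding y_def by (simp only: L2.scale_right_distrib L2.scale_scale mult.commute)
        ultimately show ?thesis by simp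
      qed
      define U where "U = y + cscale d w"
      define V where "V = cscale (- z) y + cscale d (cscale z w)"
      have UV: "(U, V) \<in> bessel_max \<nu>" unfolding U_def V_def by (intro bessel_max_add bessel_max_scale ym w)
      have "boundary_form (U, V) q = a * boundary_form (u0, cscale (- z) u0) q + b * boundary_form (u, cscale (- z) u) q
          + d * boundary_form (w, cscale z w) q" for q
        unfolding U_def V_def y_def boundary_form_def fst_conv snd_conv cinner_add_left cinner_scale_left
        by (simp add: algebra_simps)
      then have "U \<in> H02" using Z[OF UV] abd(2,3) by simp
      then have B0: "boundary_form (U, V) q = 0" if "q \<in> bessel_max \<nu>" for q
        using H02_boundary_0[OF \<nu> c UV _ that] by blast
      have "cinner y y = 0"
        using B0[OF ym, unfolded boundary_form_def U_def V_def fst_conv snd_conv cinner_add_left cinner_scale_left cinner_scale_right] zc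
        by (simp add: algebra_simps)
      then have y0: "y = 0" by (rule cinner_self_eq_0)
      have "d * cinner w w = 0"
        using B0[OF w(2)] zc y0 unfolding boundary_form_def U_def V_def
        by (simp add: cinner_add_left cinner_scale_left cinner_scale_right cscale_0 algebra_simps)
      then have d0: "d = 0" using cinner_self_eq_0[of w] w(1) by auto
      have "b \<noteq> 0"
      proof
        assume "b = 0"
        with y0 have "cscale a u0 = 0" by (simp add: y_def cscale_0)
        with u0(1) have "a = 0" by (simp add: cscale_eq_0)
        with \<open>b = 0\<close> d0 abd(1) show False by simp
      qed
      have "cscale b u = cscale (- a) u0"
        using y0 unfolding y_def by (simp add: L2.scale_minus_left add_eq_0_iff)
      then have "cscale (1 / b) (cscale b u) = cscale (1 / b) (cscale (- a) u0)" by simp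
      then have "u = cscale (- a / b) u0" using \<open>b \<noteq> 0\<close> by (simp add: L2.scale_scale)
      then show "u \<in> L2.span {u0}" using L2.span_base[of u0 "{u0}"] L2.span_scale by blast
    qed
  qed
  moreover have "{u0} \<subseteq> ker_shift (bessel_max \<nu>) z" using u0(2) by (simp add: mem)
  moreover have "L2.independent {u0}" using u0(1) by (simp add: L2.dependent_single)
  ultimately show ?thesis using L2.dim_unique[of "{u0}" "ker_shift (bessel_max \<nu>) z" 1] by simp
qed

theorem theorem5p1:
  fixes \<nu> :: real and \<xi> :: "real \<Rightarrow> complex"
  assumes "0 \<le> \<nu>" and "\<nu> < 1"
    and "\<xi> \<in> C01_half_line"
    and "\<forall>x\<in>{0..1}. \<xi> x = 1"
    and "L2_class \<xi> \<in> H2"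
  shows "(deficiency_plus (bessel_min \<nu>) = 1 \<and> deficiency_minus (bessel_min \<nu>) = 1) \<and>
    Domain (bessel_min \<nu>) = H02 \<and>
    bessel_max \<nu> = adjoint_op (bessel_min \<nu>) \<and>
    (0 < \<nu> \<longrightarrow>
      is_direct_sum (Domain (adjoint_op (bessel_min \<nu>))) H02
        (L2.span {L2_class (\<lambda>x. complex_of_real (x powr (1/2 + \<nu>)) * \<xi> x),
                  L2_class (\<lambda>x. complex_of_real (x powr (1/2 - \<nu>)) * \<xi> x)})) \<and>
    (\<nu> = 0 \<longrightarrow>
      is_direct_sum (Domain (adjoint_op (bessel_min \<nu>))) H02
        (L2.span {L2_class (\<lambda>x. complex_of_real (x powr (1/2)) * \<xi> x),
                  L2_class (\<lambda>x. complex_of_real (x powr (1/2) * ln x) * \<xi> x)}))"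
proof -
  note \<nu> = assms(1,2)
  obtain \<xi>' \<xi>'' B where c: "cutoff \<xi> \<xi>' \<xi>'' B" using cutoff_exists[OF assms(3-5)] by blast
  have "deficiency_plus (bessel_min \<nu>) = 1" "deficiency_minus (bessel_min \<nu>) = 1"
    unfolding deficiency_plus_def deficiency_minus_def adjoint_bessel_min
    using dim_deficiency_space[OF \<nu> c] by simp_all
  moreover have "is_direct_sum (Domain (adjoint_op (bessel_min \<nu>))) H02
        (L2.span {L2_class (\<lambda>x. complex_of_real (x powr (1/2 + \<nu>)) * \<xi> x),
                  L2_class (\<lambda>x. complex_of_real (x powr (1/2 - \<nu>)) * \<xi> x)})" if "0 < \<nu>"
    using max_domain_direct_sum[OF \<nu> c] that unfolding adjoint_bessel_min by (simp add: sol_pos_def sol_neg_def)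
  moreover have "is_direct_sum (Domain (adjoint_op (bessel_min \<nu>))) H02
        (L2.span {L2_class (\<lambda>x. complex_of_real (x powr (1/2)) * \<xi> x),
                  L2_class (\<lambda>x. complex_of_real (x powr (1/2) * ln x) * \<xi> x)})" if "\<nu> = 0"
    using max_domain_direct_sum[OF \<nu> c] that unfolding adjoint_bessel_min by (simp add: sol_pos_def sol_neg_def)
  ultimately show ?thesis using Domain_bessel_min[OF \<nu> c] adjoint_bessel_min by blast
qed

end
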